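(* Let $k\in\mathbb{N}$ and $i_1,\ldots,i_k\in\{1,\ldots,m\}$. Suppose that $\psi_1(\tau),\ldots,\psi_k(\tau)\in L_2([t,T])$ and $\{\phi_j(x)\}_{j=0}^{\infty}$ is an arbitrary complete orthonormal system of functions in the space $L_2([t,T])$. Then $$\mathsf{M}\left\{\left(J[\psi^{(k)}]_{T,t}-J[\psi^{(k)}]_{T,t}^p\right)^2\right\}=\int_{[t,T]^k}K^2(t_1,\ldots,t_k)\,dt_1\ldots dt_k$$ $$-\sum_{j_1=0}^{p}\ldots\sum_{j_k=0}^{p}C_{j_k\ldots j_1}\,\mathsf{M}\left\{J[\psi^{(k)}]_{T,t}\sum_{(j_1,\ldots,j_k)}\int_t^T\phi_{j_k}(t_k)\ldots\int_t^{t_2}\phi_{j_1}(t_1)\,d\mathbf{f}_{t_1}^{(i_1)}\ldots d\mathbf{f}_{t_k}^{(i_k)}\right\},$$ where $$J[\psi^{(k)}]_{T,t}=\int_t^T\psi_k(t_k)\ldots\int_t^{t_2}\psi_1(t_1)\,d\mathbf{f}_{t_1}^{(i_1)}\ldots d\mathbf{f}_{t_k}^{(i_k)},\qquad J[\psi^{(k)}]_{T,t}^p=\sum_{j_1=0}^{p}\ldots\sum_{j_k=0}^{p}C_{j_k\ldots j_1}J'[\phi_{j_1}\ldots\phi_{j_k}]_{T,t}^{(i_1\ldots i_k)},$$ $J'[\phi_{j_1}\ldots\phi_{j_k}]_{T,t}^{(i_1\ldots i_k)}$ is the multiple Wiener stochastic integral of $\phi_{j_1}(t_1)\cdots\phi_{j_k}(t_k)$,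 and $\sum_{(j_1,\ldots,j_k)}$ means the sum over all possible permutations of $(j_1,\ldots,j_k)$, where whenever $j_r$ is swapped with $j_q$ in $(j_1,\ldots,j_k)$, also $i_r$ is swapped with $i_q$ in $(i_1,\ldots,i_k)$.
   Context: Setting: $(\Omega,\mathrm{F},\mathsf{P})$ is a complete probability space with a nondecreasing right-continuous family $\{\mathrm{F}_s\}_{s\in[0,T]}$ of sub-$\sigma$-fields, and $\mathbf{f}_s=(\mathbf{f}_s^{(1)},\ldots,\mathbf{f}_s^{(m)})$ is a standard $m$-dimensional Wiener process, $\mathrm{F}_s$-measurable for every $s\in[0,T]$, with independent components. $0\le t<T$. $\mathsf{M}$ denotes expectation; iterated stochastic integrals are Ito integrals; l.i.m. is the limit in the mean-square sense. Kernel and Fourier coefficients: $K(t_1,\ldots,t_k)=\psi_1(t_1)\cdots\psi_k(t_k)$ if $t_1<\ldots<t_k$ and $0$ otherwise, for $t_1,\ldots,t_k\in[t,T]$, $k\ge2$; $K(t_1)=\psi_1(t_1)$ for $k=1$. $C_{j_k\ldots j_1}=\int_{[t,T]^k}K(t_1,\ldots,t_k)\prod_{l=1}^k\phi_{j_l}(t_l)\,dt_1\ldots dt_k$. Multiple Wiener stochastic integral: consider step functions $\Phi_N(t_1,\ldots,t_k)=\sum_{l_1,\ldots,l_k=0}^{N-1}a_{l_1\ldots l_k}\mathbf{1}_{[\tau_{l_1},\tau_{l_1+1})}(t_1)\cdots\mathbf{1}_{[\tau_{l_k},\tau_{l_k+1})}(t_k)$ on $[t,T]^k$, where $a_{l_1\ldots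 l_k}\in\mathbb{R}$, $a_{l_1\ldots l_k}=0$ whenever $l_p=l_q$ for some $p\ne q$, and $t=\tau_0<\ldots<\tau_N=T$ is a partition with $\max_j(\tau_{j+1}-\tau_j)\to0$ as $N\to\infty$. For such $\Phi_N$ put $J'[\Phi_N]_{T,t}^{(i_1\ldots i_k)}=\sum_{l_1,\ldots,l_k=0}^{N-1}a_{l_1\ldots l_k}\Delta\mathbf{f}_{\tau_{l_1}}^{(i_1)}\cdots\Delta\mathbf{f}_{\tau_{l_k}}^{(i_k)}$, with $\Delta\mathbf{f}_{\tau_j}^{(i)}=\mathbf{f}_{\tau_{j+1}}^{(i)}-\mathbf{f}_{\tau_j}^{(i)}$. For $\Phi\in L_2([t,T]^k)$ put $J'[\Phi]_{T,t}^{(i_1\ldots i_k)}=\mathrm{l.i.m.}_{N\to\infty}J'[\Phi_N]_{T,t}^{(i_1\ldots i_k)}$, where $\Phi_N$ is a sequence of such step functions with $\Phi_N\to\Phi$ in $L_2([t,T]^k)$. Permutation sum: explicitly, with $\mathfrak{S}_k$ the set of all $k!$ permutations of $\{1,\ldots,k\}$, $\sum_{(j_1,\ldots,j_k)}\int_t^T\phi_{j_k}(t_k)\ldots\int_t^{t_2}\phi_{j_1}(t_1)\,d\mathbf{f}_{t_1}^{(i_1)}\ldots d\mathbf{f}_{t_k}^{(i_k)}=\sum_{\sigma\in\mathfrak{S}_k}\int_t^T\phi_{j_{\sigma(k)}}(t_k)\ldots\int_t^{t_2}\phi_{j_{\sigma(1)}}(t_1)\,d\mathbf{f}_{t_1}^{(i_{\sigma(1)})}\ldots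 d\mathbf{f}_{t_k}^{(i_{\sigma(k)})}$ (all $k!$ permutations are counted, even if some $j$'s coincide). $p$ is a nonnegative integer. *)

theory Defs
  imports "HOL-Probability.Probability" "HOL-Combinatorics.Permutations"
begin

text \<open>Elements of an \<open>L\<^sub>2\<close> space are represented by measurable, square integrable functions.
  Measurability is kept explicit because the Bochner integral is \<open>0\<close> outside its domain.\<close>

definition square_integrable :: "'b measure \<Rightarrow> ('b \<Rightarrow> real) \<Rightarrow> bool" where
  "square_integrable \<mu> f \<longleftrightarrow> f \<in> borel_measurable \<mu> \<and> integrable \<mu> (\<lambda>x. (f x)\<^sup>2)"

definition l2_tendsto :: "'b measure \<Rightarrow> (nat \<Rightarrow> 'b \<Rightarrow> real) \<Rightarrow> ('b \<Rightarrow> real) \<Rightarrow> bool" where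
  "l2_tendsto \<mu> f g \<longleftrightarrow> (\<forall>n. square_integrable \<mu> (f n)) \<and> square_integrable \<mu> g \<and>
     (\<lambda>n. \<integral>x. (f n x - g x)\<^sup>2 \<partial>\<mu>) \<longlonglongrightarrow> 0"

definition complete_orthonormal_system :: "'b measure \<Rightarrow> (nat \<Rightarrow> 'b \<Rightarrow> real) \<Rightarrow> bool" where
  "complete_orthonormal_system \<mu> \<phi> \<longleftrightarrow>
     (\<forall>j. square_integrable \<mu> (\<phi> j)) \<and>
     (\<forall>i j. (\<integral>x. \<phi> i x * \<phi> j x \<partial>\<mu>) = (if i = j then 1 else 0)) \<and>
     (\<forall>f. square_integrable \<mu> f \<longrightarrow> (\<forall>j. (\<integral>x. f x * \<phi> j x \<partial>\<mu>) = 0) \<longrightarrow> (AE x in \<mu>. f x = 0))"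


definition right_continuous_filtration :: "'a measure \<Rightarrow> (real \<Rightarrow> 'a measure) \<Rightarrow> real \<Rightarrow> bool" where
  "right_continuous_filtration M F T \<longleftrightarrow>
     (\<forall>s\<in>{0..T}. subalgebra M (F s)) \<and>
     (\<forall>s\<in>{0..T}. \<forall>u\<in>{s..T}. sets (F s) \<subseteq> sets (F u)) \<and>
     (\<forall>s\<in>{0..<T}. sets (F s) = (\<Inter>u\<in>{s<..T}. sets (F u)))"

text \<open>A standard \<open>m\<close>-dimensional Wiener process relative to the filtration \<open>F\<close>, with components
  \<open>W 1, \<dots>, W m\<close>. The fifth conjunct says that the increment of the vector process over \<open>[s, u]\<close>
  is independent of \<open>F s\<close> (so that in particular increments over disjoint intervals are
  independent); the last one says that the components are independent as processes.\<close>

definition wiener_process ::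
    "'a measure \<Rightarrow> (real \<Rightarrow> 'a measure) \<Rightarrow> real \<Rightarrow> nat \<Rightarrow> (nat \<Rightarrow> real \<Rightarrow> 'a \<Rightarrow> real) \<Rightarrow> bool" where
  "wiener_process M F T m W \<longleftrightarrow>
     (\<forall>i\<in>{1..m}. \<forall>s\<in>{0..T}. W i s \<in> borel_measurable (F s)) \<and>
     (\<forall>i\<in>{1..m}. AE \<omega> in M. W i 0 \<omega> = 0) \<and>
     (\<forall>i\<in>{1..m}. AE \<omega> in M. continuous_on {0..T} (\<lambda>s. W i s \<omega>)) \<and>
     (\<forall>i\<in>{1..m}. \<forall>s\<in>{0..T}. \<forall>u\<in>{s<..T}.
        distributed M lborel (\<lambda>\<omega>. W i u \<omega> - W i s \<omega>) (normal_density 0 (sqrt (u - s)))) \<and>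
     (\<forall>s\<in>{0..T}. \<forall>u\<in>{s<..T}.
        prob_space.indep_set M (sets (F s))
          {(\<lambda>\<omega>. \<lambda>i\<in>{1..m}. W i u \<omega> - W i s \<omega>) -` A \<inter> space M | A. A \<in> sets (\<Pi>\<^sub>M i\<in>{1..m}. borel)}) \<and>
     prob_space.indep_vars M (\<lambda>_. \<Pi>\<^sub>M s\<in>{0..T}. borel) (\<lambda>i \<omega>. \<lambda>s\<in>{0..T}. W i s \<omega>) {1..m}"


definition interval_partition :: "real \<Rightarrow> real \<Rightarrow> nat \<Rightarrow> (nat \<Rightarrow> real) \<Rightarrow> bool" where
  "interval_partition a b N \<tau> \<longleftrightarrow> \<tau> 0 = a \<and> \<tau> N = b \<and> (\<forall>j<N. \<tau> j < \<tau> (Suc j))"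

text \<open>For every \<open>N > 0\<close>, \<open>\<tau> N\<close> is a partition of \<open>[a, b]\<close> into \<open>N\<close> intervals, and the mesh tends
  to \<open>0\<close>. There is no such partition for \<open>N = 0\<close>; all sums over it below are empty.\<close>

definition refining_partitions :: "real \<Rightarrow> real \<Rightarrow> (nat \<Rightarrow> nat \<Rightarrow> real) \<Rightarrow> bool" where
  "refining_partitions a b \<tau> \<longleftrightarrow> (\<forall>N>0. interval_partition a b N (\<tau> N)) \<and>
     (\<lambda>N. MAX j\<in>{..<N}. \<tau> N (Suc j) - \<tau> N j) \<longlonglongrightarrow> 0"

text \<open>\<open>X\<close> is (a version of) the Ito integral of the process \<open>\<xi>\<close> over \<open>[a, b]\<close>, \<open>a < b\<close>, with respect
  to the scalar Wiener process \<open>B\<close>: the mean-square limit of the integrals of nonanticipating step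
  processes that converge to \<open>\<xi>\<close> in \<open>L\<^sub>2([a, b] \<times> \<Omega>)\<close>.\<close>

definition has_ito_integral ::
    "'a measure \<Rightarrow> (real \<Rightarrow> 'a measure) \<Rightarrow> (real \<Rightarrow> 'a \<Rightarrow> real) \<Rightarrow> real \<Rightarrow> real \<Rightarrow>
     (real \<Rightarrow> 'a \<Rightarrow> real) \<Rightarrow> ('a \<Rightarrow> real) \<Rightarrow> bool" where
  "has_ito_integral M F B a b \<xi> X \<longleftrightarrow>
     (\<exists>\<tau> \<eta>. refining_partitions a b \<tau> \<and>
        (\<forall>N. \<forall>j<N. \<eta> N j \<in> borel_measurable (F (\<tau> N j)) \<and> square_integrable M (\<eta> N j)) \<and>
        l2_tendsto (lebesgue_on {a..b} \<Otimes>\<^sub>M M)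
          (\<lambda>N (s, \<omega>). \<Sum>j<N. \<eta> N j \<omega> * indicator {\<tau> N j..<\<tau> N (Suc j)} s) (\<lambda>(s, \<omega>). \<xi> s \<omega>) \<and>
        l2_tendsto M
          (\<lambda>N \<omega>. \<Sum>j<N. \<eta> N j \<omega> * (B (\<tau> N (Suc j)) \<omega> - B (\<tau> N j) \<omega>)) X)"

text \<open>The integral over \<open>[t, s]\<close> is determined only up to a null set for each \<open>s\<close>; the indefinite
  integral is a choice of versions that is adapted and jointly measurable in \<open>(s, \<omega>)\<close>, so that it
  can be integrated again.\<close>

definition is_indefinite_ito_integral ::
    "'a measure \<Rightarrow> (real \<Rightarrow> 'a measure) \<Rightarrow> (real \<Rightarrow> 'a \<Rightarrow> real) \<Rightarrow> real \<Rightarrow> real \<Rightarrow>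
     (real \<Rightarrow> 'a \<Rightarrow> real) \<Rightarrow> (real \<Rightarrow> 'a \<Rightarrow> real) \<Rightarrow> bool" where
  "is_indefinite_ito_integral M F B t T \<xi> Y \<longleftrightarrow>
     (\<lambda>(s, \<omega>). Y s \<omega>) \<in> borel_measurable (lebesgue_on {t..T} \<Otimes>\<^sub>M M) \<and>
     (\<forall>s\<in>{t..T}. Y s \<in> borel_measurable (F s)) \<and>
     (\<forall>\<omega>\<in>space M. Y t \<omega> = 0) \<and>
     (\<forall>s\<in>{t<..T}. has_ito_integral M F B t s \<xi> (Y s))"

definition indefinite_ito_integral ::
    "'a measure \<Rightarrow> (real \<Rightarrow> 'a measure) \<Rightarrow> (real \<Rightarrow> 'a \<Rightarrow> real) \<Rightarrow> real \<Rightarrow> real \<Rightarrow>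
     (real \<Rightarrow> 'a \<Rightarrow> real) \<Rightarrow> real \<Rightarrow> 'a \<Rightarrow> real" where
  "indefinite_ito_integral M F B t T \<xi> = (SOME Y. is_indefinite_ito_integral M F B t T \<xi> Y)"

text \<open>\<open>iterated_ito_process M F W t T \<psi> i l s\<close> is
  \<open>\<integral>\<^sub>t\<^sup>s \<psi> l (t\<^sub>l) \<dots> \<integral>\<^sub>t\<^bsup>t\<^sub>2\<^esup> \<psi> 1 (t\<^sub>1) dW (i 1) t\<^sub>1 \<dots> dW (i l) t\<^sub>l\<close>, the variable \<open>t\<^sub>1\<close> being innermost.\<close>

primrec iterated_ito_process ::
    "'a measure \<Rightarrow> (real \<Rightarrow> 'a measure) \<Rightarrow> (nat \<Rightarrow> real \<Rightarrow> 'a \<Rightarrow> real) \<Rightarrow> real \<Rightarrow> real \<Rightarrow>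
     (nat \<Rightarrow> real \<Rightarrow> real) \<Rightarrow> (nat \<Rightarrow> nat) \<Rightarrow> nat \<Rightarrow> real \<Rightarrow> 'a \<Rightarrow> real" where
  "iterated_ito_process M F W t T \<psi> i 0 = (\<lambda>s \<omega>. 1)"
| "iterated_ito_process M F W t T \<psi> i (Suc l) =
     indefinite_ito_integral M F (W (i (Suc l))) t T
       (\<lambda>s \<omega>. \<psi> (Suc l) s * iterated_ito_process M F W t T \<psi> i l s \<omega>)"

definition iterated_ito_integral ::
    "'a measure \<Rightarrow> (real \<Rightarrow> 'a measure) \<Rightarrow> (nat \<Rightarrow> real \<Rightarrow> 'a \<Rightarrow> real) \<Rightarrow> real \<Rightarrow> real \<Rightarrow> nat \<Rightarrow>
     (nat \<Rightarrow> real \<Rightarrow> real) \<Rightarrow> (nat \<Rightarrow> nat) \<Rightarrow> 'a \<Rightarrow> real" where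
  "iterated_ito_integral M F W t T k \<psi> i = iterated_ito_process M F W t T \<psi> i k T"


text \<open>Points of \<open>[t, T]\<^sup>k\<close> and multi-indices are functions on \<open>{1..k}\<close>.\<close>

abbreviation cube :: "real \<Rightarrow> real \<Rightarrow> nat \<Rightarrow> (nat \<Rightarrow> real) measure" where
  "cube t T k \<equiv> \<Pi>\<^sub>M l\<in>{1..k}. lebesgue_on {t..T}"

definition step_function ::
    "nat \<Rightarrow> nat \<Rightarrow> (nat \<Rightarrow> real) \<Rightarrow> ((nat \<Rightarrow> nat) \<Rightarrow> real) \<Rightarrow> (nat \<Rightarrow> real) \<Rightarrow> real" where
  "step_function k N \<tau> a x =
     (\<Sum>l\<in>{1..k} \<rightarrow>\<^sub>E {..<N}. a l * (\<Prod>q=1..k. indicator {\<tau> (l q)..<\<tau> (Suc (l q))} (x q)))"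

definition step_wiener_integral ::
    "(nat \<Rightarrow> real \<Rightarrow> 'a \<Rightarrow> real) \<Rightarrow> (nat \<Rightarrow> nat) \<Rightarrow> nat \<Rightarrow> nat \<Rightarrow> (nat \<Rightarrow> real) \<Rightarrow>
     ((nat \<Rightarrow> nat) \<Rightarrow> real) \<Rightarrow> 'a \<Rightarrow> real" where
  "step_wiener_integral W i k N \<tau> a \<omega> =
     (\<Sum>l\<in>{1..k} \<rightarrow>\<^sub>E {..<N}. a l * (\<Prod>q=1..k. W (i q) (\<tau> (Suc (l q))) \<omega> - W (i q) (\<tau> (l q)) \<omega>))"

definition has_multiple_wiener_integral ::
    "'a measure \<Rightarrow> (nat \<Rightarrow> real \<Rightarrow> 'a \<Rightarrow> real) \<Rightarrow> real \<Rightarrow> real \<Rightarrow> nat \<Rightarrow> (nat \<Rightarrow> nat) \<Rightarrow>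
     ((nat \<Rightarrow> real) \<Rightarrow> real) \<Rightarrow> ('a \<Rightarrow> real) \<Rightarrow> bool" where
  "has_multiple_wiener_integral M W t T k i \<Phi> X \<longleftrightarrow>
     (\<exists>\<tau> a. refining_partitions t T \<tau> \<and>
        (\<forall>N. \<forall>l\<in>{1..k} \<rightarrow>\<^sub>E {..<N}. \<not> inj_on l {1..k} \<longrightarrow> a N l = 0) \<and>
        l2_tendsto (cube t T k) (\<lambda>N. step_function k N (\<tau> N) (a N)) \<Phi> \<and>
        l2_tendsto M (\<lambda>N. step_wiener_integral W i k N (\<tau> N) (a N)) X)"

definition multiple_wiener_integral ::
    "'a measure \<Rightarrow> (nat \<Rightarrow> real \<Rightarrow> 'a \<Rightarrow> real) \<Rightarrow> real \<Rightarrow> real \<Rightarrow> nat \<Rightarrow> (nat \<Rightarrow> nat) \<Rightarrow>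
     ((nat \<Rightarrow> real) \<Rightarrow> real) \<Rightarrow> 'a \<Rightarrow> real" where
  "multiple_wiener_integral M W t T k i \<Phi> =
     (SOME X. has_multiple_wiener_integral M W t T k i \<Phi> X)"


definition ordered_kernel :: "nat \<Rightarrow> (nat \<Rightarrow> real \<Rightarrow> real) \<Rightarrow> (nat \<Rightarrow> real) \<Rightarrow> real" where
  "ordered_kernel k \<psi> x =
     (if \<forall>l\<in>{1..<k}. x l < x (Suc l) then (\<Prod>l=1..k. \<psi> l (x l)) else 0)"

definition fourier_coeff ::
    "real \<Rightarrow> real \<Rightarrow> nat \<Rightarrow> (nat \<Rightarrow> real \<Rightarrow> real) \<Rightarrow> (nat \<Rightarrow> real \<Rightarrow> real) \<Rightarrow> (nat \<Rightarrow> nat) \<Rightarrow> real" where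
  "fourier_coeff t T k \<psi> \<phi> j =
     (\<integral>x. ordered_kernel k \<psi> x * (\<Prod>l=1..k. \<phi> (j l) (x l)) \<partial>cube t T k)"

definition approx_integral ::
    "'a measure \<Rightarrow> (nat \<Rightarrow> real \<Rightarrow> 'a \<Rightarrow> real) \<Rightarrow> real \<Rightarrow> real \<Rightarrow> nat \<Rightarrow> (nat \<Rightarrow> real \<Rightarrow> real) \<Rightarrow>
     (nat \<Rightarrow> nat) \<Rightarrow> (nat \<Rightarrow> real \<Rightarrow> real) \<Rightarrow> nat \<Rightarrow> 'a \<Rightarrow> real" where
  "approx_integral M W t T k \<psi> i \<phi> p \<omega> =
     (\<Sum>j\<in>{1..k} \<rightarrow>\<^sub>E {0..p}. fourier_coeff t T k \<psi> \<phi> j *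
        multiple_wiener_integral M W t T k i (\<lambda>x. \<Prod>l=1..k. \<phi> (j l) (x l)) \<omega>)"

end

theory Submission
  imports Defs
begin


text \<open>Everything is reduced to the Ito isometry. For step processes with respect to arbitrary, unrelated
  partitions it follows from the independence of increments, and by continuity it holds for all Ito
  integrals; applied repeatedly, it shows that two iterated integrals are orthogonal unless their
  component indices agree, in which case their inner product is that of the integrands over the
  simplex.

  Let \<open>S f\<close> be the sum over all permutations of the iterated integrals of the permuted factors of
  \<open>f\<^sub>1 \<otimes> \<dots> \<otimes> f\<^sub>k\<close>. If the \<open>f\<^sub>q\<close> are indicators of distinct cells of a partition, exactly one
  permutation sorts the cells: its iterated integral is the product of the Wiener increments, and all
  the others vanish. Hence the multiple Wiener integral of an off-diagonal step function is a linear
  combination of values of \<open>S\<close>, and since the inner product of \<open>S f\<close> and \<open>S g\<close> is the sum, over the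
  permutations that fix the component indices, of products of one-dimensional inner products, \<open>S\<close> is
  bounded in \<open>L\<^sub>2\<close> by \<open>k!\<close>. So \<open>S f\<close> is the multiple Wiener integral of \<open>f\<^sub>1 \<otimes> \<dots> \<otimes> f\<^sub>k\<close>.

  For an orthonormal basis the inner products of the \<open>S \<phi>\<^sub>j\<close> are counts of permutations, which makes
  the approximation \<open>J\<^sup>p\<close> satisfy \<open>E (J\<^sup>p)\<^sup>2 = E (J J\<^sup>p)\<close>; expanding the square gives the formula.\<close>

text \<open>Both kinds of integral are picked by \<open>SOME\<close> from a limit relation, so a
  statement about them needs existence first and then a property shared by all witnesses. Iteration
  adds an obstacle: an Ito integral is determined only almost surely at each time, so a jointly
  measurable adapted version must be found before it can be integrated again. Second moments that
  are bounded and continuous in time make this possible, and they survive each integration. The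
  identity for \<open>J\<^sup>p\<close> holds because \<open>J - J\<^sup>p\<close> is orthogonal to
  every \<open>S \<phi>\<^sub>j\<close> with indices at most \<open>p\<close>. Inner products of two
  \<open>S \<phi>\<^sub>j\<close> select the multi-indices \<open>j \<circ> \<rho>\<close>, for the
  permutations \<open>\<rho>\<close> that fix the component indices, and the inner product of
  \<open>J\<close> with \<open>S \<phi>\<^sub>j\<close> is the sum of the Fourier coefficients at
  the same multi-indices. They all lie in the range of summation because the bound \<open>p\<close>
  is the same in each coordinate. The factor \<open>k!\<close> counts permutations: each contributes
  the inner product of a function with a copy of itself in permuted coordinates.\<close>

subsection \<open>Square integrable functions\<close>

lemma square_integrableD:
  assumes "square_integrable \<mu> f"
  shows "f \<in> borel_measurable \<mu>" "integrable \<mu> (\<lambda>x. (f x)\<^sup>2)"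
  using assms by (auto simp: square_integrable_def)

lemma square_integrable_mult_integrable:
  assumes "square_integrable \<mu> f" "square_integrable \<mu> g"
  shows "integrable \<mu> (\<lambda>x. f x * g x)"
proof (rule Bochner_Integration.integrable_bound)
  show "integrable \<mu> (\<lambda>x. (f x)\<^sup>2 + (g x)\<^sup>2)"
    using assms by (auto simp: square_integrable_def)
  show "(\<lambda>x. f x * g x) \<in> borel_measurable \<mu>"
    using assms by (auto simp: square_integrable_def)
  have "\<bar>a * b\<bar> \<le> a\<^sup>2 + b\<^sup>2" for a b :: real
  proof -
    have "2 * (\<bar>a\<bar> * \<bar>b\<bar>) \<le> a\<^sup>2 + b\<^sup>2" using sum_squares_bound[of "\<bar>a\<bar>" "\<bar>b\<bar>"] by simp
    moreover have "0 \<le> \<bar>a\<bar> * \<bar>b\<bar>" by simp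
    ultimately show ?thesis unfolding abs_mult by linarith
  qed
  then show "AE x in \<mu>. norm (f x * g x) \<le> norm ((f x)\<^sup>2 + (g x)\<^sup>2)"
    by (intro AE_I2) (auto intro: order_trans)
qed

lemma square_integrable_zero: "square_integrable \<mu> (\<lambda>x. 0)"
  by (simp add: square_integrable_def)

lemma square_integrable_cmult:
  "square_integrable \<mu> f \<Longrightarrow> square_integrable \<mu> (\<lambda>x. c * f x)"
  by (auto simp: square_integrable_def power_mult_distrib)

lemma square_integrable_add:
  assumes "square_integrable \<mu> f" "square_integrable \<mu> g"
  shows "square_integrable \<mu> (\<lambda>x. f x + g x)"
proof -
  have "integrable \<mu> (\<lambda>x. (f x)\<^sup>2 + (g x)\<^sup>2 + 2 * (f x * g x))"
    using assms square_integrable_mult_integrable[OF assms]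
    by (intro Bochner_Integration.integrable_add) (auto simp: square_integrable_def)
  then have "integrable \<mu> (\<lambda>x. (f x + g x)\<^sup>2)" by (simp add: power2_sum mult.assoc)
  moreover have "(\<lambda>x. f x + g x) \<in> borel_measurable \<mu>"
    using assms by (intro borel_measurable_add) (simp_all add: square_integrable_def)
  ultimately show ?thesis by (simp add: square_integrable_def)
qed

lemma square_integrable_diff:
  assumes "square_integrable \<mu> f" "square_integrable \<mu> g"
  shows "square_integrable \<mu> (\<lambda>x. f x - g x)"
  using square_integrable_add[OF assms(1) square_integrable_cmult[OF assms(2), of "-1"]] by simp

lemma square_integrable_sum:
  "(\<And>a. a \<in> A \<Longrightarrow> square_integrable \<mu> (f a)) \<Longrightarrow> square_integrable \<mu> (\<lambda>x. \<Sum>a\<in>A. f a x)"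
  by (induction A rule: infinite_finite_induct) (auto intro: square_integrable_zero square_integrable_add)

lemma square_integrable_bound:
  assumes "square_integrable \<mu> g" "f \<in> borel_measurable \<mu>" "\<And>x. x \<in> space \<mu> \<Longrightarrow> \<bar>f x\<bar> \<le> \<bar>g x\<bar>"
  shows "square_integrable \<mu> f"
proof -
  have "integrable \<mu> (\<lambda>x. (f x)\<^sup>2)"
    using square_integrableD[OF assms(1)] assms(2,3)
    by (elim Bochner_Integration.integrable_bound) (auto intro!: AE_I2 simp: abs_le_square_iff)
  then show ?thesis using assms(2) by (simp add: square_integrable_def)
qed

lemma square_integrable_cong_AE:
  assumes "square_integrable \<mu> f" "g \<in> borel_measurable \<mu>" "AE x in \<mu>. f x = g x"
  shows "square_integrable \<mu> g"
proof -
  have "integrable \<mu> (\<lambda>x. (f x)\<^sup>2) \<longleftrightarrow> integrable \<mu> (\<lambda>x. (g x)\<^sup>2)"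
    using assms by (intro integrable_cong_AE) (auto simp: square_integrable_def)
  then show ?thesis using assms by (simp add: square_integrable_def)
qed

lemma l2_cauchy_schwarz:
  assumes "square_integrable \<mu> f" "square_integrable \<mu> g"
  shows "\<bar>\<integral>x. f x * g x \<partial>\<mu>\<bar> \<le> sqrt (\<integral>x. (f x)\<^sup>2 \<partial>\<mu>) * sqrt (\<integral>x. (g x)\<^sup>2 \<partial>\<mu>)"
proof -
  define A B C where "A = (\<integral>x. (f x)\<^sup>2 \<partial>\<mu>)" and "B = (\<integral>x. f x * g x \<partial>\<mu>)" and "C = (\<integral>x. (g x)\<^sup>2 \<partial>\<mu>)"
  have [simp]: "integrable \<mu> (\<lambda>x. (f x)\<^sup>2)" "integrable \<mu> (\<lambda>x. (g x)\<^sup>2)" "integrable \<mu> (\<lambda>x. f x * g x)"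
    "f \<in> borel_measurable \<mu>" "g \<in> borel_measurable \<mu>"
    using assms square_integrable_mult_integrable[OF assms] by (auto simp: square_integrable_def)
  \<comment> \<open>\<open>C f - B g\<close> is \<open>C\<close> times the part of \<open>f\<close>
    orthogonal to \<open>g\<close>. This form avoids dividing by \<open>C\<close>, so that
    \<open>C = 0\<close> is split off only at the end.\<close>
  have "0 \<le> (\<integral>x. (C * f x - B * g x)\<^sup>2 \<partial>\<mu>)" by simp
  also have "\<dots> = (\<integral>x. C\<^sup>2 * (f x)\<^sup>2 - 2 * C * B * (f x * g x) + B\<^sup>2 * (g x)\<^sup>2 \<partial>\<mu>)"
    by (intro Bochner_Integration.integral_cong) (auto simp: power2_eq_square algebra_simps)
  also have "\<dots> = C\<^sup>2 * A - 2 * C * B * B + B\<^sup>2 * C"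
    by (simp add: A_def B_def C_def)
  also have "\<dots> = C * (C * A - B\<^sup>2)" by (simp add: power2_eq_square algebra_simps)
  finally have *: "0 \<le> C * (C * A - B\<^sup>2)" .
  have C: "0 \<le> C" "0 \<le> A" by (auto simp: C_def A_def)
  have "B\<^sup>2 \<le> A * C"
  proof (cases "C = 0")
    case True
    then have "AE x in \<mu>. g x = 0" unfolding C_def
      by (subst (asm) integral_nonneg_eq_0_iff_AE) auto
    then have "AE x in \<mu>. f x * g x = 0" by eventually_elim simp
    then have "B = 0" unfolding B_def by (rule integral_eq_zero_AE)
    then show ?thesis using True by simp
  next
    case False
    then show ?thesis using * C by (simp add: zero_le_mult_iff mult.commute)
  qed
  then have "\<bar>B\<bar> \<le> sqrt (A * C)" using real_le_rsqrt by fastforce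
  then show ?thesis by (simp add: A_def B_def C_def real_sqrt_mult)
qed

text \<open>Replaces the triangle inequality: it speaks of squared norms, as
  \<open>l2_tendsto\<close> does, and the factor 2 is harmless in limits to 0.\<close>

lemma l2_sum_bound:
  assumes "square_integrable \<mu> f" "square_integrable \<mu> g"
  shows "(\<integral>x. (f x + g x)\<^sup>2 \<partial>\<mu>) \<le> 2 * (\<integral>x. (f x)\<^sup>2 \<partial>\<mu>) + 2 * (\<integral>x. (g x)\<^sup>2 \<partial>\<mu>)"
proof -
  have "(\<integral>x. (f x + g x)\<^sup>2 \<partial>\<mu>) \<le> (\<integral>x. 2 * (f x)\<^sup>2 + 2 * (g x)\<^sup>2 \<partial>\<mu>)"
  proof (rule integral_mono)
    show "(f x + g x)\<^sup>2 \<le> 2 * (f x)\<^sup>2 + 2 * (g x)\<^sup>2" for x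
      using sum_squares_bound[of "f x" "g x"] by (simp add: power2_sum)
    show "integrable \<mu> (\<lambda>x. (f x + g x)\<^sup>2)"
      by (rule square_integrableD(2)[OF square_integrable_add[OF assms]])
    show "integrable \<mu> (\<lambda>x. 2 * (f x)\<^sup>2 + 2 * (g x)\<^sup>2)"
      using assms by (simp add: square_integrable_def)
  qed
  also have "\<dots> = 2 * (\<integral>x. (f x)\<^sup>2 \<partial>\<mu>) + 2 * (\<integral>x. (g x)\<^sup>2 \<partial>\<mu>)"
    using assms by (simp add: square_integrable_def)
  finally show ?thesis .
qed

lemma l2_diff_bound:
  assumes "square_integrable \<mu> f" "square_integrable \<mu> g"
  shows "(\<integral>x. (f x - g x)\<^sup>2 \<partial>\<mu>) \<le> 2 * (\<integral>x. (f x)\<^sup>2 \<partial>\<mu>) + 2 * (\<integral>x. (g x)\<^sup>2 \<partial>\<mu>)"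
  using l2_sum_bound[OF assms(1) square_integrable_cmult[OF assms(2), of "-1"]] by simp

lemma l2_tendstoD:
  assumes "l2_tendsto \<mu> f g"
  shows "square_integrable \<mu> (f n)" "square_integrable \<mu> g" "(\<lambda>n. \<integral>x. (f n x - g x)\<^sup>2 \<partial>\<mu>) \<longlonglongrightarrow> 0"
  using assms by (auto simp: l2_tendsto_def)

lemma l2_tendsto_const: "square_integrable \<mu> g \<Longrightarrow> l2_tendsto \<mu> (\<lambda>n. g) g"
  by (simp add: l2_tendsto_def)

text \<open>With the errors \<open>u = f - f'\<close> and \<open>v = g - g'\<close> the difference
  of the products is \<open>u v + u g' + f' v\<close>, and Cauchy-Schwarz bounds each term. Through
  this lemma isometries pass from simple integrands to limits.\<close>

lemma l2_tendsto_inner: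
  assumes f: "l2_tendsto \<mu> f f'" and g: "l2_tendsto \<mu> g g'"
  shows "(\<lambda>n. \<integral>x. f n x * g n x \<partial>\<mu>) \<longlonglongrightarrow> (\<integral>x. f' x * g' x \<partial>\<mu>)"
proof -
  note [simp] = l2_tendstoD(1,2)[OF f] l2_tendstoD(1,2)[OF g]
  define u v where "u n = (\<lambda>x. f n x - f' x)" and "v n = (\<lambda>x. g n x - g' x)" for n
  have [simp]: "square_integrable \<mu> (u n)" "square_integrable \<mu> (v n)" for n
    unfolding u_def v_def by (intro square_integrable_diff; simp)+
  define U V where "U n = sqrt (\<integral>x. (u n x)\<^sup>2 \<partial>\<mu>)" and "V n = sqrt (\<integral>x. (v n x)\<^sup>2 \<partial>\<mu>)" for n
  have U: "U \<longlonglongrightarrow> 0" and V: "V \<longlonglongrightarrow> 0"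
    using tendsto_real_sqrt[OF l2_tendstoD(3)[OF f]] tendsto_real_sqrt[OF l2_tendstoD(3)[OF g]]
    by (simp_all add: U_def[abs_def] V_def[abs_def] u_def v_def)
  define A B where "A = sqrt (\<integral>x. (f' x)\<^sup>2 \<partial>\<mu>)" and "B = sqrt (\<integral>x. (g' x)\<^sup>2 \<partial>\<mu>)"
  have "norm ((\<integral>x. f n x * g n x \<partial>\<mu>) - (\<integral>x. f' x * g' x \<partial>\<mu>)) \<le> U n * V n + U n * B + A * V n" for n
  proof -
    have [simp]: "integrable \<mu> (\<lambda>x. u n x * v n x)" "integrable \<mu> (\<lambda>x. u n x * g' x)"
      "integrable \<mu> (\<lambda>x. f' x * v n x)" "integrable \<mu> (\<lambda>x. f' x * g' x)" "integrable \<mu> (\<lambda>x. f n x * g n x)"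
      by (intro square_integrable_mult_integrable; simp)+
    have "(\<integral>x. f n x * g n x \<partial>\<mu>) - (\<integral>x. f' x * g' x \<partial>\<mu>) = (\<integral>x. f n x * g n x - f' x * g' x \<partial>\<mu>)"
      by simp
    also have "\<dots> = (\<integral>x. u n x * v n x + u n x * g' x + f' x * v n x \<partial>\<mu>)"
      by (intro Bochner_Integration.integral_cong) (auto simp: u_def v_def algebra_simps)
    also have "\<dots> = (\<integral>x. u n x * v n x \<partial>\<mu>) + (\<integral>x. u n x * g' x \<partial>\<mu>) + (\<integral>x. f' x * v n x \<partial>\<mu>)" by simp
    finally have "norm ((\<integral>x. f n x * g n x \<partial>\<mu>) - (\<integral>x. f' x * g' x \<partial>\<mu>)) \<le>
       \<bar>\<integral>x. u n x * v n x \<partial>\<mu>\<bar> + \<bar>\<integral>x. u n x * g' x \<partial>\<mu>\<bar> + \<bar>\<integral>x. f' x * v n x \<partial>\<mu>\<bar>"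
      by simp
    also have "\<dots> \<le> U n * V n + U n * B + A * V n"
      unfolding U_def V_def A_def B_def by (intro add_mono l2_cauchy_schwarz) simp_all
    finally show ?thesis .
  qed
  moreover have "(\<lambda>n. U n * V n + U n * B + A * V n) \<longlonglongrightarrow> 0 * 0 + 0 * B + A * 0"
    by (intro tendsto_add tendsto_mult U V tendsto_const)
  then have "(\<lambda>n. U n * V n + U n * B + A * V n) \<longlonglongrightarrow> 0" by simp
  ultimately have "(\<lambda>n. (\<integral>x. f n x * g n x \<partial>\<mu>) - (\<integral>x. f' x * g' x \<partial>\<mu>)) \<longlonglongrightarrow> 0"
    by (rule Lim_null_comparison[OF always_eventually[OF allI]])
  then show ?thesis by (simp add: LIM_zero_iff)
qed

lemma l2_tendsto_diff:
  assumes f: "l2_tendsto \<mu> f f'" and g: "l2_tendsto \<mu> g g'"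
  shows "l2_tendsto \<mu> (\<lambda>n x. f n x - g n x) (\<lambda>x. f' x - g' x)"
proof -
  note [simp] = l2_tendstoD(1,2)[OF f] l2_tendstoD(1,2)[OF g]
  have "(\<lambda>n. \<integral>x. ((f n x - g n x) - (f' x - g' x))\<^sup>2 \<partial>\<mu>) \<longlonglongrightarrow> 0"
  proof (rule tendsto_sandwich)
    show "\<forall>\<^sub>F n in sequentially. 0 \<le> (\<integral>x. ((f n x - g n x) - (f' x - g' x))\<^sup>2 \<partial>\<mu>)" by simp
    show "\<forall>\<^sub>F n in sequentially. (\<integral>x. ((f n x - g n x) - (f' x - g' x))\<^sup>2 \<partial>\<mu>) \<le>
      2 * (\<integral>x. (f n x - f' x)\<^sup>2 \<partial>\<mu>) + 2 * (\<integral>x. (g n x - g' x)\<^sup>2 \<partial>\<mu>)"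
    proof (rule always_eventually, rule allI)
      fix n
      have eq: "(f n x - g n x) - (f' x - g' x) = (f n x - f' x) - (g n x - g' x)" for x by simp
      show "(\<integral>x. ((f n x - g n x) - (f' x - g' x))\<^sup>2 \<partial>\<mu>) \<le>
        2 * (\<integral>x. (f n x - f' x)\<^sup>2 \<partial>\<mu>) + 2 * (\<integral>x. (g n x - g' x)\<^sup>2 \<partial>\<mu>)"
        unfolding eq by (intro l2_diff_bound square_integrable_diff; simp)
    qed
    show "(\<lambda>n. 2 * (\<integral>x. (f n x - f' x)\<^sup>2 \<partial>\<mu>) + 2 * (\<integral>x. (g n x - g' x)\<^sup>2 \<partial>\<mu>)) \<longlonglongrightarrow> 0"
      using tendsto_add[OF tendsto_mult_left[OF l2_tendstoD(3)[OF f], of 2] tendsto_mult_left[OF l2_tendstoD(3)[OF g], of 2]]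
      by simp
  qed simp
  moreover have "square_integrable \<mu> (\<lambda>x. f n x - g n x)" "square_integrable \<mu> (\<lambda>x. f' x - g' x)" for n
    by (intro square_integrable_diff; simp)+
  ultimately show ?thesis by (simp add: l2_tendsto_def)
qed

lemma l2_zero_AE:
  assumes "square_integrable \<mu> f" "(\<integral>x. (f x)\<^sup>2 \<partial>\<mu>) = 0"
  shows "AE x in \<mu>. f x = 0"
  using assms by (subst (asm) integral_nonneg_eq_0_iff_AE) (auto simp: square_integrable_def)

text \<open>The zero sequence converges to \<open>g - g'\<close>. This identifies a multiple Wiener
  integral picked by \<open>SOME\<close> from its own approximating sequence.\<close>

lemma l2_tendsto_unique:
  assumes f: "l2_tendsto \<mu> f g" and g: "l2_tendsto \<mu> f g'"
  shows "AE x in \<mu>. g x = g' x"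
proof -
  have *: "l2_tendsto \<mu> (\<lambda>n x. 0) (\<lambda>x. g x - g' x)" using l2_tendsto_diff[OF f g] by simp
  have "(\<integral>x. (g x - g' x)\<^sup>2 \<partial>\<mu>) = 0"
    using l2_tendstoD(3)[OF *] by (simp add: LIMSEQ_const_iff power2_commute)
  from l2_zero_AE[OF l2_tendstoD(2)[OF *] this] show ?thesis by simp
qed

lemma l2_tendsto_cong_AE:
  assumes "l2_tendsto \<mu> f g" "g' \<in> borel_measurable \<mu>" "AE x in \<mu>. g x = g' x"
  shows "l2_tendsto \<mu> f g'"
proof -
  note m = square_integrableD(1)[OF l2_tendstoD(1)[OF assms(1)]]  square_integrableD(1)[OF l2_tendstoD(2)[OF assms(1)]]
  have "(\<integral>x. (f n x - g x)\<^sup>2 \<partial>\<mu>) = (\<integral>x. (f n x - g' x)\<^sup>2 \<partial>\<mu>)" for n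
    using assms(2,3) m by (intro integral_cong_AE) auto
  then show ?thesis using assms square_integrable_cong_AE[OF l2_tendstoD(2)[OF assms(1)] assms(2,3)]
    by (simp add: l2_tendsto_def)
qed

section \<open>Completeness of the space of square integrable functions\<close>

lemma AE_summable_of_integral_le:
  assumes "\<And>k. integrable M (f k)" "\<And>k x. 0 \<le> f k x" "\<And>k::nat. (\<integral>x. f k x \<partial>M) \<le> (1/2::real)^k"
  shows "AE x in M. summable (\<lambda>k. f k x)"
proof -
  have [measurable]: "f k \<in> borel_measurable M" for k using assms(1) by auto
  \<comment> \<open>By monotone convergence the sum of the series has integral at most 2, so it is
    finite almost everywhere. Fast convergence in the mean thus becomes almost sure
    convergence.\<close>
  have "(\<integral>\<^sup>+x. (\<Sum>k. ennreal (f k x)) \<partial>M) = (\<Sum>k. \<integral>\<^sup>+x. ennreal (f k x) \<partial>M)"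
    by (intro nn_integral_suminf) auto
  also have "\<dots> = (\<Sum>k. ennreal (\<integral>x. f k x \<partial>M))"
    using assms by (intro suminf_cong) (simp add: nn_integral_eq_integral)
  also have "\<dots> \<le> (\<Sum>k. ennreal ((1/2::real)^k))"
    using assms(3) by (intro suminf_le ennreal_leI) auto
  also have "\<dots> = ennreal (\<Sum>k. (1/2::real)^k)"
    by (intro suminf_ennreal2) (auto intro: summable_geometric)
  finally have "(\<integral>\<^sup>+x. (\<Sum>k. ennreal (f k x)) \<partial>M) \<noteq> \<infinity>"
    by (metis ennreal_less_top infinity_ennreal_def leD order_less_le top.not_eq_extremum)
  then have "AE x in M. (\<Sum>k. ennreal (f k x)) \<noteq> \<infinity>"
    by (intro nn_integral_PInf_AE) auto
  then show ?thesis
  proof eventually_elim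
    case (elim x)
    then show ?case using assms(2) by (intro summable_suminf_not_top) auto
  qed
qed

text \<open>Riesz-Fischer: a rapidly Cauchy subsequence converges almost surely. The limit is
  measurable for \<open>G\<close> itself, since adaptedness of the Ito integral rests on it.\<close>

lemma (in prob_space) l2_complete:
  assumes S: "\<And>n. square_integrable M (S n)" and G: "subalgebra M G" "\<And>n. S n \<in> borel_measurable G"
    and cau: "\<And>e. 0 < e \<Longrightarrow> \<exists>N0. \<forall>m\<ge>N0. \<forall>n\<ge>N0. (\<integral>x. (S m x - S n x)\<^sup>2 \<partial>M) < e"
  shows "\<exists>X\<in>borel_measurable G. l2_tendsto M S X"
proof -
  \<comment> \<open>Squared distances of order \<open>(1/4)^k\<close> leave room for the weight
    \<open>2^k\<close> in \<open>d\<close> below.\<close>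
  have "\<forall>k. \<exists>r. \<forall>m\<ge>r. \<forall>n\<ge>r. (\<integral>x. (S m x - S n x)\<^sup>2 \<partial>M) < (1/4::real)^k"
    by (intro allI cau) simp
  from choice[OF this] obtain r0 where r0: "\<And>k m n. m \<ge> r0 k \<Longrightarrow> n \<ge> r0 k \<Longrightarrow> (\<integral>x. (S m x - S n x)\<^sup>2 \<partial>M) < (1/4::real)^k"
    by auto
  \<comment> \<open>Partial sums make the thresholds monotone.\<close>
  define r where "r k = (\<Sum>j\<le>k. r0 j)" for k :: nat
  have rmono: "r k \<le> r l" if "k \<le> l" for k l
    unfolding r_def using that by (intro sum_mono2) auto
  have rge: "r0 k \<le> r k" for k unfolding r_def by (rule member_le_sum) auto
  have r: "(\<integral>x. (S m x - S n x)\<^sup>2 \<partial>M) < (1/4::real)^k" if "m \<ge> r k" "n \<ge> r k" for k m n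
    using r0[of k m n] that rge[of k] by linarith
  note [measurable] = square_integrableD(1)[OF S]
  \<comment> \<open>By \<open>2 |a| \<le> 1/y + y a\<^sup>2\<close> with \<open>y = 2^k\<close>,
    \<open>d k\<close> dominates the increment number \<open>k\<close> of the subsequence, while its
    integral is at most \<open>(1/2)^k\<close>.\<close>
  define d where "d k x = (1/2::real)^k * (1/2) + 2^k * (1/2) * (S (r (Suc k)) x - S (r k) x)\<^sup>2" for k x
  have sq: "square_integrable M (\<lambda>x. S m x - S n x)" for m n by (intro square_integrable_diff S)
  have AEd: "AE x in M. summable (\<lambda>k. d k x)"
  proof (rule AE_summable_of_integral_le)
    fix k :: nat
    show "integrable M (d k)" unfolding d_def[abs_def]
      using square_integrableD(2)[OF sq] by auto
    have e1: "(\<integral>x. d k x \<partial>M) = (1/2)^k * (1/2) + 2^k * (1/2) * (\<integral>x. (S (r (Suc k)) x - S (r k) x)\<^sup>2 \<partial>M)"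
      unfolding d_def using square_integrableD(2)[OF sq] by (subst Bochner_Integration.integral_add) (auto simp: prob_space)
    have e2: "(\<integral>x. (S (r (Suc k)) x - S (r k) x)\<^sup>2 \<partial>M) \<le> (1/4)^k"
      using r[of k "r (Suc k)" "r k"] rmono[of k "Suc k"] by simp
    have e3: "2^k * (1/4::real)^k = (1/2)^k"
      by (simp flip: power_mult_distrib)
    have "2^k * (\<integral>x. (S (r (Suc k)) x - S (r k) x)\<^sup>2 \<partial>M) \<le> 2^k * (1/4)^k"
      using e2 by (rule mult_left_mono) simp
    then show "(\<integral>x. d k x \<partial>M) \<le> (1/2)^k" unfolding e1 e3 by simp
  qed (simp add: d_def)
  have conv: "AE x in M. convergent (\<lambda>k. S (r k) x)"
    using AEd
  proof eventually_elim
    case (elim x)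
    have le: "norm (S (r (Suc k)) x - S (r k) x) \<le> d k x" for k
    proof -
      have "2 * \<bar>a\<bar> \<le> inverse y + y * a\<^sup>2" if "y > 0" for a y :: real
      proof -
        define z where "z = inverse y"
        have yz: "y * z = 1" using that by (simp add: z_def)
        have "0 \<le> y * (z - \<bar>a\<bar>)\<^sup>2" using that by simp
        also have "\<dots> = (y * z) * z + y * a\<^sup>2 - 2 * (y * z) * \<bar>a\<bar>"
          by (simp add: power2_eq_square algebra_simps)
        finally show ?thesis unfolding yz z_def[symmetric] by simp
      qed
      from this[of "2^k" "S (r (Suc k)) x - S (r k) x"] show ?thesis
        by (simp add: d_def power_one_over inverse_eq_divide)
    qed
    have "summable (\<lambda>k. S (r (Suc k)) x - S (r k) x)"
      by (rule summable_comparison_test'[OF elim]) (rule le)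
    then have "convergent (\<lambda>n. \<Sum>k<n. S (r (Suc k)) x - S (r k) x)" by (simp add: summable_iff_convergent)
    then have "convergent (\<lambda>n. (S (r n) x - S (r 0) x) + S (r 0) x)"
      by (intro convergent_add convergent_const) (simp add: sum_lessThan_telescope[of "\<lambda>k. S (r k) x"])
    then show ?case by simp
  qed
  \<comment> \<open>\<open>lim\<close> is total, so \<open>X\<close> is measurable for
    \<open>G\<close> on the whole space, including the points where the subsequence
    diverges.\<close>
  define X where "X x = lim (\<lambda>k. S (r k) x)" for x
  have XG: "X \<in> borel_measurable G" unfolding X_def[abs_def] using G(2) by measurable
  then have [measurable]: "X \<in> borel_measurable M" using G(1) measurable_from_subalg by blast
  have lim: "AE x in M. (\<lambda>k. S (r k) x) \<longlonglongrightarrow> X x"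
    using conv by eventually_elim (simp add: X_def convergent_LIMSEQ_iff)
  \<comment> \<open>Fatou's lemma: \<open>n\<close> is fixed and the second index runs along the
    subsequence.\<close>
  have bnd: "(\<integral>\<^sup>+x. ennreal ((S n x - X x)\<^sup>2) \<partial>M) \<le> ennreal ((1/4)^k)" if n: "n \<ge> r k" for n k
  proof -
    have "(\<integral>\<^sup>+x. ennreal ((S n x - X x)\<^sup>2) \<partial>M) = (\<integral>\<^sup>+x. liminf (\<lambda>m. ennreal ((S n x - S (r m) x)\<^sup>2)) \<partial>M)"
    proof (rule nn_integral_cong_AE)
      show "AE x in M. ennreal ((S n x - X x)\<^sup>2) = liminf (\<lambda>m. ennreal ((S n x - S (r m) x)\<^sup>2))"
        using lim
      proof eventually_elim
        case (elim x)
        have "(\<lambda>m. ennreal ((S n x - S (r m) x)\<^sup>2)) \<longlonglongrightarrow> ennreal ((S n x - X x)\<^sup>2)"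
          by (intro tendsto_intros elim)
        then show ?case by (intro lim_imp_Liminf[symmetric]) auto
      qed
    qed
    also have "\<dots> \<le> liminf (\<lambda>m. \<integral>\<^sup>+x. ennreal ((S n x - S (r m) x)\<^sup>2) \<partial>M)"
      by (rule nn_integral_liminf) auto
    also have "\<dots> \<le> liminf (\<lambda>m::nat. ennreal ((1/4)^k))"
    proof (rule Liminf_mono)
      show "\<forall>\<^sub>F m in sequentially. (\<integral>\<^sup>+x. ennreal ((S n x - S (r m) x)\<^sup>2) \<partial>M) \<le> ennreal ((1/4)^k)"
        using eventually_ge_at_top[of k]
      proof eventually_elim
        case (elim m)
        have "(\<integral>\<^sup>+x. ennreal ((S n x - S (r m) x)\<^sup>2) \<partial>M) = ennreal (\<integral>x. (S n x - S (r m) x)\<^sup>2 \<partial>M)"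
          using square_integrableD(2)[OF sq] by (intro nn_integral_eq_integral) auto
        also have "\<dots> \<le> ennreal ((1/4)^k)" using r[OF n, of "r m"] rmono[OF elim] by (intro ennreal_leI) auto
        finally show ?case .
      qed
    qed
    also have "\<dots> = ennreal ((1/4)^k)" by (simp add: Liminf_const)
    finally show ?thesis .
  qed
  have sqX': "square_integrable M (\<lambda>x. S (r 0) x - X x)"
    using bnd[of 0 "r 0"] by (auto simp: square_integrable_def integrable_iff_bounded le_less_trans)
  have sqX: "square_integrable M X"
    using square_integrable_diff[OF S[of "r 0"] sqX'] by simp
  have "(\<lambda>n. \<integral>x. (S n x - X x)\<^sup>2 \<partial>M) \<longlonglongrightarrow> 0"
  proof (rule LIMSEQ_I)
    fix e :: real assume "0 < e"
    then obtain k where k: "(1/4::real)^k < e" using real_arch_pow_inv[of e "1/4"] by auto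
    show "\<exists>no. \<forall>n\<ge>no. norm ((\<integral>x. (S n x - X x)\<^sup>2 \<partial>M) - 0) < e"
    proof (intro exI[of _ "r k"] allI impI)
      fix n assume n: "r k \<le> n"
      have "ennreal (\<integral>x. (S n x - X x)\<^sup>2 \<partial>M) = (\<integral>\<^sup>+x. ennreal ((S n x - X x)\<^sup>2) \<partial>M)"
        using square_integrableD(2)[OF square_integrable_diff[OF S sqX]] by (intro nn_integral_eq_integral[symmetric]) auto
      also note bnd[OF n]
      finally show "norm ((\<integral>x. (S n x - X x)\<^sup>2 \<partial>M) - 0) < e" using k by (simp add: ennreal_le_iff)
    qed
  qed
  then show ?thesis using XG S sqX by (auto simp: l2_tendsto_def)
qed


subsection \<open>Increments of the Wiener process\<close>

locale brownian = prob_space M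
  for M :: "'a measure" and F :: "real \<Rightarrow> 'a measure" and T :: real and m :: nat
    and W :: "nat \<Rightarrow> real \<Rightarrow> 'a \<Rightarrow> real" +
  assumes filtration: "right_continuous_filtration M F T"
    and wiener: "wiener_process M F T m W"
begin

abbreviation D :: "nat \<Rightarrow> real \<Rightarrow> real \<Rightarrow> 'a \<Rightarrow> real" where
  "D i a b \<equiv> (\<lambda>\<omega>. W i b \<omega> - W i a \<omega>)"

lemma subalgebra_F: "s \<in> {0..T} \<Longrightarrow> subalgebra M (F s)"
  using filtration by (auto simp: right_continuous_filtration_def)

lemma F_measurable_mono:
  assumes "f \<in> borel_measurable (F s)" "0 \<le> s" "s \<le> u" "u \<le> T"
  shows "f \<in> borel_measurable (F u)"
proof -
  have "subalgebra M (F s)" "subalgebra M (F u)" "sets (F s) \<subseteq> sets (F u)"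
    using filtration assms by (auto simp: right_continuous_filtration_def)
  then have "subalgebra (F u) (F s)" by (auto simp: subalgebra_def)
  then show ?thesis using assms(1) measurable_from_subalg by blast
qed

lemma F_measurable:
  assumes "f \<in> borel_measurable (F s)" "0 \<le> s" "s \<le> T"
  shows "f \<in> borel_measurable M"
  using subalgebra_F[of s] assms measurable_from_subalg by auto

lemma W_F_measurable:
  assumes "i \<in> {1..m}" "0 \<le> s" "s \<le> u" "u \<le> T"
  shows "W i s \<in> borel_measurable (F u)"
proof -
  have "W i s \<in> borel_measurable (F s)" using wiener assms by (auto simp: wiener_process_def)
  then show ?thesis using F_measurable_mono assms by blast
qed

lemma W_measurable: "i \<in> {1..m} \<Longrightarrow> 0 \<le> s \<Longrightarrow> s \<le> T \<Longrightarrow> W i s \<in> borel_measurable M"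
  using F_measurable[OF W_F_measurable[of i s s]] by auto

lemma D_F_measurable:
  assumes "i \<in> {1..m}" "0 \<le> a" "a \<le> b" "b \<le> T"
  shows "D i a b \<in> borel_measurable (F b)"
  using assms by (intro borel_measurable_diff W_F_measurable) auto

lemma D_measurable: "i \<in> {1..m} \<Longrightarrow> 0 \<le> a \<Longrightarrow> a \<le> b \<Longrightarrow> b \<le> T \<Longrightarrow> D i a b \<in> borel_measurable M"
  by (intro borel_measurable_diff W_measurable) auto

text \<open>The Borel function \<open>h\<close> of the whole vector increment allows a product of
  two components as one factor; independence of \<open>F s\<close> from each single component would
  not give the mixed second moments.\<close>

lemma indep_F_increment:
  fixes h :: "(nat \<Rightarrow> real) \<Rightarrow> real"
  assumes s: "0 \<le> s" "s < u" "u \<le> T" and Z: "Z \<in> borel_measurable (F s)"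
    and h: "h \<in> borel_measurable (\<Pi>\<^sub>M i\<in>{1..m}. borel)"
  shows "indep_var borel Z borel (\<lambda>\<omega>. h (\<lambda>i\<in>{1..m}. D i s u \<omega>))"
proof -
  define V where "V \<omega> = (\<lambda>i\<in>{1..m}. D i s u \<omega>)" for \<omega>
  let ?N = "\<Pi>\<^sub>M i\<in>{1..m}. (borel :: real measure)"
  have V: "V \<in> measurable M ?N"
    unfolding V_def using s by (intro measurable_restrict D_measurable) auto
  then have Vsp: "V \<in> space M \<rightarrow> space ?N" by (auto simp: measurable_def)
  have ind: "indep_set (sets (F s)) {V -` A \<inter> space M | A. A \<in> sets ?N}"
    using wiener s unfolding wiener_process_def V_def by auto
  have sub: "subalgebra M (F s)" using subalgebra_F s by auto
  have ZM: "Z \<in> borel_measurable M" using sub Z measurable_from_subalg by blast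
  have A: "sigma_sets (space M) {Z -` A \<inter> space M | A. A \<in> sets borel} \<subseteq> sets (F s)"
  proof -
    have "{Z -` A \<inter> space M | A. A \<in> sets borel} \<subseteq> sets (F s)"
      using Z sub by (auto simp: subalgebra_def measurable_def)
    then show ?thesis using sets.sigma_sets_subset[of _ "F s"] sub by (auto simp: subalgebra_def)
  qed
  \<comment> \<open>The preimages under \<open>V\<close> already form a sigma-algebra, so they
    contain the one generated by \<open>h\<close> composed with \<open>V\<close>.\<close>
  have B: "sigma_sets (space M) {(\<lambda>\<omega>. h (V \<omega>)) -` A \<inter> space M | A. A \<in> sets borel} \<subseteq> {V -` A \<inter> space M | A. A \<in> sets ?N}"
  proof -
    have 1: "{V -` A \<inter> space M | A. A \<in> sets ?N} = sets (vimage_algebra (space M) V ?N)"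
      by (rule sets_vimage_algebra2[OF Vsp, symmetric])
    have "{(\<lambda>\<omega>. h (V \<omega>)) -` A \<inter> space M | A. A \<in> sets borel} \<subseteq> {V -` A \<inter> space M | A. A \<in> sets ?N}"
    proof safe
      fix A :: "real set" assume "A \<in> sets borel"
      then have "h -` A \<inter> space ?N \<in> sets ?N" using h by (rule measurable_sets[rotated])
      moreover have "(\<lambda>\<omega>. h (V \<omega>)) -` A \<inter> space M = V -` (h -` A \<inter> space ?N) \<inter> space M"
        using Vsp by auto
      ultimately show "\<exists>Aa. (\<lambda>\<omega>. h (V \<omega>)) -` A \<inter> space M = V -` Aa \<inter> space M \<and> Aa \<in> sets ?N" by blast
    qed
    then show ?thesis unfolding 1 using sets.sigma_sets_subset[of _ "vimage_algebra (space M) V ?N"] by simp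
  qed
  have "indep_set (sigma_sets (space M) {Z -` A \<inter> space M | A. A \<in> sets borel})
     (sigma_sets (space M) {(\<lambda>\<omega>. h (V \<omega>)) -` A \<inter> space M | A. A \<in> sets borel})"
    using ind A B unfolding indep_sets2_eq by (meson subset_iff subset_trans)
  moreover have "(\<lambda>\<omega>. h (V \<omega>)) \<in> borel_measurable M" using measurable_compose[OF V h] .
  ultimately show ?thesis using ZM unfolding indep_var_eq V_def by auto
qed

lemma D_moments:
  assumes "i \<in> {1..m}" "0 \<le> s" "s < u" "u \<le> T"
  shows "integrable M (D i s u)" "(\<integral>\<omega>. D i s u \<omega> \<partial>M) = 0"
    "integrable M (\<lambda>\<omega>. (D i s u \<omega>)\<^sup>2)" "(\<integral>\<omega>. (D i s u \<omega>)\<^sup>2 \<partial>M) = u - s"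
proof -
  have d: "distributed M lborel (D i s u) (normal_density 0 (sqrt (u - s)))"
    using wiener assms unfolding wiener_process_def by auto
  have pos: "0 < sqrt (u - s)" using assms by simp
  show int: "integrable M (D i s u)"
    using distributed_integrable[OF d, of "\<lambda>x. x"] integrable_normal_moment_nz_1[OF pos, of 0] by simp
  show e: "(\<integral>\<omega>. D i s u \<omega> \<partial>M) = 0" using normal_distributed_expectation[OF pos d] .
  show "integrable M (\<lambda>\<omega>. (D i s u \<omega>)\<^sup>2)"
    using distributed_integrable[OF d, of "\<lambda>x. x^2"] integrable_normal_moment[OF pos, of 0 2] by simp
  show "(\<integral>\<omega>. (D i s u \<omega>)\<^sup>2 \<partial>M) = u - s"
    using normal_distributed_variance[OF pos d] assms unfolding e by simp
qed

text \<open>The components are independent as processes, and an increment is a measurable function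
  of a path through its values at \<open>s\<close> and \<open>u\<close>.\<close>

lemma D_cross_component:
  assumes i: "i \<in> {1..m}" "j \<in> {1..m}" "i \<noteq> j" and s: "0 \<le> s" "s < u" "u \<le> T"
  shows "(\<integral>\<omega>. D i s u \<omega> * D j s u \<omega> \<partial>M) = 0"
proof -
  have ind: "indep_vars (\<lambda>_. \<Pi>\<^sub>M s\<in>{0..T}. borel) (\<lambda>i \<omega>. \<lambda>s\<in>{0..T}. W i s \<omega>) {1..m}"
    using wiener unfolding wiener_process_def by auto
  let ?K = "\<lambda>_::nat. (\<Pi>\<^sub>M s\<in>{0..T}. (borel :: real measure))"
  have meas: "(\<lambda>v. v q u - v q s) \<in> borel_measurable (PiM {q} ?K)" for q
  proof -
    have "(\<lambda>v. v q r) \<in> borel_measurable (PiM {q} ?K)" if "r \<in> {0..T}" for r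
      using measurable_compose[OF measurable_component_singleton[of q "{q}" ?K] measurable_component_singleton[of r "{0..T}" "\<lambda>_. borel"]] that
      by simp
    then show ?thesis using s by (intro borel_measurable_diff) auto
  qed
  have 1: "indep_var (PiM {i} ?K) (\<lambda>\<omega>. restrict (\<lambda>i. \<lambda>s\<in>{0..T}. W i s \<omega>) {i})
     (PiM {j} ?K) (\<lambda>\<omega>. restrict (\<lambda>i. \<lambda>s\<in>{0..T}. W i s \<omega>) {j})"
    by (rule indep_var_restrict[OF ind]) (use i in auto)
  have "indep_var borel (D i s u) borel (D j s u)"
    using indep_var_compose[OF 1 meas meas] s by (simp add: comp_def)
  from indep_var_lebesgue_integral[OF this] show ?thesis
    using D_moments[OF i(1) s] D_moments[OF i(2) s] by simp
qed

lemma D_product_moments: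
  assumes i: "i \<in> {1..m}" "j \<in> {1..m}" and s: "0 \<le> s" "s < u" "u \<le> T"
  shows "integrable M (\<lambda>\<omega>. D i s u \<omega> * D j s u \<omega>)"
    "(\<integral>\<omega>. D i s u \<omega> * D j s u \<omega> \<partial>M) = (if i = j then u - s else 0)"
proof -
  have "square_integrable M (D i s u)" "square_integrable M (D j s u)"
    using D_moments[OF i(1) s] D_moments[OF i(2) s] by (auto simp: square_integrable_def)
  then show "integrable M (\<lambda>\<omega>. D i s u \<omega> * D j s u \<omega>)" by (rule square_integrable_mult_integrable)
  show "(\<integral>\<omega>. D i s u \<omega> * D j s u \<omega> \<partial>M) = (if i = j then u - s else 0)"
    using D_cross_component[OF i _ s] D_moments(4)[OF i(1) s] by (cases "i = j") (auto simp: power2_eq_square)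
qed

text \<open>The martingale property of the increments. The case \<open>s = u\<close> is separate
  because \<open>wiener_process\<close> gives laws and independence only for
  \<open>s < u\<close>.\<close>

lemma expectation_F_times_D:
  assumes i: "i \<in> {1..m}" and s: "0 \<le> s" "s \<le> u" "u \<le> T"
    and Z: "Z \<in> borel_measurable (F s)" "integrable M Z"
  shows "(\<integral>\<omega>. Z \<omega> * D i s u \<omega> \<partial>M) = 0"
proof (cases "s = u")
  case False
  then have su: "s < u" using s by simp
  have "indep_var borel Z borel (\<lambda>\<omega>. (\<lambda>i\<in>{1..m}. D i s u \<omega>) i)"
    by (rule indep_F_increment[OF s(1) su s(3) Z(1)]) (use i in \<open>intro measurable_component_singleton; simp\<close>)
  then have "indep_var borel Z borel (D i s u)" using i by simp
  from indep_var_lebesgue_integral[OF this] show ?thesis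
    using Z D_moments[OF i s(1) su s(3)] by simp
qed simp

lemma F_times_D_product:
  assumes i: "i \<in> {1..m}" "j \<in> {1..m}" and s: "0 \<le> s" "s \<le> u" "u \<le> T"
    and Z: "Z \<in> borel_measurable (F s)" "integrable M Z"
  shows "integrable M (\<lambda>\<omega>. Z \<omega> * (D i s u \<omega> * D j s u \<omega>))"
    "(\<integral>\<omega>. Z \<omega> * (D i s u \<omega> * D j s u \<omega>) \<partial>M) = (if i = j then (\<integral>\<omega>. Z \<omega> \<partial>M) * (u - s) else 0)"
proof -
  have "integrable M (\<lambda>\<omega>. Z \<omega> * (D i s u \<omega> * D j s u \<omega>)) \<and>
    (\<integral>\<omega>. Z \<omega> * (D i s u \<omega> * D j s u \<omega>) \<partial>M) = (if i = j then (\<integral>\<omega>. Z \<omega> \<partial>M) * (u - s) else 0)"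
  proof (cases "s = u")
    case False
    then have su: "s < u" using s by simp
    have h: "(\<lambda>v. v i * v j) \<in> borel_measurable (\<Pi>\<^sub>M i\<in>{1..m}. (borel::real measure))"
      using i by (intro borel_measurable_times measurable_component_singleton)
    have "indep_var borel Z borel (\<lambda>\<omega>. D i s u \<omega> * D j s u \<omega>)"
      using indep_F_increment[OF s(1) su s(3) Z(1) h] i by simp
    from indep_var_lebesgue_integral[OF this] indep_var_integrable[OF this] show ?thesis
      using Z D_product_moments[OF i s(1) su s(3)] by auto
  qed simp
  then show "integrable M (\<lambda>\<omega>. Z \<omega> * (D i s u \<omega> * D j s u \<omega>))"
    "(\<integral>\<omega>. Z \<omega> * (D i s u \<omega> * D j s u \<omega>) \<partial>M) = (if i = j then (\<integral>\<omega>. Z \<omega> \<partial>M) * (u - s) else 0)"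
    by auto
qed

section \<open>Integrals of one-step processes\<close>

lemma square_integrable_F_times_D:
  assumes i: "i \<in> {1..m}" and s: "0 \<le> s" "s \<le> u" "u \<le> T"
    and Z: "Z \<in> borel_measurable (F s)" "square_integrable M Z"
  shows "square_integrable M (\<lambda>\<omega>. Z \<omega> * D i s u \<omega>)"
proof -
  have "integrable M (\<lambda>\<omega>. (Z \<omega>)\<^sup>2 * (D i s u \<omega> * D i s u \<omega>))"
    by (rule F_times_D_product(1)[OF i i s]) (use Z in \<open>auto simp: square_integrable_def\<close>)
  then have "integrable M (\<lambda>\<omega>. (Z \<omega> * D i s u \<omega>)\<^sup>2)"
    by (simp add: power_mult_distrib power2_eq_square mult_ac)
  moreover have "(\<lambda>\<omega>. Z \<omega> * D i s u \<omega>) \<in> borel_measurable M"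
    using Z D_measurable[OF i s] by (intro borel_measurable_times) (auto simp: square_integrable_def)
  ultimately show ?thesis by (simp add: square_integrable_def)
qed

text \<open>Everything in front of the later increment, including the earlier increment, is
  \<open>F c\<close>-measurable and so acts as a coefficient in the martingale property.\<close>

lemma elementary_orthogonal:
  assumes i: "i \<in> {1..m}" "j \<in> {1..m}" and s: "0 \<le> a" "a \<le> b" "b \<le> c" "c \<le> d" "d \<le> T"
    and X: "X \<in> borel_measurable (F a)" "square_integrable M X"
    and Y: "Y \<in> borel_measurable (F c)" "square_integrable M Y"
  shows "(\<integral>\<omega>. (X \<omega> * D i a b \<omega>) * (Y \<omega> * D j c d \<omega>) \<partial>M) = 0"
proof -
  have sq: "square_integrable M (\<lambda>\<omega>. X \<omega> * D i a b \<omega>)"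
    using s by (intro square_integrable_F_times_D i X) auto
  have XF: "X \<in> borel_measurable (F c)" by (rule F_measurable_mono[OF X(1)]) (use s in auto)
  have DF: "D i a b \<in> borel_measurable (F c)" by (rule F_measurable_mono[OF D_F_measurable[OF i(1)]]) (use s in auto)
  have "(\<integral>\<omega>. (X \<omega> * D i a b \<omega> * Y \<omega>) * D j c d \<omega> \<partial>M) = 0"
    by (rule expectation_F_times_D)
       (use s i XF DF Y square_integrable_mult_integrable[OF sq Y(2)] in \<open>auto intro!: borel_measurable_times\<close>)
  then show ?thesis by (simp add: mult.assoc)
qed

text \<open>The longer increment is cut at \<open>b\<close>: its second part is orthogonal to
  everything before, and its first part lives on the same interval as the other increment.\<close>

lemma elementary_isometry_le:
  assumes i: "i \<in> {1..m}" "j \<in> {1..m}" and s: "0 \<le> a" "a \<le> b" "b \<le> d" "d \<le> T"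
    and X: "X \<in> borel_measurable (F a)" "square_integrable M X"
    and Y: "Y \<in> borel_measurable (F a)" "square_integrable M Y"
  shows "(\<integral>\<omega>. (X \<omega> * D i a b \<omega>) * (Y \<omega> * D j a d \<omega>) \<partial>M) =
    (if i = j then (\<integral>\<omega>. X \<omega> * Y \<omega> \<partial>M) * (b - a) else 0)"
proof -
  have XY: "integrable M (\<lambda>\<omega>. X \<omega> * Y \<omega>)" "(\<lambda>\<omega>. X \<omega> * Y \<omega>) \<in> borel_measurable (F a)"
    using X Y square_integrable_mult_integrable by (auto intro: borel_measurable_times)
  have b: "b \<le> T" "a \<le> d" using s by auto
  have YF: "Y \<in> borel_measurable (F b)" by (rule F_measurable_mono[OF Y(1)]) (use s in auto)
  have 1: "square_integrable M (\<lambda>\<omega>. X \<omega> * D i a b \<omega>)" "square_integrable M (\<lambda>\<omega>. Y \<omega> * D j b d \<omega>)"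
    "square_integrable M (\<lambda>\<omega>. Y \<omega> * D j a b \<omega>)"
    using s by (intro square_integrable_F_times_D i X Y YF; simp)+
  have "(\<integral>\<omega>. (X \<omega> * D i a b \<omega>) * (Y \<omega> * D j a d \<omega>) \<partial>M) =
     (\<integral>\<omega>. (X \<omega> * D i a b \<omega>) * (Y \<omega> * D j a b \<omega>) + (X \<omega> * D i a b \<omega>) * (Y \<omega> * D j b d \<omega>) \<partial>M)"
    by (intro Bochner_Integration.integral_cong) (auto simp: algebra_simps)
  also have "\<dots> = (\<integral>\<omega>. (X \<omega> * D i a b \<omega>) * (Y \<omega> * D j a b \<omega>) \<partial>M) + (\<integral>\<omega>. (X \<omega> * D i a b \<omega>) * (Y \<omega> * D j b d \<omega>) \<partial>M)"
    by (intro Bochner_Integration.integral_add square_integrable_mult_integrable 1)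
  also have "(\<integral>\<omega>. (X \<omega> * D i a b \<omega>) * (Y \<omega> * D j b d \<omega>) \<partial>M) = 0"
    by (rule elementary_orthogonal[OF i s(1,2) order_refl s(3,4) X YF Y(2)])
  also have "(\<integral>\<omega>. (X \<omega> * D i a b \<omega>) * (Y \<omega> * D j a b \<omega>) \<partial>M) = (\<integral>\<omega>. (X \<omega> * Y \<omega>) * (D i a b \<omega> * D j a b \<omega>) \<partial>M)"
    by (intro Bochner_Integration.integral_cong) (auto simp: mult_ac)
  also have "\<dots> = (if i = j then (\<integral>\<omega>. X \<omega> * Y \<omega> \<partial>M) * (b - a) else 0)"
    by (rule F_times_D_product(2)[OF i s(1,2) b(1) XY(2,1)])
  finally show ?thesis by simp
qed

text \<open>The part of \<open>[a, b)\<close> before \<open>c\<close> is orthogonal to the increment over \<open>[c, d)\<close>; what remains starts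
  at the common point \<open>c\<close>.\<close>

lemma elementary_isometry_aux:
  assumes i: "i \<in> {1..m}" "j \<in> {1..m}" and s: "0 \<le> a" "a \<le> b" "b \<le> T" "0 \<le> c" "c \<le> d" "d \<le> T" "a \<le> c"
    and X: "X \<in> borel_measurable (F a)" "square_integrable M X"
    and Y: "Y \<in> borel_measurable (F c)" "square_integrable M Y"
  shows "(\<integral>\<omega>. (X \<omega> * D i a b \<omega>) * (Y \<omega> * D j c d \<omega>) \<partial>M) =
    (if i = j then (\<integral>\<omega>. X \<omega> * Y \<omega> \<partial>M) * max 0 (min b d - c) else 0)"
proof (cases "b \<le> c")
  case True
  then show ?thesis using elementary_orthogonal[OF i s(1,2) True s(5,6) X Y] by simp
next
  case False
  then have cb: "c \<le> b" by simp
  have XF: "X \<in> borel_measurable (F c)" by (rule F_measurable_mono[OF X(1)]) (use s in auto)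
  have 1: "square_integrable M (\<lambda>\<omega>. X \<omega> * D i a c \<omega>)" "square_integrable M (\<lambda>\<omega>. X \<omega> * D i c b \<omega>)"
    "square_integrable M (\<lambda>\<omega>. Y \<omega> * D j c d \<omega>)"
    using s cb by (intro square_integrable_F_times_D i X XF Y; simp)+
  have "(\<integral>\<omega>. (X \<omega> * D i a b \<omega>) * (Y \<omega> * D j c d \<omega>) \<partial>M) =
     (\<integral>\<omega>. (X \<omega> * D i a c \<omega>) * (Y \<omega> * D j c d \<omega>) + (X \<omega> * D i c b \<omega>) * (Y \<omega> * D j c d \<omega>) \<partial>M)"
    by (intro Bochner_Integration.integral_cong) (auto simp: algebra_simps)
  also have "\<dots> = (\<integral>\<omega>. (X \<omega> * D i a c \<omega>) * (Y \<omega> * D j c d \<omega>) \<partial>M) + (\<integral>\<omega>. (X \<omega> * D i c b \<omega>) * (Y \<omega> * D j c d \<omega>) \<partial>M)"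
    by (intro Bochner_Integration.integral_add square_integrable_mult_integrable 1)
  also have "(\<integral>\<omega>. (X \<omega> * D i a c \<omega>) * (Y \<omega> * D j c d \<omega>) \<partial>M) = 0"
    by (rule elementary_orthogonal[OF i s(1) s(7) order_refl s(5,6) X Y])
  also have "(\<integral>\<omega>. (X \<omega> * D i c b \<omega>) * (Y \<omega> * D j c d \<omega>) \<partial>M) =
      (if i = j then (\<integral>\<omega>. X \<omega> * Y \<omega> \<partial>M) * (min b d - c) else 0)"
  proof (cases "b \<le> d")
    case True
    then show ?thesis using elementary_isometry_le[OF i s(4) cb True s(6) XF X(2) Y] by simp
  next
    case False
    then have "d \<le> b" by simp
    from elementary_isometry_le[OF i(2,1) s(4,5) this s(3) Y XF X(2)] \<open>d \<le> b\<close> show ?thesis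
      by (simp add: mult.commute)
  qed
  finally show ?thesis using s cb by simp
qed

text \<open>The last factor is the length of the overlap of the two intervals, so integrals over
  unrelated partitions can be compared without a common refinement. The case
  \<open>c \<le> a\<close> follows by exchanging the two integrals.\<close>

lemma elementary_isometry:
  assumes i: "i \<in> {1..m}" "j \<in> {1..m}" and s: "0 \<le> a" "a \<le> b" "b \<le> T" "0 \<le> c" "c \<le> d" "d \<le> T"
    and X: "X \<in> borel_measurable (F a)" "square_integrable M X"
    and Y: "Y \<in> borel_measurable (F c)" "square_integrable M Y"
  shows "(\<integral>\<omega>. (X \<omega> * D i a b \<omega>) * (Y \<omega> * D j c d \<omega>) \<partial>M) =
    (if i = j then (\<integral>\<omega>. X \<omega> * Y \<omega> \<partial>M) * max 0 (min b d - max a c) else 0)"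
proof (cases "a \<le> c")
  case True
  then show ?thesis using elementary_isometry_aux[OF i s True X Y] by (simp add: max_absorb2)
next
  case False
  then have "c \<le> a" by simp
  have eq: "(X \<omega> * D i a b \<omega>) * (Y \<omega> * D j c d \<omega>) = (Y \<omega> * D j c d \<omega>) * (X \<omega> * D i a b \<omega>)"
    "X \<omega> * Y \<omega> = Y \<omega> * X \<omega>" for \<omega> by simp_all
  show ?thesis unfolding eq using elementary_isometry_aux[OF i(2,1) s(4-6) s(1-3) \<open>c \<le> a\<close> Y X] \<open>c \<le> a\<close>
    by (auto simp: max_absorb1 min.commute)
qed

end


subsection \<open>The Ito isometry\<close>

lemma interval_partition_mono:
  assumes "interval_partition a b N \<tau>" "j \<le> l" "l \<le> N"
  shows "\<tau> j \<le> \<tau> l"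
  using assms(2,3)
proof (induction l rule: dec_induct)
  case (step n)
  then have "\<tau> n < \<tau> (Suc n)" using assms(1) by (auto simp: interval_partition_def)
  with step show ?case by simp
qed simp

lemma interval_partition_bounds:
  assumes "interval_partition a b N \<tau>" "j < N"
  shows "a \<le> \<tau> j" "\<tau> j < \<tau> (Suc j)" "\<tau> (Suc j) \<le> b"
  using interval_partition_mono[OF assms(1), of 0 j] interval_partition_mono[OF assms(1), of "Suc j" N] assms
  by (auto simp: interval_partition_def)

text \<open>\<open>has_ito_integral\<close> lives on \<open>[t, s]\<close> for varying
  \<open>s\<close>; with this lemma all these product spaces become parts of the one over
  \<open>[t, T]\<close>. Both measures agree on rectangles.\<close>

lemma pair_measure_restrict_space:
  assumes A: "sigma_finite_measure A" and B: "sigma_finite_measure B" and S: "S \<in> sets A"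
  shows "restrict_space A S \<Otimes>\<^sub>M B = restrict_space (A \<Otimes>\<^sub>M B) (S \<times> space B)"
proof (rule pair_measure_eqI)
  interpret B: sigma_finite_measure B by fact
  have S': "S \<subseteq> space A" using S sets.sets_into_space by auto
  have SB: "S \<times> space B \<in> sets (A \<Otimes>\<^sub>M B)" using S by auto
  show "sigma_finite_measure (restrict_space A S)" by (rule sigma_finite_measure_restrict_space[OF A S])
  show "sigma_finite_measure B" by fact
  have "sets (restrict_space (A \<Otimes>\<^sub>M B) (S \<times> space B)) =
     (\<inter>) (S \<times> space B) ` sigma_sets (space A \<times> space B) {a \<times> b | a b. a \<in> sets A \<and> b \<in> sets B}"
    by (simp add: sets_restrict_space sets_pair_measure)
  also have "\<dots> = sigma_sets (S \<times> space B) ((\<inter>) (S \<times> space B) ` {a \<times> b | a b. a \<in> sets A \<and> b \<in> sets B})"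
    by (rule sigma_sets_Int) (use SB S' in \<open>auto simp: sets_pair_measure\<close>)
  also have "(\<inter>) (S \<times> space B) ` {a \<times> b | a b. a \<in> sets A \<and> b \<in> sets B} =
     {a \<times> b | a b. a \<in> sets (restrict_space A S) \<and> b \<in> sets B}"
  proof safe
    fix a b assume "a \<in> sets A" "b \<in> sets B"
    moreover have "(S \<times> space B) \<inter> (a \<times> b) = (S \<inter> a) \<times> b" using sets.sets_into_space[OF \<open>b \<in> sets B\<close>] by auto
    ultimately show "\<exists>c d. (S \<times> space B) \<inter> (a \<times> b) = c \<times> d \<and> c \<in> sets (restrict_space A S) \<and> d \<in> sets B"
      by (auto simp: sets_restrict_space)
  next
    fix a b assume "a \<in> sets (restrict_space A S)" and b: "b \<in> sets B"
    then obtain c where c: "c \<in> sets A" "a = S \<inter> c" by (auto simp: sets_restrict_space)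
    have "a \<times> b = (S \<times> space B) \<inter> (c \<times> b)" using c sets.sets_into_space[OF b] by auto
    then show "a \<times> b \<in> (\<inter>) (S \<times> space B) ` {a \<times> b | a b. a \<in> sets A \<and> b \<in> sets B}" using b c by blast
  qed
  also have "sigma_sets (S \<times> space B) {a \<times> b | a b. a \<in> sets (restrict_space A S) \<and> b \<in> sets B} =
     sets (restrict_space A S \<Otimes>\<^sub>M B)"
    using S' by (simp add: sets_pair_measure space_restrict_space Int_absorb2)
  finally show "sets (restrict_space A S \<Otimes>\<^sub>M B) = sets (restrict_space (A \<Otimes>\<^sub>M B) (S \<times> space B))" by simp
  fix a b assume "a \<in> sets (restrict_space A S)" and b: "b \<in> sets B"
  then have a: "a \<in> sets A" "a \<subseteq> S" using S S' by (auto simp: sets_restrict_space)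
  have "emeasure (restrict_space (A \<Otimes>\<^sub>M B) (S \<times> space B)) (a \<times> b) = emeasure (A \<Otimes>\<^sub>M B) (a \<times> b)"
    using a SB sets.sets_into_space[OF b] sets.sets_into_space[OF SB]
    by (intro emeasure_restrict_space) (auto simp: Int_absorb2)
  also have "\<dots> = emeasure A a * emeasure B b" using a b by (intro B.emeasure_pair_measure_Times)
  also have "emeasure A a = emeasure (restrict_space A S) a"
    using a S S' by (intro emeasure_restrict_space[symmetric]) (auto simp: Int_absorb2)
  finally show "emeasure (restrict_space A S) a * emeasure B b = emeasure (restrict_space (A \<Otimes>\<^sub>M B) (S \<times> space B)) (a \<times> b)"
    by simp
qed

lemma (in pair_sigma_finite) integrable_tensor:
  fixes g :: "'a \<Rightarrow> real" and h :: "'b \<Rightarrow> real"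
  assumes g: "integrable M1 g" and h: "integrable M2 h"
  shows "integrable (M1 \<Otimes>\<^sub>M M2) (\<lambda>(x, y). g x * h y)"
    "(\<integral>(x, y). g x * h y \<partial>(M1 \<Otimes>\<^sub>M M2)) = (\<integral>x. g x \<partial>M1) * (\<integral>y. h y \<partial>M2)"
proof -
  have [measurable]: "g \<in> borel_measurable M1" "h \<in> borel_measurable M2" using g h by auto
  show int: "integrable (M1 \<Otimes>\<^sub>M M2) (\<lambda>(x, y). g x * h y)"
  proof (rule Fubini_integrable)
    show "integrable M1 (\<lambda>x. \<integral>y. norm (case (x, y) of (x, y) \<Rightarrow> g x * h y) \<partial>M2)"
      using g by (simp add: abs_mult)
    show "AE x in M1. integrable M2 (\<lambda>y. case (x, y) of (x, y) \<Rightarrow> g x * h y)"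
      using h by simp
  qed measurable
  show "(\<integral>(x, y). g x * h y \<partial>(M1 \<Otimes>\<^sub>M M2)) = (\<integral>x. g x \<partial>M1) * (\<integral>y. h y \<partial>M2)"
    using integral_fst'[OF int] by simp
qed

lemma measure_lebesgue_on_Ico:
  assumes "t \<le> a" "b \<le> T"
  shows "integrable (lebesgue_on {t..T}) (indicator {a..<b} :: real \<Rightarrow> real)"
    "(\<integral>x. indicator {a..<b} x \<partial>lebesgue_on {t..T}) = (max 0 (b - a) :: real)"
proof -
  have eq: "(\<lambda>x. indicator {t..T} x *\<^sub>R indicator {a..<b} x) = (indicator {a..<b} :: real \<Rightarrow> real)"
    using assms by (auto simp: fun_eq_iff split: split_indicator)
  have m: "{a..<b} \<in> lmeasurable" by (rule bounded_set_imp_lmeasurable) auto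
  show "integrable (lebesgue_on {t..T}) (indicator {a..<b} :: real \<Rightarrow> real)"
    by (subst integrable_restrict_space) (use m in \<open>simp_all add: eq[unfolded real_scaleR_def] fmeasurable_def integrable_indicator_iff\<close>)
  have "(\<integral>x. indicator {a..<b} x \<partial>lebesgue_on {t..T}) = (\<integral>x. (indicator {a..<b} x :: real) \<partial>lebesgue)"
    by (subst integral_restrict_space) (simp_all add: eq[unfolded real_scaleR_def])
  also have "\<dots> = measure lebesgue {a..<b}" by simp
  also have "\<dots> = max 0 (b - a)" by (cases "a \<le> b") auto
  finally show "(\<integral>x. indicator {a..<b} x \<partial>lebesgue_on {t..T}) = (max 0 (b - a) :: real)" .
qed

section \<open>Simple integrands and their isometry\<close>

locale ito = brownian M F T m W for M :: "'a measure" and F T m W +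
  fixes t :: real
  assumes t: "0 \<le> t" "t < T"
begin

abbreviation "L \<equiv> lebesgue_on {t..T}"
abbreviation "P \<equiv> L \<Otimes>\<^sub>M M"

sublocale L: finite_measure L
  by (rule finite_measure_lebesgue_on) auto

sublocale P: pair_sigma_finite L M ..

text \<open>A relation between integrand and integral instead of a function of the integrand: no
  representation has to be shown unique, and intervals may overlap, so differences need no common
  partition.\<close>

inductive simple_ito :: "nat \<Rightarrow> (real \<times> 'a \<Rightarrow> real) \<Rightarrow> ('a \<Rightarrow> real) \<Rightarrow> bool" for i where
  zero: "simple_ito i (\<lambda>_. 0) (\<lambda>_. 0)"
| add: "simple_ito i f X \<Longrightarrow> t \<le> a \<Longrightarrow> a \<le> b \<Longrightarrow> b \<le> T \<Longrightarrow> \<eta> \<in> borel_measurable (F a) \<Longrightarrow>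
    square_integrable M \<eta> \<Longrightarrow>
    simple_ito i (\<lambda>z. f z + \<eta> (snd z) * indicator {a..<b} (fst z)) (\<lambda>\<omega>. X \<omega> + \<eta> \<omega> * D i a b \<omega>)"

lemma elementary_square_integrable:
  assumes "t \<le> a" "b \<le> T" "square_integrable M \<eta>"
  shows "square_integrable P (\<lambda>z. \<eta> (snd z) * indicator {a..<b} (fst z))"
proof -
  note [measurable] = square_integrableD(1)[OF assms(3)]
  have [measurable]: "(indicator {a..<b} :: real \<Rightarrow> real) \<in> borel_measurable L"
    by (rule borel_measurable_integrable[OF measure_lebesgue_on_Ico(1)[OF assms(1,2)]])
  have "integrable P (\<lambda>(x, y). indicator {a..<b} x * (\<eta> y)\<^sup>2)"
    by (rule P.integrable_tensor) (use measure_lebesgue_on_Ico[OF assms(1,2)] square_integrableD[OF assms(3)] in auto)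
  also have "(\<lambda>(x, y). indicator {a..<b} x * (\<eta> y)\<^sup>2) = (\<lambda>z. (\<eta> (snd z) * indicator {a..<b} (fst z))\<^sup>2)"
    by (auto simp: fun_eq_iff power_mult_distrib split: split_indicator)
  finally have "integrable P (\<lambda>z. (\<eta> (snd z) * indicator {a..<b} (fst z))\<^sup>2)" .
  moreover have "(\<lambda>z. \<eta> (snd z) * indicator {a..<b} (fst z)) \<in> borel_measurable P"
    by measurable
  ultimately show ?thesis by (simp add: square_integrable_def)
qed

text \<open>The same product of an expectation and an overlap length as in
  \<open>elementary_isometry\<close>, now on the side of the integrands.\<close>

lemma elementary_inner:
  assumes "t \<le> a" "b \<le> T" "t \<le> c" "d \<le> T" "square_integrable M X" "square_integrable M Y"
  shows "(\<integral>z. (X (snd z) * indicator {a..<b} (fst z)) * (Y (snd z) * indicator {c..<d} (fst z)) \<partial>P) =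
    (\<integral>\<omega>. X \<omega> * Y \<omega> \<partial>M) * max 0 (min b d - max a c)"
proof -
  have "(\<integral>z. (X (snd z) * indicator {a..<b} (fst z)) * (Y (snd z) * indicator {c..<d} (fst z)) \<partial>P) =
     (\<integral>(r, \<omega>). indicator {max a c..<min b d} r * (X \<omega> * Y \<omega>) \<partial>P)"
    by (intro Bochner_Integration.integral_cong) (auto split: split_indicator)
  also have "\<dots> = (\<integral>r. indicator {max a c..<min b d} r \<partial>L) * (\<integral>\<omega>. X \<omega> * Y \<omega> \<partial>M)"
    by (rule P.integrable_tensor(2))
       (use assms square_integrable_mult_integrable measure_lebesgue_on_Ico(1)[of t "max a c" "min b d" T] in auto)
  also have "(\<integral>r. indicator {max a c..<min b d} r \<partial>L) = max 0 (min b d - max a c)"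
    by (rule measure_lebesgue_on_Ico) (use assms in auto)
  finally show ?thesis by simp
qed

lemma elementary_F_square_integrable:
  assumes "i \<in> {1..m}" "t \<le> a" "a \<le> b" "b \<le> T" "\<eta> \<in> borel_measurable (F a)" "square_integrable M \<eta>"
  shows "square_integrable M (\<lambda>\<omega>. \<eta> \<omega> * D i a b \<omega>)"
  using assms t by (intro square_integrable_F_times_D) auto

lemma simple_ito_square_integrable:
  assumes "simple_ito i f X" "i \<in> {1..m}"
  shows "square_integrable P f" "square_integrable M X"
  using assms
  by (induction rule: simple_ito.induct)
     (auto intro!: square_integrable_zero square_integrable_add elementary_square_integrable
       elementary_F_square_integrable)

text \<open>Bilinearity is used in one argument at a time: a single step against a simple integral
  here, two simple integrals in \<open>simple_isometry\<close>.\<close>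

lemma elementary_simple_isometry:
  assumes "simple_ito j g Y" and i: "i \<in> {1..m}" "j \<in> {1..m}"
    and a: "t \<le> a" "a \<le> b" "b \<le> T" "\<eta> \<in> borel_measurable (F a)" "square_integrable M \<eta>"
  shows "(\<integral>\<omega>. (\<eta> \<omega> * D i a b \<omega>) * Y \<omega> \<partial>M) =
    (if i = j then (\<integral>z. (\<eta> (snd z) * indicator {a..<b} (fst z)) * g z \<partial>P) else 0)"
  using assms(1)
proof (induction rule: simple_ito.induct)
  case (add f X c d \<theta>)
  have 1: "square_integrable M (\<lambda>\<omega>. \<eta> \<omega> * D i a b \<omega>)" "square_integrable M (\<lambda>\<omega>. \<theta> \<omega> * D j c d \<omega>)"
    "square_integrable M X"
    using elementary_F_square_integrable i a add simple_ito_square_integrable by auto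
  have 2: "square_integrable P (\<lambda>z. \<eta> (snd z) * indicator {a..<b} (fst z))"
    "square_integrable P (\<lambda>z. \<theta> (snd z) * indicator {c..<d} (fst z))" "square_integrable P f"
    using elementary_square_integrable a add i simple_ito_square_integrable by auto
  have "(\<integral>\<omega>. (\<eta> \<omega> * D i a b \<omega>) * (X \<omega> + \<theta> \<omega> * D j c d \<omega>) \<partial>M) =
      (\<integral>\<omega>. (\<eta> \<omega> * D i a b \<omega>) * X \<omega> \<partial>M) + (\<integral>\<omega>. (\<eta> \<omega> * D i a b \<omega>) * (\<theta> \<omega> * D j c d \<omega>) \<partial>M)"
    unfolding distrib_left by (intro Bochner_Integration.integral_add square_integrable_mult_integrable 1)
  also have "(\<integral>\<omega>. (\<eta> \<omega> * D i a b \<omega>) * (\<theta> \<omega> * D j c d \<omega>) \<partial>M) =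
      (if i = j then (\<integral>\<omega>. \<eta> \<omega> * \<theta> \<omega> \<partial>M) * max 0 (min b d - max a c) else 0)"
    by (rule elementary_isometry) (use i a add t in auto)
  also have "(\<integral>\<omega>. \<eta> \<omega> * \<theta> \<omega> \<partial>M) * max 0 (min b d - max a c) =
      (\<integral>z. (\<eta> (snd z) * indicator {a..<b} (fst z)) * (\<theta> (snd z) * indicator {c..<d} (fst z)) \<partial>P)"
    by (rule elementary_inner[symmetric]) (use a add in auto)
  also have "(\<integral>\<omega>. (\<eta> \<omega> * D i a b \<omega>) * X \<omega> \<partial>M) + (if i = j then
      (\<integral>z. (\<eta> (snd z) * indicator {a..<b} (fst z)) * (\<theta> (snd z) * indicator {c..<d} (fst z)) \<partial>P) else 0) =
    (if i = j then (\<integral>z. (\<eta> (snd z) * indicator {a..<b} (fst z)) * (f z + \<theta> (snd z) * indicator {c..<d} (fst z)) \<partial>P) else 0)"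
    unfolding add.IH distrib_left
    using Bochner_Integration.integral_add[OF square_integrable_mult_integrable[OF 2(1,3)] square_integrable_mult_integrable[OF 2(1,2)]]
    by simp
  finally show ?case .
qed simp

lemma simple_isometry:
  assumes "simple_ito i f X" "simple_ito j g Y" and i: "i \<in> {1..m}" "j \<in> {1..m}"
  shows "(\<integral>\<omega>. X \<omega> * Y \<omega> \<partial>M) = (if i = j then (\<integral>z. f z * g z \<partial>P) else 0)"
  using assms(1)
proof (induction rule: simple_ito.induct)
  case (add f X c d \<theta>)
  have 1: "square_integrable M X" "square_integrable M (\<lambda>\<omega>. \<theta> \<omega> * D i c d \<omega>)" "square_integrable M Y"
    using elementary_F_square_integrable i add simple_ito_square_integrable assms(2) by auto
  have 2: "square_integrable P f" "square_integrable P (\<lambda>z. \<theta> (snd z) * indicator {c..<d} (fst z))" "square_integrable P g"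
    using elementary_square_integrable add i simple_ito_square_integrable assms(2) by auto
  have "(\<integral>\<omega>. (X \<omega> + \<theta> \<omega> * D i c d \<omega>) * Y \<omega> \<partial>M) =
      (\<integral>\<omega>. X \<omega> * Y \<omega> \<partial>M) + (\<integral>\<omega>. (\<theta> \<omega> * D i c d \<omega>) * Y \<omega> \<partial>M)"
    unfolding distrib_right by (intro Bochner_Integration.integral_add square_integrable_mult_integrable 1)
  also have "\<dots> = (if i = j then (\<integral>z. f z * g z \<partial>P) else 0) +
     (if i = j then (\<integral>z. (\<theta> (snd z) * indicator {c..<d} (fst z)) * g z \<partial>P) else 0)"
    unfolding add.IH using elementary_simple_isometry[OF assms(2) i] add by simp
  also have "\<dots> = (if i = j then (\<integral>z. (f z + \<theta> (snd z) * indicator {c..<d} (fst z)) * g z \<partial>P) else 0)"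
    unfolding distrib_right
    using Bochner_Integration.integral_add[OF square_integrable_mult_integrable[OF 2(1,3)] square_integrable_mult_integrable[OF 2(2,3)]]
    by simp
  finally show ?case .
qed simp

lemma simple_ito_diff:
  assumes "simple_ito i f X" "simple_ito i g Y"
  shows "simple_ito i (\<lambda>z. f z - g z) (\<lambda>\<omega>. X \<omega> - Y \<omega>)"
  using assms(2)
proof (induction rule: simple_ito.induct)
  case zero
  then show ?case using assms(1) by simp
next
  case (add f' X' a b \<eta>)
  have "simple_ito i (\<lambda>z. (f z - f' z) + (- \<eta> (snd z)) * indicator {a..<b} (fst z)) (\<lambda>\<omega>. (X \<omega> - X' \<omega>) + (- \<eta> \<omega>) * D i a b \<omega>)"
    using add square_integrable_cmult[of M \<eta> "-1"] by (intro simple_ito.add) (auto simp: borel_measurable_uminus)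
  then show ?case by (simp add: algebra_simps)
qed

lemma simple_ito_sum:
  fixes N :: nat
  assumes "\<And>j. j < N \<Longrightarrow> t \<le> a j \<and> a j \<le> b j \<and> b j \<le> T \<and> \<eta> j \<in> borel_measurable (F (a j)) \<and> square_integrable M (\<eta> j)"
  shows "simple_ito i (\<lambda>z. \<Sum>j<N. \<eta> j (snd z) * indicator {a j..<b j} (fst z)) (\<lambda>\<omega>. \<Sum>j<N. \<eta> j \<omega> * D i (a j) (b j) \<omega>)"
  using assms
proof (induction N)
  case (Suc N)
  then show ?case by (simp only: sum.lessThan_Suc) (intro simple_ito.add; simp)
qed (simp add: simple_ito.zero)

text \<open>Unlike \<open>has_ito_integral\<close>, this relation forgets the interval and the shape of the partitions, so
  that integrals over different intervals live in the same space.\<close>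

definition ito_rel :: "nat \<Rightarrow> (real \<times> 'a \<Rightarrow> real) \<Rightarrow> ('a \<Rightarrow> real) \<Rightarrow> bool" where
  "ito_rel i f X \<longleftrightarrow> (\<exists>fn Xn. (\<forall>n. simple_ito i (fn n) (Xn n)) \<and> l2_tendsto P fn f \<and> l2_tendsto M Xn X)"

lemma ito_rel_simple: "simple_ito i f X \<Longrightarrow> i \<in> {1..m} \<Longrightarrow> ito_rel i f X"
  unfolding ito_rel_def
  by (rule exI[of _ "\<lambda>n. f"], rule exI[of _ "\<lambda>n. X"])
     (simp add: l2_tendsto_const simple_ito_square_integrable)

lemma ito_rel_square_integrable:
  assumes "ito_rel i f X"
  shows "square_integrable P f" "square_integrable M X"
proof -
  obtain fn Xn where "l2_tendsto P fn f" "l2_tendsto M Xn X" using assms unfolding ito_rel_def by (elim exE conjE)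
  then show "square_integrable P f" "square_integrable M X" using l2_tendstoD(2) by blast+
qed

lemma ito_rel_isometry:
  assumes "ito_rel i f X" "ito_rel j g Y" and i: "i \<in> {1..m}" "j \<in> {1..m}"
  shows "(\<integral>\<omega>. X \<omega> * Y \<omega> \<partial>M) = (if i = j then (\<integral>z. f z * g z \<partial>P) else 0)"
proof -
  obtain fn Xn where f: "\<And>n. simple_ito i (fn n) (Xn n)" "l2_tendsto P fn f" "l2_tendsto M Xn X"
    using assms(1) by (auto simp: ito_rel_def)
  obtain gn Yn where g: "\<And>n. simple_ito j (gn n) (Yn n)" "l2_tendsto P gn g" "l2_tendsto M Yn Y"
    using assms(2) by (auto simp: ito_rel_def)
  have 1: "(\<lambda>n. \<integral>\<omega>. Xn n \<omega> * Yn n \<omega> \<partial>M) \<longlonglongrightarrow> (\<integral>\<omega>. X \<omega> * Y \<omega> \<partial>M)" by (rule l2_tendsto_inner[OF f(3) g(3)])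
  have 2: "(\<lambda>n. \<integral>z. fn n z * gn n z \<partial>P) \<longlonglongrightarrow> (\<integral>z. f z * g z \<partial>P)" by (rule l2_tendsto_inner[OF f(2) g(2)])
  show ?thesis
  proof (cases "i = j")
    case True
    then show ?thesis using LIMSEQ_unique[OF 1] 2 simple_isometry[OF f(1) g(1) i] by simp
  next
    case False
    then show ?thesis using LIMSEQ_unique[OF 1] simple_isometry[OF f(1) g(1) i] by simp
  qed
qed

lemma ito_rel_diff:
  assumes "ito_rel i f X" "ito_rel i g Y"
  shows "ito_rel i (\<lambda>z. f z - g z) (\<lambda>\<omega>. X \<omega> - Y \<omega>)"
proof -
  obtain fn Xn where f: "\<And>n. simple_ito i (fn n) (Xn n)" "l2_tendsto P fn f" "l2_tendsto M Xn X"
    using assms(1) by (auto simp: ito_rel_def)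
  obtain gn Yn where g: "\<And>n. simple_ito i (gn n) (Yn n)" "l2_tendsto P gn g" "l2_tendsto M Yn Y"
    using assms(2) by (auto simp: ito_rel_def)
  show ?thesis unfolding ito_rel_def
    using simple_ito_diff[OF f(1) g(1)] l2_tendsto_diff[OF f(2) g(2)] l2_tendsto_diff[OF f(3) g(3)]
    by (intro exI[of _ "\<lambda>n z. fn n z - gn n z"] exI[of _ "\<lambda>n z. Xn n z - Yn n z"]) auto
qed

text \<open>The isometry as it is applied later: to show that approximations are Cauchy, that
  integrals depend continuously on the end point, and that equal integrands give equal
  integrals.\<close>

lemma ito_rel_dist:
  assumes "ito_rel i f X" "ito_rel i g Y" "i \<in> {1..m}"
  shows "(\<integral>\<omega>. (X \<omega> - Y \<omega>)\<^sup>2 \<partial>M) = (\<integral>z. (f z - g z)\<^sup>2 \<partial>P)"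
  using ito_rel_isometry[OF ito_rel_diff[OF assms(1,2)] ito_rel_diff[OF assms(1,2)] assms(3,3)]
  by (simp add: power2_eq_square)

section \<open>Shorter time intervals as strips of the product space\<close>

lemma lebesgue_on_pair_restrict:
  assumes "s \<le> T"
  shows "lebesgue_on {t..s} \<Otimes>\<^sub>M M = restrict_space P ({t..s} \<times> space M)"
proof -
  have "lebesgue_on {t..s} = restrict_space L {t..s}"
    using assms by (subst restrict_restrict_space) (auto simp: Int_absorb1)
  moreover have "{t..s} \<in> sets L" using assms by (auto simp: sets_restrict_space_iff)
  ultimately show ?thesis
    using pair_measure_restrict_space[OF L.sigma_finite_measure_axioms sigma_finite_measure_axioms, of "{t..s}"] by simp
qed

lemma sets_P_strip: "s \<le> T \<Longrightarrow> {t..s} \<times> space M \<in> sets P" "s \<le> T \<Longrightarrow> {t..<s} \<times> space M \<in> sets P"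
  by (rule pair_measureI; auto simp: sets_restrict_space_iff)+

text \<open>The half-open indicator fits the cells of step processes, while the measure lives on the
  closed interval. Dropping the slice at \<open>s\<close> can only decrease the integral, and an
  inequality is enough for convergence.\<close>

lemma indicator_strip_square_integrable:
  assumes s: "s \<le> T" and f: "square_integrable (lebesgue_on {t..s} \<Otimes>\<^sub>M M) f"
  shows "square_integrable P (\<lambda>z. indicator {t..<s} (fst z) * f z)"
    "(\<integral>z. (indicator {t..<s} (fst z) * f z)\<^sup>2 \<partial>P) \<le> (\<integral>z. (f z)\<^sup>2 \<partial>(lebesgue_on {t..s} \<Otimes>\<^sub>M M))"
proof -
  let ?S = "{t..s} \<times> space M"
  have S: "?S \<inter> space P \<in> sets P" using sets_P_strip(1)[OF s] by auto
  have m: "(\<lambda>z. indicator ?S z * f z) \<in> borel_measurable P"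
    using square_integrableD(1)[OF f] unfolding lebesgue_on_pair_restrict[OF s]
    using borel_measurable_restrict_space_iff[OF S, of f] by simp
  have eq2: "(indicator ?S z * f z)\<^sup>2 = indicator ?S z *\<^sub>R (f z)\<^sup>2" for z by (auto split: split_indicator)
  have i: "integrable P (\<lambda>z. (indicator ?S z * f z)\<^sup>2)"
    using square_integrableD(2)[OF f] unfolding lebesgue_on_pair_restrict[OF s] integrable_restrict_space[OF S] eq2 .
  have sq: "square_integrable P (\<lambda>z. indicator ?S z * f z)" using m i by (simp add: square_integrable_def)
  have eq: "indicator {t..<s} (fst z) * f z = indicator ({t..<s} \<times> space M) z * (indicator ?S z * f z)" if "z \<in> space P" for z
    using that by (auto simp: space_pair_measure split: split_indicator)
  have m2: "(\<lambda>z. indicator {t..<s} (fst z) * f z) \<in> borel_measurable P"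
    by (subst measurable_cong[OF eq]) (auto intro!: borel_measurable_times borel_measurable_indicator sets_P_strip s m)
  show sq2: "square_integrable P (\<lambda>z. indicator {t..<s} (fst z) * f z)"
    by (rule square_integrable_bound[OF sq m2]) (auto simp: space_pair_measure split: split_indicator)
  have "(\<integral>z. (indicator {t..<s} (fst z) * f z)\<^sup>2 \<partial>P) \<le> (\<integral>z. (indicator ?S z * f z)\<^sup>2 \<partial>P)"
    by (rule integral_mono[OF square_integrableD(2)[OF sq2] i])
       (auto simp: space_pair_measure split: split_indicator)
  also have "\<dots> = (\<integral>z. (f z)\<^sup>2 \<partial>(lebesgue_on {t..s} \<Otimes>\<^sub>M M))"
    unfolding lebesgue_on_pair_restrict[OF s] integral_restrict_space[OF S] eq2 ..
  finally show "(\<integral>z. (indicator {t..<s} (fst z) * f z)\<^sup>2 \<partial>P) \<le> (\<integral>z. (f z)\<^sup>2 \<partial>(lebesgue_on {t..s} \<Otimes>\<^sub>M M))" .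
qed

lemma partition_simple_ito:
  assumes "interval_partition t s N \<tau>" "s \<le> T"
    and "\<forall>j<N. \<eta> j \<in> borel_measurable (F (\<tau> j)) \<and> square_integrable M (\<eta> j)"
  shows "simple_ito i (\<lambda>z. \<Sum>j<N. \<eta> j (snd z) * indicator {\<tau> j..<\<tau> (Suc j)} (fst z))
     (\<lambda>\<omega>. \<Sum>j<N. \<eta> j \<omega> * (W i (\<tau> (Suc j)) \<omega> - W i (\<tau> j) \<omega>))"
  using interval_partition_bounds[OF assms(1)] assms(2,3)
  by (intro simple_ito_sum) fastforce

text \<open>Outside \<open>[t, s)\<close> both functions vanish, so the error on the full space is
  bounded by the error on the strip.\<close>

lemma l2_tendsto_strip:
  assumes s: "s \<le> T" and l: "l2_tendsto (lebesgue_on {t..s} \<Otimes>\<^sub>M M) f g"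
    and sqf: "\<And>N. square_integrable P (f N)"
    and supp: "\<And>N z. fst z \<notin> {t..<s} \<Longrightarrow> f N z = 0"
  shows "l2_tendsto P f (\<lambda>z. indicator {t..<s} (fst z) * g z)"
proof -
  let ?Q = "lebesgue_on {t..s} \<Otimes>\<^sub>M M" and ?g = "\<lambda>z. indicator {t..<s} (fst z) * g z"
  have sqg: "square_integrable P ?g"
    by (rule indicator_strip_square_integrable(1)[OF s l2_tendstoD(2)[OF l]])
  have le: "(\<integral>z. (f N z - ?g z)\<^sup>2 \<partial>P) \<le> (\<integral>z. (f N z - g z)\<^sup>2 \<partial>?Q)" for N
  proof -
    have sqd: "square_integrable ?Q (\<lambda>z. f N z - g z)"
      using l2_tendstoD(1,2)[OF l] by (intro square_integrable_diff)
    have "f N z - ?g z = indicator {t..<s} (fst z) * (f N z - g z)" for z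
      using supp[of z N] by (cases "fst z \<in> {t..<s}") auto
    then show ?thesis using indicator_strip_square_integrable(2)[OF s sqd] by simp
  qed
  have "(\<lambda>N. \<integral>z. (f N z - ?g z)\<^sup>2 \<partial>P) \<longlonglongrightarrow> 0"
  proof (rule tendsto_sandwich[OF _ _ tendsto_const])
    show "\<forall>\<^sub>F N in sequentially. (\<integral>z. (f N z - ?g z)\<^sup>2 \<partial>P) \<le> (\<integral>z. (f N z - g z)\<^sup>2 \<partial>?Q)"
      using le by (intro always_eventually allI)
    show "(\<lambda>N. \<integral>z. (f N z - g z)\<^sup>2 \<partial>?Q) \<longlonglongrightarrow> 0"
      using l2_tendstoD(3)[OF l] .
  qed simp
  then show ?thesis using sqf sqg by (simp add: l2_tendsto_def)
qed

lemma partition_support: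
  assumes "interval_partition t s N \<tau>" "r \<notin> {t..<s}"
  shows "(\<Sum>j<N. c j * indicator {\<tau> j..<\<tau> (Suc j)} r) = (0::real)"
proof (rule sum.neutral, rule ballI)
  fix j assume "j \<in> {..<N}"
  then show "c j * indicator {\<tau> j..<\<tau> (Suc j)} r = 0"
    using interval_partition_bounds[OF assms(1), of j] assms(2) by (auto split: split_indicator)
qed

lemma has_ito_integral_rel:
  assumes has: "has_ito_integral M F (W i) t s \<xi> X" and s: "s \<le> T" and i: "i \<in> {1..m}"
  shows "ito_rel i (\<lambda>z. indicator {t..<s} (fst z) * \<xi> (fst z) (snd z)) X"
proof -
  let ?Q = "lebesgue_on {t..s} \<Otimes>\<^sub>M M"
  obtain \<tau> \<eta> where \<tau>: "refining_partitions t s \<tau>"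
    and \<eta>: "\<forall>N. \<forall>j<N. \<eta> N j \<in> borel_measurable (F (\<tau> N j)) \<and> square_integrable M (\<eta> N j)"
    and l1: "l2_tendsto ?Q (\<lambda>N (s, \<omega>). \<Sum>j<N. \<eta> N j \<omega> * indicator {\<tau> N j..<\<tau> N (Suc j)} s) (\<lambda>(s, \<omega>). \<xi> s \<omega>)"
    and l2: "l2_tendsto M (\<lambda>N \<omega>. \<Sum>j<N. \<eta> N j \<omega> * (W i (\<tau> N (Suc j)) \<omega> - W i (\<tau> N j) \<omega>)) X"
    using has unfolding has_ito_integral_def by (elim exE conjE)
  define f where "f N z = (\<Sum>j<N. \<eta> N j (snd z) * indicator {\<tau> N j..<\<tau> N (Suc j)} (fst z))" for N z
  define S where "S N \<omega> = (\<Sum>j<N. \<eta> N j \<omega> * (W i (\<tau> N (Suc j)) \<omega> - W i (\<tau> N j) \<omega>))" for N \<omega>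
  \<comment> \<open>No partition exists for \<open>N = 0\<close>; there the sums are empty and the
    pair is \<open>simple_ito.zero\<close>.\<close>
  have part: "N = 0 \<or> interval_partition t s N (\<tau> N)" for N using \<tau> by (auto simp: refining_partitions_def)
  have simp: "simple_ito i (f N) (S N)" for N
  proof (cases "N = 0")
    case True then show ?thesis by (simp add: f_def[abs_def] S_def[abs_def] simple_ito.zero)
  next
    case False
    then have "interval_partition t s N (\<tau> N)" using part[of N] by simp
    then show ?thesis unfolding f_def[abs_def] S_def[abs_def]
      by (rule partition_simple_ito[OF _ s]) (use \<eta> in simp)
  qed
  have supp: "f N z = 0" if "fst z \<notin> {t..<s}" for N z
    using part[of N] partition_support[of s N "\<tau> N" "fst z"] that by (auto simp: f_def)
  have "l2_tendsto P f (\<lambda>z. indicator {t..<s} (fst z) * (case z of (s, \<omega>) \<Rightarrow> \<xi> s \<omega>))"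
  proof (rule l2_tendsto_strip[OF s])
    show "l2_tendsto ?Q f (\<lambda>(s, \<omega>). \<xi> s \<omega>)"
      using l1 by (simp add: f_def[abs_def] case_prod_unfold)
  qed (use simple_ito_square_integrable(1)[OF simp i] supp in simp_all)
  moreover have "l2_tendsto M S X" using l2 unfolding S_def[abs_def] .
  ultimately show ?thesis using simp unfolding ito_rel_def case_prod_unfold by blast
qed

end


subsection \<open>Approximation by step functions\<close>

text \<open>Near-minimizers of the error at each \<open>N\<close> turn an approximation up to \<open>e\<close> for all large \<open>N\<close> into
  a single approximating sequence.\<close>

lemma vanishing_choice:
  fixes err :: "nat \<Rightarrow> 'c \<Rightarrow> real"
  assumes nn: "\<And>N c. 0 \<le> err N c"
    and small: "\<And>e. 0 < e \<Longrightarrow> \<exists>N0. \<forall>N\<ge>N0. \<exists>c. err N c < e"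
  shows "\<exists>c. (\<lambda>N. err N (c N)) \<longlonglongrightarrow> 0"
proof -
  have "\<exists>c. \<forall>c'. err N c \<le> err N c' + 1 / real (Suc N)" for N
  proof -
    have "bdd_below (range (err N))" by (rule bdd_belowI[of _ 0]) (use nn in auto)
    moreover have "Inf (range (err N)) < Inf (range (err N)) + 1 / real (Suc N)" by simp
    ultimately obtain c where c: "err N c < Inf (range (err N)) + 1 / real (Suc N)"
      using cInf_lessD[of "range (err N)" "Inf (range (err N)) + 1 / real (Suc N)"] by auto
    have "err N c \<le> err N c' + 1 / real (Suc N)" for c'
    proof -
      have "Inf (range (err N)) \<le> err N c'"
        using \<open>bdd_below (range (err N))\<close> by (intro cInf_lower) auto
      then show ?thesis using c by linarith
    qed
    then show ?thesis by blast
  qed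
  then have "\<exists>c. \<forall>N c'. err N (c N) \<le> err N c' + 1 / real (Suc N)" by metis
  then obtain c where c: "\<And>N c'. err N (c N) \<le> err N c' + 1 / real (Suc N)" by blast
  have "(\<lambda>N. err N (c N)) \<longlonglongrightarrow> 0"
  proof (rule LIMSEQ_I)
    fix e :: real assume e: "0 < e"
    obtain N0 where N0: "\<forall>N\<ge>N0. \<exists>c. err N c < e / 2" using small[of "e / 2"] e by auto
    obtain N1 where N1: "1 / real (Suc N1) < e / 2" using e by (meson half_gt_zero nat_approx_posE)
    show "\<exists>no. \<forall>N\<ge>no. norm (err N (c N) - 0) < e"
    proof (intro exI[of _ "max N0 N1"] allI impI)
      fix N assume N: "max N0 N1 \<le> N"
      then obtain c' where "err N c' < e / 2" using N0 by auto
      moreover have "1 / real (Suc N) \<le> 1 / real (Suc N1)" using N by (intro divide_left_mono) auto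
      ultimately have "err N (c N) < e" using c[of N c'] N1 by linarith
      then show "norm (err N (c N) - 0) < e" using nn[of N "c N"] by simp
    qed
  qed
  then show ?thesis by blast
qed

section \<open>Uniform partitions and their cells\<close>

definition uniform_partition :: "real \<Rightarrow> real \<Rightarrow> nat \<Rightarrow> nat \<Rightarrow> real" where
  "uniform_partition a b N j = a + (b - a) * real j / real N"

lemma uniform_partition_step:
  "uniform_partition a b N (Suc j) - uniform_partition a b N j = (b - a) / real N"
  by (simp add: uniform_partition_def diff_divide_distrib[symmetric] algebra_simps add_divide_distrib)

lemma interval_partition_uniform:
  assumes "a < b" "0 < N"
  shows "interval_partition a b N (uniform_partition a b N)"
proof -
  have "uniform_partition a b N j < uniform_partition a b N (Suc j)" for j
  proof -
    have "0 < (b - a) / real N" using assms by simp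
    then show ?thesis using uniform_partition_step[of a b N j] by linarith
  qed
  then show ?thesis using assms by (simp add: interval_partition_def uniform_partition_def)
qed

lemma refining_partitions_uniform:
  assumes "a < b"
  shows "refining_partitions a b (uniform_partition a b)"
proof -
  have "(\<lambda>N. MAX j\<in>{..<N}. uniform_partition a b N (Suc j) - uniform_partition a b N j) \<longlonglongrightarrow> 0"
  proof (rule Lim_transform_eventually)
    show "(\<lambda>N. (b - a) / real N) \<longlonglongrightarrow> 0" by (rule lim_const_over_n)
    show "\<forall>\<^sub>F N in sequentially. (b - a) / real N = (MAX j\<in>{..<N}. uniform_partition a b N (Suc j) - uniform_partition a b N j)"
      using eventually_gt_at_top[of 0]
    proof eventually_elim
      case (elim N)
      then have "(\<lambda>j. uniform_partition a b N (Suc j) - uniform_partition a b N j) ` {..<N} = {(b - a) / real N}"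
        by (auto simp: uniform_partition_step)
      then show ?case by simp
    qed
  qed
  then show ?thesis using interval_partition_uniform[OF assms] by (simp add: refining_partitions_def)
qed

lemma interval_partition_cell:
  assumes "interval_partition a b N \<tau>" "a \<le> r" "r < b"
  obtains j where "j < N" "\<tau> j \<le> r" "r < \<tau> (Suc j)"
proof -
  have "\<exists>j<n. \<tau> j \<le> r \<and> r < \<tau> (Suc j)" if "r < \<tau> n" "n \<le> N" for n
    using that
  proof (induction n)
    case 0
    then show ?case using assms by (simp add: interval_partition_def)
  next
    case (Suc n)
    then show ?case by (cases "r < \<tau> n") (auto intro: less_SucI)
  qed
  from this[of N] show ?thesis using assms that by (auto simp: interval_partition_def)
qed

lemma interval_partition_cell_unique:
  assumes "interval_partition a b N \<tau>" "j < N" "l < N" "r \<in> {\<tau> j..<\<tau> (Suc j)}" "r \<in> {\<tau> l..<\<tau> (Suc l)}"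
  shows "j = l"
proof (rule ccontr)
  assume "j \<noteq> l"
  then consider "Suc j \<le> l" | "Suc l \<le> j" by linarith
  then show False
    using interval_partition_mono[OF assms(1), of "Suc j" l] interval_partition_mono[OF assms(1), of "Suc l" j] assms(2-5)
    by cases auto
qed

lemma partition_sum_cell:
  fixes c :: "nat \<Rightarrow> real"
  assumes "interval_partition a b N \<tau>" "j < N" "\<tau> j \<le> r" "r < \<tau> (Suc j)"
  shows "(\<Sum>l<N. c l * indicator {\<tau> l..<\<tau> (Suc l)} r) = c j"
proof -
  have "(\<Sum>l<N. c l * indicator {\<tau> l..<\<tau> (Suc l)} r) = (\<Sum>l<N. if l = j then c j else 0)"
  proof (rule sum.cong[OF refl])
    fix l assume "l \<in> {..<N}"
    then show "c l * indicator {\<tau> l..<\<tau> (Suc l)} r = (if l = j then c j else 0)"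
      using interval_partition_cell_unique[OF assms(1) assms(2), of l r] assms by (cases "l = j") (auto simp: indicator_def)
  qed
  then show ?thesis using assms(2) by simp
qed

lemma borel_measurable_step:
  fixes \<tau> :: "nat \<Rightarrow> real" and N :: nat
  shows
  "(\<lambda>r. \<Sum>l<N. c l * indicator {\<tau> l..<\<tau> (Suc l)} r :: real) \<in> borel_measurable (lebesgue_on S)"
proof -
  have "(\<lambda>r. \<Sum>l<N. c l * indicator {\<tau> l..<\<tau> (Suc l)} r :: real) \<in> borel_measurable lborel"
    by measurable
  then have "(\<lambda>r. \<Sum>l<N. c l * indicator {\<tau> l..<\<tau> (Suc l)} r :: real) \<in> borel_measurable lebesgue"
    by (rule measurable_completion)
  then show ?thesis by (rule measurable_restrict_space1)
qed

lemma step_bounded: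
  fixes N :: nat and c :: "nat \<Rightarrow> real"
  shows "\<bar>\<Sum>l<N. c l * indicator {\<tau> l..<\<tau> (Suc l)} r\<bar> \<le> (\<Sum>l<N. \<bar>c l\<bar>)"
  by (rule order_trans[OF sum_abs]) (auto intro!: sum_mono split: split_indicator)

lemma square_integrable_bounded:
  assumes "finite_measure \<mu>" "f \<in> borel_measurable \<mu>" "\<And>x. \<bar>f x\<bar> \<le> B"
  shows "square_integrable \<mu> f"
proof -
  interpret finite_measure \<mu> by fact
  have "square_integrable \<mu> (\<lambda>_. B)" by (simp add: square_integrable_def)
  then show ?thesis
    by (rule square_integrable_bound[OF _ assms(2)]) (rule order_trans[OF assms(3) abs_ge_self])
qed

lemma finite_measure_lebesgue_on_interval: "finite_measure (lebesgue_on {a..b::real})"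
  by (rule finite_measure_lebesgue_on) auto

lemma square_integrable_step:
  fixes \<tau> :: "nat \<Rightarrow> real" and N :: nat
  shows
  "square_integrable (lebesgue_on {a..b}) (\<lambda>r. \<Sum>l<N. c l * indicator {\<tau> l..<\<tau> (Suc l)} r :: real)"
  by (rule square_integrable_bounded[OF finite_measure_lebesgue_on_interval borel_measurable_step step_bounded])

abbreviation clamp1 :: "real \<Rightarrow> real \<Rightarrow> real" where
  "clamp1 R x \<equiv> max (- R) (min R x)"

text \<open>First truncate, then approximate the truncated function almost everywhere by continuous
  functions clamped to the same range. Both steps are dominated convergence, and
  \<open>l2_sum_bound\<close> doubles each error \<open>e / 4\<close>.\<close>

lemma l2_continuous_dense:
  fixes \<psi> :: "real \<Rightarrow> real"
  assumes \<psi>: "square_integrable (lebesgue_on {a..b}) \<psi>" and e: "0 < e"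
  obtains g where "continuous_on UNIV g" "square_integrable (lebesgue_on {a..b}) g"
    "(\<integral>x. (\<psi> x - g x)\<^sup>2 \<partial>lebesgue_on {a..b}) < e"
proof -
  let ?L = "lebesgue_on {a..b}"
  interpret finite_measure ?L by (rule finite_measure_lebesgue_on_interval)
  note m[measurable] = square_integrableD(1)[OF \<psi>]
  have "(\<lambda>n. \<integral>x. (\<psi> x - clamp1 (real n) (\<psi> x))\<^sup>2 \<partial>?L) \<longlonglongrightarrow> (\<integral>x. 0 \<partial>?L)"
  proof (rule integral_dominated_convergence[where w="\<lambda>x. (\<psi> x)\<^sup>2"])
    show "AE x in ?L. (\<lambda>n. (\<psi> x - clamp1 (real n) (\<psi> x))\<^sup>2) \<longlonglongrightarrow> 0"
    proof (rule AE_I2)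
      fix x
      obtain n0 :: nat where n0: "\<bar>\<psi> x\<bar> \<le> real n0" using real_arch_simple by blast
      have "\<forall>\<^sub>F n in sequentially. (\<psi> x - clamp1 (real n) (\<psi> x))\<^sup>2 = 0"
        using eventually_ge_at_top[of n0]
      proof eventually_elim
        case (elim n)
        then have "\<bar>\<psi> x\<bar> \<le> real n" using n0 by linarith
        then have "clamp1 (real n) (\<psi> x) = \<psi> x" by linarith
        then show ?case by simp
      qed
      then show "(\<lambda>n. (\<psi> x - clamp1 (real n) (\<psi> x))\<^sup>2) \<longlonglongrightarrow> 0" by (rule tendsto_eventually)
    qed
    show "AE x in ?L. norm ((\<psi> x - clamp1 (real n) (\<psi> x))\<^sup>2) \<le> (\<psi> x)\<^sup>2" for n
    proof (rule AE_I2)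
      fix x
      have "\<bar>\<psi> x - clamp1 (real n) (\<psi> x)\<bar> \<le> \<bar>\<psi> x\<bar>" by linarith
      then show "norm ((\<psi> x - clamp1 (real n) (\<psi> x))\<^sup>2) \<le> (\<psi> x)\<^sup>2" by (simp add: abs_le_square_iff)
    qed
    show "integrable ?L (\<lambda>x. (\<psi> x)\<^sup>2)" by (rule square_integrableD(2)[OF \<psi>])
  qed measurable
  from LIMSEQ_D[OF this, of "e / 4"] e obtain R :: nat where
    R: "(\<integral>x. (\<psi> x - clamp1 (real R) (\<psi> x))\<^sup>2 \<partial>?L) < e / 4" by auto
  have "(\<lambda>x. if x \<in> {a..b} then \<psi> x else 0) \<in> borel_measurable lebesgue"
    using borel_measurable_if_I[OF m] by simp
  \<comment> \<open>Measurability in the sense of \<open>measurable_on\<close> provides continuous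
    functions that converge off a negligible set.\<close>
  then have "(\<lambda>x. if x \<in> {a..b} then \<psi> x else 0) measurable_on UNIV"
    by (simp add: measurable_on_iff_borel_measurable)
  then obtain N g where N: "negligible N" and g: "\<And>n. continuous_on UNIV (g n)"
    and lim: "\<And>x. x \<notin> N \<Longrightarrow> (\<lambda>n. g n x) \<longlonglongrightarrow> (if x \<in> {a..b} then \<psi> x else 0)"
    unfolding measurable_on_def by auto
  define h where "h n x = clamp1 (real R) (g n x)" for n x
  have hc: "continuous_on UNIV (h n)" for n
    unfolding h_def[abs_def] by (intro continuous_intros g)
  have hm[measurable]: "h n \<in> borel_measurable ?L" for n
    using borel_measurable_continuous_onI[OF hc] by (intro measurable_restrict_space1 measurable_completion) simp
  have hb: "\<bar>h n x\<bar> \<le> real R" for n x unfolding h_def by linarith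
  have "(\<lambda>n. \<integral>x. (clamp1 (real R) (\<psi> x) - h n x)\<^sup>2 \<partial>?L) \<longlonglongrightarrow> (\<integral>x. 0 \<partial>?L)"
  proof (rule integral_dominated_convergence[where w="\<lambda>x. (2 * real R)\<^sup>2"])
    have "N \<in> null_sets lebesgue" using N by (simp add: negligible_iff_null_sets)
    then have "AE x in lebesgue. x \<notin> N" by (rule AE_not_in)
    then have "AE x in ?L. x \<notin> N" by (subst AE_restrict_space_iff) (auto elim: eventually_mono)
    then show "AE x in ?L. (\<lambda>n. (clamp1 (real R) (\<psi> x) - h n x)\<^sup>2) \<longlonglongrightarrow> 0"
    proof (rule AE_mp, intro AE_I2 impI)
      fix x assume x: "x \<in> space ?L" "x \<notin> N"
      then have "(\<lambda>n. g n x) \<longlonglongrightarrow> \<psi> x" using lim[of x] by simp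
      then have "(\<lambda>n. (clamp1 (real R) (\<psi> x) - h n x)\<^sup>2) \<longlonglongrightarrow> (clamp1 (real R) (\<psi> x) - clamp1 (real R) (\<psi> x))\<^sup>2"
        unfolding h_def by (intro tendsto_intros)
      then show "(\<lambda>n. (clamp1 (real R) (\<psi> x) - h n x)\<^sup>2) \<longlonglongrightarrow> 0" by simp
    qed
    show "AE x in ?L. norm ((clamp1 (real R) (\<psi> x) - h n x)\<^sup>2) \<le> (2 * real R)\<^sup>2" for n
    proof (rule AE_I2)
      fix x
      have "\<bar>clamp1 (real R) (\<psi> x) - h n x\<bar> \<le> \<bar>2 * real R\<bar>" using hb[of n x] by linarith
      from abs_le_square_iff[THEN iffD1, OF this]
      show "norm ((clamp1 (real R) (\<psi> x) - h n x)\<^sup>2) \<le> (2 * real R)\<^sup>2" by simp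
    qed
    show "integrable ?L (\<lambda>x. (2 * real R)\<^sup>2)" by simp
  qed measurable
  from LIMSEQ_D[OF this, of "e / 4"] e obtain n :: nat where
    n: "(\<integral>x. (clamp1 (real R) (\<psi> x) - h n x)\<^sup>2 \<partial>?L) < e / 4" by auto
  have sh: "square_integrable ?L (h n)"
    by (rule square_integrable_bounded[OF finite_measure_axioms hm hb])
  have sc: "square_integrable ?L (\<lambda>x. clamp1 (real R) (\<psi> x))"
  proof (rule square_integrable_bounded[OF finite_measure_axioms])
    show "\<bar>clamp1 (real R) (\<psi> x)\<bar> \<le> real R" for x by linarith
  qed measurable
  have "(\<integral>x. ((\<psi> x - clamp1 (real R) (\<psi> x)) + (clamp1 (real R) (\<psi> x) - h n x))\<^sup>2 \<partial>?L) \<le>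
     2 * (\<integral>x. (\<psi> x - clamp1 (real R) (\<psi> x))\<^sup>2 \<partial>?L) + 2 * (\<integral>x. (clamp1 (real R) (\<psi> x) - h n x)\<^sup>2 \<partial>?L)"
    by (intro l2_sum_bound square_integrable_diff \<psi> sc sh)
  then have "(\<integral>x. (\<psi> x - h n x)\<^sup>2 \<partial>?L) < e" using R n by simp
  then show ?thesis using that hc sh by blast
qed

text \<open>The coefficients sample a continuous approximant at left end points; samples of the
  square integrable function itself would depend on its version.\<close>

lemma l2_step_approx:
  assumes ab: "a < b" and \<psi>: "square_integrable (lebesgue_on {a..b}) \<psi>"
  shows "\<exists>c. (\<lambda>N. \<integral>r. (\<psi> r - (\<Sum>j<N. c N j * indicator {uniform_partition a b N j..<uniform_partition a b N (Suc j)} r))\<^sup>2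
     \<partial>lebesgue_on {a..b}) \<longlonglongrightarrow> 0"
proof (rule vanishing_choice)
  let ?L = "lebesgue_on {a..b}"
  interpret finite_measure ?L by (rule finite_measure_lebesgue_on_interval)
  let ?\<sigma> = "\<lambda>N c r. \<Sum>j<N. c j * indicator {uniform_partition a b N j..<uniform_partition a b N (Suc j)} r :: real"
  fix e :: real assume e: "0 < e"
  obtain g where g: "continuous_on UNIV g" "square_integrable ?L g" "(\<integral>x. (\<psi> x - g x)\<^sup>2 \<partial>?L) < e / 4"
    using l2_continuous_dense[OF \<psi>, of "e / 4"] e by auto
  have "uniformly_continuous_on {a..b} g"
    by (rule compact_uniformly_continuous[OF continuous_on_subset[OF g(1)]]) auto
  \<comment> \<open>Chosen so that \<open>\<kappa>\<^sup>2 (b - a) = e / 8\<close>, which together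
    with \<open>e / 4\<close> for \<open>g\<close> stays below \<open>e\<close> after
    doubling.\<close>
  define \<kappa> where "\<kappa> = sqrt (e / 8 / (b - a))"
  have \<kappa>: "0 < \<kappa>" "\<kappa>\<^sup>2 = e / 8 / (b - a)" using e ab by (simp_all add: \<kappa>_def)
  obtain d where d: "0 < d" "\<And>x y. x \<in> {a..b} \<Longrightarrow> y \<in> {a..b} \<Longrightarrow> \<bar>x - y\<bar> < d \<Longrightarrow> \<bar>g x - g y\<bar> < \<kappa>"
    using \<open>uniformly_continuous_on {a..b} g\<close> \<kappa>(1) unfolding uniformly_continuous_on_def dist_real_def by meson
  obtain N0 :: nat where N0: "(b - a) / d < real N0" using reals_Archimedean2 by blast
  show "\<exists>N0. \<forall>N\<ge>N0. \<exists>c. (\<integral>r. (\<psi> r - ?\<sigma> N c r)\<^sup>2 \<partial>?L) < e"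
  proof (intro exI[of _ "max 1 N0"] allI impI)
    fix N :: nat assume N: "max 1 N0 \<le> N"
    let ?\<tau> = "uniform_partition a b N"
    have ip: "interval_partition a b N ?\<tau>" using N ab by (intro interval_partition_uniform) auto
    have "(b - a) / d < real N" using N0 N by simp
    then have mesh: "(b - a) / real N < d" using d(1) N by (simp add: field_simps)
    define c where "c j = g (?\<tau> j)" for j
    have close: "\<bar>g r - ?\<sigma> N c r\<bar> \<le> \<kappa>" if r: "r \<in> {a..<b}" for r
    proof -
      obtain j where j: "j < N" "?\<tau> j \<le> r" "r < ?\<tau> (Suc j)" using interval_partition_cell[OF ip, of r] r by auto
      have "\<bar>r - ?\<tau> j\<bar> < d" using j uniform_partition_step[of a b N j] mesh by linarith
      then have "\<bar>g r - g (?\<tau> j)\<bar> < \<kappa>" using r interval_partition_bounds[OF ip j(1)] by (intro d(2)) auto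
      then show ?thesis using partition_sum_cell[OF ip j, of c] by (simp add: c_def)
    qed
    have sqs: "square_integrable ?L (?\<sigma> N c)" by (rule square_integrable_step)
    have "(\<integral>r. (g r - ?\<sigma> N c r)\<^sup>2 \<partial>?L) \<le> (\<integral>r. \<kappa>\<^sup>2 \<partial>?L)"
    proof (rule integral_mono_AE)
      \<comment> \<open>All cells are half open, so the step function vanishes at \<open>b\<close>
        and the estimate may fail there.\<close>
      have "AE r in lebesgue. r \<notin> {b}" by (rule AE_not_in) (simp add: negligible_iff_null_sets[symmetric])
      then have "AE r in ?L. r \<noteq> b" by (subst AE_restrict_space_iff) (auto elim: eventually_mono)
      then show "AE r in ?L. (g r - ?\<sigma> N c r)\<^sup>2 \<le> \<kappa>\<^sup>2"
      proof (rule AE_mp, intro AE_I2 impI)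
        fix r assume "r \<in> space ?L" "r \<noteq> b"
        then have "\<bar>g r - ?\<sigma> N c r\<bar> \<le> \<bar>\<kappa>\<bar>" using close[of r] by simp
        then show "(g r - ?\<sigma> N c r)\<^sup>2 \<le> \<kappa>\<^sup>2" by (simp add: abs_le_square_iff)
      qed
    qed (use square_integrableD(2)[OF square_integrable_diff[OF g(2) sqs]] in auto)
    also have "\<dots> = \<kappa>\<^sup>2 * (b - a)" using ab by (simp add: measure_restrict_space)
    also have "\<dots> = e / 8"
    proof -
      have ne: "b - a \<noteq> 0" using ab by simp
      show ?thesis using nonzero_eq_divide_eq[OF ne] \<kappa>(2) by blast
    qed
    finally have 2: "(\<integral>r. (g r - ?\<sigma> N c r)\<^sup>2 \<partial>?L) \<le> e / 8" .
    have "(\<integral>r. ((\<psi> r - g r) + (g r - ?\<sigma> N c r))\<^sup>2 \<partial>?L) \<le>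
      2 * (\<integral>r. (\<psi> r - g r)\<^sup>2 \<partial>?L) + 2 * (\<integral>r. (g r - ?\<sigma> N c r)\<^sup>2 \<partial>?L)"
      by (intro l2_sum_bound square_integrable_diff \<psi> g(2) sqs)
    then have "(\<integral>r. (\<psi> r - ?\<sigma> N c r)\<^sup>2 \<partial>?L) < e" using g(3) 2 e by simp
    then show "\<exists>c. (\<integral>r. (\<psi> r - ?\<sigma> N c r)\<^sup>2 \<partial>?L) < e" by blast
  qed
qed simp

text \<open>The indefinite integral of the square is continuous on a compact interval, hence
  uniformly continuous. Through the isometry this becomes continuity in the mean of Ito
  integrals.\<close>

lemma l2_modulus:
  fixes \<psi> :: "real \<Rightarrow> real"
  assumes \<psi>: "square_integrable (lebesgue_on {a..b}) \<psi>" and e: "0 < e"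
  shows "\<exists>d>0. \<forall>u\<in>{a..b}. \<forall>s\<in>{a..b}. u \<le> s \<longrightarrow> s - u < d \<longrightarrow>
     (\<integral>r. indicator {u..<s} r * (\<psi> r)\<^sup>2 \<partial>lebesgue_on {a..b}) < e"
proof -
  let ?L = "lebesgue_on {a..b}"
  have int: "integrable ?L (\<lambda>r. (\<psi> r)\<^sup>2)" by (rule square_integrableD(2)[OF \<psi>])
  then have io: "(\<lambda>r. (\<psi> r)\<^sup>2) integrable_on {a..b}" by (intro integrable_on_lebesgue_on) auto
  define H where "H x = integral {a..x} (\<lambda>r. (\<psi> r)\<^sup>2)" for x
  have "continuous_on {a..b} H" unfolding H_def[abs_def] by (rule indefinite_integral_continuous_1[OF io])
  then have "uniformly_continuous_on {a..b} H" by (rule compact_uniformly_continuous) auto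
  then obtain d where d: "0 < d" "\<And>x y. x \<in> {a..b} \<Longrightarrow> y \<in> {a..b} \<Longrightarrow> \<bar>x - y\<bar> < d \<Longrightarrow> \<bar>H x - H y\<bar> < e"
    using e unfolding uniformly_continuous_on_def dist_real_def by meson
  show ?thesis
  proof (intro exI[of _ d] conjI ballI impI)
    fix u s assume us: "u \<in> {a..b}" "s \<in> {a..b}" "u \<le> s" "s - u < d"
    have rs: "lebesgue_on {u..s} = restrict_space ?L {u..s}"
      using us by (subst restrict_restrict_space) (auto simp: Int_absorb1)
    have us': "{u..s} \<inter> space ?L \<in> sets ?L" using us by (auto simp: sets_restrict_space_iff)
    have i2: "integrable ?L (\<lambda>r. indicator {u..s} r * (\<psi> r)\<^sup>2)"
    proof -
      have "{u..s} \<in> sets ?L" using us by (auto simp: sets_restrict_space_iff)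
      from integrable_mult_indicator[OF this int] show ?thesis by simp
    qed
    have i1: "integrable ?L (\<lambda>r. indicator {u..<s} r * (\<psi> r)\<^sup>2)"
    proof -
      have "{u..<s} \<in> sets ?L" using us by (auto simp: sets_restrict_space_iff)
      from integrable_mult_indicator[OF this int] show ?thesis by simp
    qed
    have i3: "integrable (lebesgue_on {u..s}) (\<lambda>r. (\<psi> r)\<^sup>2)"
      unfolding rs using integrable_restrict_space[OF us', of "\<lambda>r. (\<psi> r)\<^sup>2"] i2 by simp
    have "(\<integral>r. indicator {u..<s} r * (\<psi> r)\<^sup>2 \<partial>?L) \<le> (\<integral>r. indicator {u..s} r * (\<psi> r)\<^sup>2 \<partial>?L)"
      by (rule integral_mono[OF i1 i2]) (auto split: split_indicator)
    also have "\<dots> = (\<integral>r. (\<psi> r)\<^sup>2 \<partial>lebesgue_on {u..s})"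
      unfolding rs using integral_restrict_space[OF us', of "\<lambda>r. (\<psi> r)\<^sup>2"] by simp
    also have "\<dots> = integral {u..s} (\<lambda>r. (\<psi> r)\<^sup>2)"
      by (rule lebesgue_integral_eq_integral[OF i3]) auto
    also have "\<dots> = H s - H u"
    proof -
      have "(\<lambda>r. (\<psi> r)\<^sup>2) integrable_on {a..s}" by (rule integrable_on_subinterval[OF io]) (use us in auto)
      then have "H u + integral {u..s} (\<lambda>r. (\<psi> r)\<^sup>2) = H s"
        unfolding H_def using us by (intro Henstock_Kurzweil_Integration.integral_combine) auto
      then show ?thesis by simp
    qed
    also have "\<dots> < e" using d(2)[OF us(2,1)] us by auto
    finally show "(\<integral>r. indicator {u..<s} r * (\<psi> r)\<^sup>2 \<partial>?L) < e" .
  qed (rule d(1))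
qed


subsection \<open>Existence of Ito integrals\<close>

text \<open>By Tonelli's theorem norms of processes can be bounded one time at a time; square
  integrability on the product comes out together with the bound.\<close>

lemma (in pair_sigma_finite) square_integrable_fiber_bound:
  fixes f :: "'a \<times> 'b \<Rightarrow> real"
  assumes f: "f \<in> borel_measurable (M1 \<Otimes>\<^sub>M M2)" and g: "integrable M1 g"
    and fib: "\<And>r. r \<in> space M1 \<Longrightarrow> square_integrable M2 (\<lambda>y. f (r, y))"
    and le: "\<And>r. r \<in> space M1 \<Longrightarrow> (\<integral>y. (f (r, y))\<^sup>2 \<partial>M2) \<le> g r"
  shows "square_integrable (M1 \<Otimes>\<^sub>M M2) f" "(\<integral>z. (f z)\<^sup>2 \<partial>(M1 \<Otimes>\<^sub>M M2)) \<le> (\<integral>r. g r \<partial>M1)"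
proof -
  have g0: "0 \<le> g r" if "r \<in> space M1" for r
    using order_trans[OF integral_nonneg_AE le[OF that]] by simp
  have fm: "(\<lambda>z. ennreal ((f z)\<^sup>2)) \<in> borel_measurable (M1 \<Otimes>\<^sub>M M2)" using f by measurable
  have "(\<integral>\<^sup>+z. ennreal ((f z)\<^sup>2) \<partial>(M1 \<Otimes>\<^sub>M M2)) = (\<integral>\<^sup>+r. \<integral>\<^sup>+y. ennreal ((f (r, y))\<^sup>2) \<partial>M2 \<partial>M1)"
    by (rule M2.nn_integral_fst[OF fm, symmetric])
  also have "\<dots> \<le> (\<integral>\<^sup>+r. ennreal (g r) \<partial>M1)"
  proof (rule nn_integral_mono)
    fix r assume r: "r \<in> space M1"
    have "(\<integral>\<^sup>+y. ennreal ((f (r, y))\<^sup>2) \<partial>M2) = ennreal (\<integral>y. (f (r, y))\<^sup>2 \<partial>M2)"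
      using square_integrableD(2)[OF fib[OF r]] by (intro nn_integral_eq_integral) auto
    also have "\<dots> \<le> ennreal (g r)" by (rule ennreal_leI[OF le[OF r]])
    finally show "(\<integral>\<^sup>+y. ennreal ((f (r, y))\<^sup>2) \<partial>M2) \<le> ennreal (g r)" .
  qed
  also have "\<dots> = ennreal (\<integral>r. g r \<partial>M1)" using g g0 by (intro nn_integral_eq_integral) auto
  finally have *: "(\<integral>\<^sup>+z. ennreal ((f z)\<^sup>2) \<partial>(M1 \<Otimes>\<^sub>M M2)) \<le> ennreal (\<integral>r. g r \<partial>M1)" .
  have int: "integrable (M1 \<Otimes>\<^sub>M M2) (\<lambda>z. (f z)\<^sup>2)"
  proof (rule integrableI_bounded)
    show "(\<lambda>z. (f z)\<^sup>2) \<in> borel_measurable (M1 \<Otimes>\<^sub>M M2)" using f by measurable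
    show "(\<integral>\<^sup>+z. ennreal (norm ((f z)\<^sup>2)) \<partial>(M1 \<Otimes>\<^sub>M M2)) < \<infinity>"
      using le_less_trans[OF * ennreal_less_top] by simp
  qed
  then show "square_integrable (M1 \<Otimes>\<^sub>M M2) f" using f by (simp add: square_integrable_def)
  have "ennreal (\<integral>z. (f z)\<^sup>2 \<partial>(M1 \<Otimes>\<^sub>M M2)) \<le> ennreal (\<integral>r. g r \<partial>M1)"
    using * nn_integral_eq_integral[OF int] by simp
  moreover have "0 \<le> (\<integral>r. g r \<partial>M1)" using g0 by (intro integral_nonneg_AE AE_I2)
  ultimately show "(\<integral>z. (f z)\<^sup>2 \<partial>(M1 \<Otimes>\<^sub>M M2)) \<le> (\<integral>r. g r \<partial>M1)" by (simp add: ennreal_le_iff)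
qed

lemma l2_tendsto_Cauchy:
  assumes l: "l2_tendsto \<mu> f g" and e: "0 < e"
  shows "\<exists>N0. \<forall>m\<ge>N0. \<forall>n\<ge>N0. (\<integral>x. (f m x - f n x)\<^sup>2 \<partial>\<mu>) < e"
proof -
  obtain N0 where N0: "\<And>n. n \<ge> N0 \<Longrightarrow> (\<integral>x. (f n x - g x)\<^sup>2 \<partial>\<mu>) < e / 4"
    using LIMSEQ_D[OF l2_tendstoD(3)[OF l], of "e / 4"] e by auto
  show ?thesis
  proof (intro exI[of _ N0] allI impI)
    fix k n assume k: "N0 \<le> k" "N0 \<le> n"
    have "(\<integral>x. ((f k x - g x) - (f n x - g x))\<^sup>2 \<partial>\<mu>) \<le> 2 * (\<integral>x. (f k x - g x)\<^sup>2 \<partial>\<mu>) + 2 * (\<integral>x. (f n x - g x)\<^sup>2 \<partial>\<mu>)"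
      by (intro l2_diff_bound square_integrable_diff l2_tendstoD[OF l])
    then show "(\<integral>x. (f k x - f n x)\<^sup>2 \<partial>\<mu>) < e" using N0[OF k(1)] N0[OF k(2)] by simp
  qed
qed

text \<open>Lets a measurable version of a family of integrals inherit the property from integrals
  that were chosen separately for each time.\<close>

lemma has_ito_integral_cong_AE:
  assumes "has_ito_integral M F B a b \<xi> X" "Y \<in> borel_measurable M" "AE \<omega> in M. X \<omega> = Y \<omega>"
  shows "has_ito_integral M F B a b \<xi> Y"
proof -
  obtain \<tau> \<eta> where *: "refining_partitions a b \<tau>"
    "\<forall>N. \<forall>j<N. \<eta> N j \<in> borel_measurable (F (\<tau> N j)) \<and> square_integrable M (\<eta> N j)"
    "l2_tendsto (lebesgue_on {a..b} \<Otimes>\<^sub>M M)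
          (\<lambda>N (s, \<omega>). \<Sum>j<N. \<eta> N j \<omega> * indicator {\<tau> N j..<\<tau> N (Suc j)} s) (\<lambda>(s, \<omega>). \<xi> s \<omega>)"
    "l2_tendsto M (\<lambda>N \<omega>. \<Sum>j<N. \<eta> N j \<omega> * (B (\<tau> N (Suc j)) \<omega> - B (\<tau> N j) \<omega>)) X"
    using assms(1) unfolding has_ito_integral_def by (elim exE conjE)
  from l2_tendsto_cong_AE[OF *(4) assms(2,3)] *(1-3) show ?thesis
    unfolding has_ito_integral_def by blast
qed

context ito
begin

text \<open>The invariant that is preserved by indefinite integration against a function in \<open>L\<^sub>2\<close>.\<close>

definition regular_process :: "(real \<Rightarrow> 'a \<Rightarrow> real) \<Rightarrow> bool" where
  "regular_process Y \<longleftrightarrow> (\<lambda>(s, \<omega>). Y s \<omega>) \<in> borel_measurable P \<and>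
     (\<forall>s\<in>{t..T}. Y s \<in> borel_measurable (F s) \<and> square_integrable M (Y s)) \<and>
     (\<exists>C. \<forall>s\<in>{t..T}. (\<integral>\<omega>. (Y s \<omega>)\<^sup>2 \<partial>M) \<le> C) \<and>
     (\<forall>e>0. \<exists>d>0. \<forall>u\<in>{t..T}. \<forall>s\<in>{t..T}. \<bar>s - u\<bar> < d \<longrightarrow> (\<integral>\<omega>. (Y u \<omega> - Y s \<omega>)\<^sup>2 \<partial>M) < e)"

lemma regular_processD:
  assumes "regular_process Y"
  shows "(\<lambda>(s, \<omega>). Y s \<omega>) \<in> borel_measurable P"
    "\<And>s. s \<in> {t..T} \<Longrightarrow> Y s \<in> borel_measurable (F s)" "\<And>s. s \<in> {t..T} \<Longrightarrow> square_integrable M (Y s)"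
    "\<exists>C\<ge>0. \<forall>s\<in>{t..T}. (\<integral>\<omega>. (Y s \<omega>)\<^sup>2 \<partial>M) \<le> C"
    "\<And>e. 0 < e \<Longrightarrow> \<exists>d>0. \<forall>u\<in>{t..T}. \<forall>s\<in>{t..T}. \<bar>s - u\<bar> < d \<longrightarrow> (\<integral>\<omega>. (Y u \<omega> - Y s \<omega>)\<^sup>2 \<partial>M) < e"
proof -
  obtain C where C: "\<forall>s\<in>{t..T}. (\<integral>\<omega>. (Y s \<omega>)\<^sup>2 \<partial>M) \<le> C" using assms by (auto simp: regular_process_def)
  have "0 \<le> (\<integral>\<omega>. (Y t \<omega>)\<^sup>2 \<partial>M)" by simp
  also have "\<dots> \<le> C" using C t by auto
  finally show "\<exists>C\<ge>0. \<forall>s\<in>{t..T}. (\<integral>\<omega>. (Y s \<omega>)\<^sup>2 \<partial>M) \<le> C" using C by blast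
qed (use assms in \<open>simp_all add: regular_process_def\<close>)

section \<open>Approximating a function times a regular process\<close>

lemma product_process_measurable:
  fixes Y :: "real \<Rightarrow> 'a \<Rightarrow> real" and \<psi> :: "real \<Rightarrow> real"
  assumes Y: "(\<lambda>(s, \<omega>). Y s \<omega>) \<in> borel_measurable P" and \<psi>: "\<psi> \<in> borel_measurable L"
  shows "(\<lambda>z. \<psi> (fst z) * Y (fst z) (snd z)) \<in> borel_measurable P"
proof -
  have 1: "(\<lambda>z. \<psi> (fst z)) \<in> borel_measurable P" by (rule measurable_compose[OF measurable_fst \<psi>])
  have 2: "(\<lambda>z. Y (fst z) (snd z)) \<in> borel_measurable P" using Y by (simp add: case_prod_unfold)
  show ?thesis by (rule borel_measurable_times[OF 1 2])
qed

lemma lebesgue_on_subinterval: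
  assumes "s \<le> T"
  shows "f \<in> borel_measurable L \<Longrightarrow> f \<in> borel_measurable (lebesgue_on {t..s})"
    "square_integrable L f \<Longrightarrow> square_integrable (lebesgue_on {t..s}) f"
proof -
  have rs: "lebesgue_on {t..s} = restrict_space L {t..s}"
    using assms by (subst restrict_restrict_space) (auto simp: Int_absorb1)
  have S: "{t..s} \<in> sets L" using assms by (auto simp: sets_restrict_space_iff)
  then have S': "{t..s} \<inter> space L \<in> sets L" by (rule sets.Int[OF _ sets.top])
  show m: "f \<in> borel_measurable (lebesgue_on {t..s})" if "f \<in> borel_measurable L" for f :: "real \<Rightarrow> real"
    unfolding rs by (rule measurable_restrict_space1[OF that])
  show "square_integrable (lebesgue_on {t..s}) f" if "square_integrable L f"
  proof -
    have "integrable (restrict_space L {t..s}) (\<lambda>x. (f x)\<^sup>2)"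
      using integrable_restrict_space[OF S', of "\<lambda>x. (f x)\<^sup>2"] integrable_mult_indicator[OF S square_integrableD(2)[OF that]] by simp
    then show ?thesis using m[OF square_integrableD(1)[OF that]] by (simp add: square_integrable_def rs)
  qed
qed

lemma square_integrable_strip:
  assumes s: "s \<le> T" and f: "square_integrable P f"
  shows "square_integrable (lebesgue_on {t..s} \<Otimes>\<^sub>M M) f"
proof -
  note S = sets_P_strip(1)[OF s]
  have S': "({t..s} \<times> space M) \<inter> space P \<in> sets P" by (rule sets.Int[OF S sets.top])
  have "integrable (restrict_space P ({t..s} \<times> space M)) (\<lambda>z. (f z)\<^sup>2)"
    using integrable_restrict_space[OF S', of "\<lambda>z. (f z)\<^sup>2"] integrable_mult_indicator[OF S square_integrableD(2)[OF f]] by simp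
  moreover have "f \<in> borel_measurable (restrict_space P ({t..s} \<times> space M))"
    by (rule measurable_restrict_space1[OF square_integrableD(1)[OF f]])
  ultimately show ?thesis unfolding lebesgue_on_pair_restrict[OF s] by (simp add: square_integrable_def)
qed

lemma product_process_strip:
  assumes s: "s \<le> T" and Y: "regular_process Y" and \<psi>: "square_integrable L \<psi>"
  shows "square_integrable (lebesgue_on {t..s} \<Otimes>\<^sub>M M) (\<lambda>z. \<psi> (fst z) * Y (fst z) (snd z))"
proof -
  interpret Ls: finite_measure "lebesgue_on {t..s}" by (rule finite_measure_lebesgue_on_interval)
  interpret Q: pair_sigma_finite "lebesgue_on {t..s}" M ..
  obtain C where C: "C \<ge> 0" "\<forall>s\<in>{t..T}. (\<integral>\<omega>. (Y s \<omega>)\<^sup>2 \<partial>M) \<le> C" using regular_processD(4)[OF Y] by blast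
  have \<psi>s: "square_integrable (lebesgue_on {t..s}) \<psi>" by (rule lebesgue_on_subinterval(2)[OF s \<psi>])
  show ?thesis
  proof (rule Q.square_integrable_fiber_bound(1))
    show "(\<lambda>z. \<psi> (fst z) * Y (fst z) (snd z)) \<in> borel_measurable (lebesgue_on {t..s} \<Otimes>\<^sub>M M)"
      unfolding lebesgue_on_pair_restrict[OF s]
      by (rule measurable_restrict_space1[OF product_process_measurable[OF regular_processD(1)[OF Y] square_integrableD(1)[OF \<psi>]]])
    show "integrable (lebesgue_on {t..s}) (\<lambda>r. (\<psi> r)\<^sup>2 * C)"
      using square_integrableD(2)[OF \<psi>s] by simp
    fix r assume "r \<in> space (lebesgue_on {t..s})"
    then have r: "r \<in> {t..T}" using s by simp
    show "square_integrable M (\<lambda>y. \<psi> (fst (r, y)) * Y (fst (r, y)) (snd (r, y)))"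
      using square_integrable_cmult[OF regular_processD(3)[OF Y r]] by simp
    show "(\<integral>y. (\<psi> (fst (r, y)) * Y (fst (r, y)) (snd (r, y)))\<^sup>2 \<partial>M) \<le> (\<psi> r)\<^sup>2 * C"
      using C(2) r by (auto simp: power_mult_distrib intro!: mult_left_mono)
  qed
qed

text \<open>The function is replaced by step functions and the process by its values at left end
  points, which keeps the approximants nonanticipating. On a cell starting at \<open>u\<close> the
  error is \<open>(\<sigma> - \<psi>) Y u + \<psi> (Y u - Y r)\<close>: the first part is small
  because second moments are bounded, the second by continuity in the mean.\<close>

lemma product_process_approx:
  assumes s: "t < s" "s \<le> T" and Y: "regular_process Y" and \<psi>: "square_integrable L \<psi>"
  shows "\<exists>c. l2_tendsto (lebesgue_on {t..s} \<Otimes>\<^sub>M M)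
    (\<lambda>N z. \<Sum>j<N. (c N j * Y (uniform_partition t s N j) (snd z)) *
        indicator {uniform_partition t s N j..<uniform_partition t s N (Suc j)} (fst z))
    (\<lambda>z. \<psi> (fst z) * Y (fst z) (snd z))"
proof -
  let ?Ls = "lebesgue_on {t..s}" and ?\<tau> = "uniform_partition t s"
  let ?Q = "?Ls \<Otimes>\<^sub>M M"
  interpret Ls: finite_measure ?Ls by (rule finite_measure_lebesgue_on_interval)
  interpret Q: pair_sigma_finite ?Ls M ..
  obtain C where C: "C \<ge> 0" "\<forall>s\<in>{t..T}. (\<integral>\<omega>. (Y s \<omega>)\<^sup>2 \<partial>M) \<le> C" using regular_processD(4)[OF Y] by blast
  have \<psi>s: "square_integrable ?Ls \<psi>" by (rule lebesgue_on_subinterval(2)[OF s(2) \<psi>])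
  define A where "A = (\<integral>r. (\<psi> r)\<^sup>2 \<partial>?Ls)"
  have A0: "0 \<le> A" by (simp add: A_def)
  obtain c where c: "(\<lambda>N. \<integral>r. (\<psi> r - (\<Sum>j<N. c N j * indicator {?\<tau> N j..<?\<tau> N (Suc j)} r))\<^sup>2 \<partial>?Ls) \<longlonglongrightarrow> 0"
    using l2_step_approx[OF s(1) \<psi>s] by blast
  define \<sigma> where "\<sigma> N r = (\<Sum>j<N. c N j * indicator {?\<tau> N j..<?\<tau> N (Suc j)} r)" for N r
  define f where "f N z = (\<Sum>j<N. (c N j * Y (?\<tau> N j) (snd z)) * indicator {?\<tau> N j..<?\<tau> N (Suc j)} (fst z))" for N z
  define g where "g z = \<psi> (fst z) * Y (fst z) (snd z)" for z :: "real \<times> 'a"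
  have err: "(\<lambda>N. \<integral>r. (\<psi> r - \<sigma> N r)\<^sup>2 \<partial>?Ls) \<longlonglongrightarrow> 0" using c by (simp add: \<sigma>_def)
  have ip: "interval_partition t s N (?\<tau> N)" if "0 < N" for N by (rule interval_partition_uniform[OF s(1) that])
  have inT: "?\<tau> N j \<in> {t..T}" if "j < N" for N j
    using interval_partition_bounds[OF ip, of N j] that s by auto
  have sq\<sigma>: "square_integrable ?Ls (\<sigma> N)" for N unfolding \<sigma>_def[abs_def] by (rule square_integrable_step)
  have sqg: "square_integrable ?Q g" unfolding g_def[abs_def] by (rule product_process_strip[OF s(2) Y \<psi>])
  have sqf: "square_integrable ?Q (f N)" for N
    unfolding f_def[abs_def]
  proof (rule square_integrable_sum)
    fix j assume "j \<in> {..<N}"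
    then have j: "j < N" by simp
    have N: "0 < N" using j by simp
    have sqY: "square_integrable M (\<lambda>\<omega>. c N j * Y (?\<tau> N j) \<omega>)"
      by (rule square_integrable_cmult[OF regular_processD(3)[OF Y inT[OF j]]])
    have "square_integrable P (\<lambda>z. (c N j * Y (?\<tau> N j) (snd z)) * indicator {?\<tau> N j..<?\<tau> N (Suc j)} (fst z))"
      using interval_partition_bounds[OF ip[OF N] j] s by (intro elementary_square_integrable sqY) auto
    then show "square_integrable ?Q (\<lambda>z. (c N j * Y (?\<tau> N j) (snd z)) * indicator {?\<tau> N j..<?\<tau> N (Suc j)} (fst z))"
      by (rule square_integrable_strip[OF s(2)])
  qed
  have bound: "(\<integral>z. (f N z - g z)\<^sup>2 \<partial>?Q) \<le> 2 * C * (\<integral>r. (\<psi> r - \<sigma> N r)\<^sup>2 \<partial>?Ls) + 2 * e * A"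
    if N: "0 < N" and e: "0 \<le> e" and d: "(s - t) / real N < d"
      and mod: "\<And>u v. u \<in> {t..T} \<Longrightarrow> v \<in> {t..T} \<Longrightarrow> \<bar>v - u\<bar> < d \<Longrightarrow> (\<integral>\<omega>. (Y u \<omega> - Y v \<omega>)\<^sup>2 \<partial>M) \<le> e" for N e d
  proof -
    have int1: "integrable ?Ls (\<lambda>r. (\<psi> r - \<sigma> N r)\<^sup>2)"
      using square_integrableD(2)[OF square_integrable_diff[OF \<psi>s sq\<sigma>]] .
    have int2: "integrable ?Ls (\<lambda>r. (\<psi> r)\<^sup>2)" using square_integrableD(2)[OF \<psi>s] .
    have "(\<integral>z. (f N z - g z)\<^sup>2 \<partial>?Q) \<le> (\<integral>r. 2 * C * (\<psi> r - \<sigma> N r)\<^sup>2 + 2 * e * (\<psi> r)\<^sup>2 \<partial>?Ls)"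
    proof (rule Q.square_integrable_fiber_bound(2))
      show "(\<lambda>z. f N z - g z) \<in> borel_measurable ?Q"
        by (rule square_integrableD(1)[OF square_integrable_diff[OF sqf sqg]])
      show "integrable ?Ls (\<lambda>r. 2 * C * (\<psi> r - \<sigma> N r)\<^sup>2 + 2 * e * (\<psi> r)\<^sup>2)"
        using int1 int2 by simp
      fix r assume "r \<in> space ?Ls"
      then have r: "r \<in> {t..s}" "r \<in> {t..T}" using s by auto
      have fr: "square_integrable M (\<lambda>y. f N (r, y))" unfolding f_def fst_conv snd_conv
      proof (rule square_integrable_sum)
        fix j assume "j \<in> {..<N}"
        then have "square_integrable M (\<lambda>x. (c N j * indicator {?\<tau> N j..<?\<tau> N (Suc j)} r) * Y (?\<tau> N j) x)"
          using inT by (intro square_integrable_cmult regular_processD(3)[OF Y]) auto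
        then show "square_integrable M (\<lambda>x. (c N j * Y (?\<tau> N j) x) * indicator {?\<tau> N j..<?\<tau> N (Suc j)} r)"
          by (simp add: mult_ac)
      qed
      have Yr: "square_integrable M (Y r)" by (rule regular_processD(3)[OF Y r(2)])
      have gr: "square_integrable M (\<lambda>y. g (r, y))"
        unfolding g_def fst_conv snd_conv by (rule square_integrable_cmult[OF Yr])
      show "square_integrable M (\<lambda>y. f N (r, y) - g (r, y))" by (rule square_integrable_diff[OF fr gr])
      show "(\<integral>y. (f N (r, y) - g (r, y))\<^sup>2 \<partial>M) \<le> 2 * C * (\<psi> r - \<sigma> N r)\<^sup>2 + 2 * e * (\<psi> r)\<^sup>2"
      proof (cases "r < s")
        case True
        obtain j where j: "j < N" "?\<tau> N j \<le> r" "r < ?\<tau> N (Suc j)"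
          using interval_partition_cell[OF ip[OF N], of r] r True by auto
        let ?u = "?\<tau> N j"
        have u: "?u \<in> {t..T}" by (rule inT[OF j(1)])
        have Yu: "square_integrable M (Y ?u)" by (rule regular_processD(3)[OF Y u])
        have f: "f N (r, y) = \<sigma> N r * Y ?u y" for y
          unfolding f_def \<sigma>_def fst_conv snd_conv
          using partition_sum_cell[OF ip[OF N] j, of "\<lambda>j. c N j * Y (?\<tau> N j) y"] partition_sum_cell[OF ip[OF N] j, of "c N"]
          by simp
        have eq: "f N (r, y) - g (r, y) = (\<sigma> N r - \<psi> r) * Y ?u y + \<psi> r * (Y ?u y - Y r y)" for y
          by (simp add: f g_def algebra_simps)
        have "\<bar>r - ?u\<bar> < d" using j uniform_partition_step[of t s N j] d by linarith
        then have m: "(\<integral>\<omega>. (Y ?u \<omega> - Y r \<omega>)\<^sup>2 \<partial>M) \<le> e" by (rule mod[OF u r(2)])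
        have "(\<integral>y. (f N (r, y) - g (r, y))\<^sup>2 \<partial>M) \<le> 2 * (\<integral>y. ((\<sigma> N r - \<psi> r) * Y ?u y)\<^sup>2 \<partial>M) + 2 * (\<integral>y. (\<psi> r * (Y ?u y - Y r y))\<^sup>2 \<partial>M)"
          unfolding eq by (intro l2_sum_bound square_integrable_cmult square_integrable_diff Yu Yr)
        also have "\<dots> = 2 * ((\<psi> r - \<sigma> N r)\<^sup>2 * (\<integral>y. (Y ?u y)\<^sup>2 \<partial>M)) + 2 * ((\<psi> r)\<^sup>2 * (\<integral>y. (Y ?u y - Y r y)\<^sup>2 \<partial>M))"
          by (simp add: power_mult_distrib power2_commute[of "\<sigma> N r"])
        also have "\<dots> \<le> 2 * ((\<psi> r - \<sigma> N r)\<^sup>2 * C) + 2 * ((\<psi> r)\<^sup>2 * e)"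
          using C(2) u m by (intro add_mono mult_left_mono) auto
        finally show ?thesis by (simp add: mult_ac)
      next
        \<comment> \<open>Here \<open>r = s\<close>, where all cells vanish; the first term of the
          bound, with \<open>\<sigma> = 0\<close>, absorbs the error.\<close>
        case False
        then have z: "f N (r, y) = 0" "\<sigma> N r = 0" for y
          unfolding f_def \<sigma>_def fst_conv snd_conv by (intro partition_support[OF ip[OF N]]; simp)+
        have "(\<integral>y. (f N (r, y) - g (r, y))\<^sup>2 \<partial>M) = (\<psi> r)\<^sup>2 * (\<integral>y. (Y r y)\<^sup>2 \<partial>M)"
          by (simp add: z g_def power_mult_distrib)
        also have "\<dots> \<le> (\<psi> r)\<^sup>2 * C" using C(2) r by (intro mult_left_mono) auto
        also have "\<dots> \<le> 2 * C * (\<psi> r - \<sigma> N r)\<^sup>2 + 2 * e * (\<psi> r)\<^sup>2"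
        proof -
          have "0 \<le> (\<psi> r)\<^sup>2 * C" "0 \<le> (\<psi> r)\<^sup>2 * e" using C(1) e by auto
          then show ?thesis unfolding z by (simp add: mult_ac)
        qed
        finally show ?thesis .
      qed
    qed
    also have "\<dots> = 2 * C * (\<integral>r. (\<psi> r - \<sigma> N r)\<^sup>2 \<partial>?Ls) + 2 * e * A"
      using int1 int2 by (simp add: A_def)
    finally show ?thesis .
  qed
  have "(\<lambda>N. \<integral>z. (f N z - g z)\<^sup>2 \<partial>?Q) \<longlonglongrightarrow> 0"
  proof (rule LIMSEQ_I)
    fix e :: real assume e: "0 < e"
    \<comment> \<open>\<open>A + 1\<close> because \<open>A\<close> may vanish.\<close>
    define e1 where "e1 = e / (4 * (A + 1))"
    have e1: "0 < e1" "2 * e1 * A \<le> e / 2"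
    proof -
      show "0 < e1" using e A0 by (simp add: e1_def)
      then have "2 * e1 * A \<le> 2 * e1 * (A + 1)" by (intro mult_left_mono) auto
      also have "\<dots> = e / 2" using A0 by (simp add: e1_def field_simps)
      finally show "2 * e1 * A \<le> e / 2" .
    qed
    obtain d where d: "0 < d" "\<forall>u\<in>{t..T}. \<forall>v\<in>{t..T}. \<bar>v - u\<bar> < d \<longrightarrow> (\<integral>\<omega>. (Y u \<omega> - Y v \<omega>)\<^sup>2 \<partial>M) < e1"
      using regular_processD(5)[OF Y e1(1)] by blast
    have "(\<lambda>N. 2 * C * (\<integral>r. (\<psi> r - \<sigma> N r)\<^sup>2 \<partial>?Ls)) \<longlonglongrightarrow> 2 * C * 0" by (intro tendsto_mult_left err)
    from LIMSEQ_D[OF this, of "e / 2"] e obtain N1 where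
      N1: "\<And>N. N \<ge> N1 \<Longrightarrow> norm (2 * C * (\<integral>r. (\<psi> r - \<sigma> N r)\<^sup>2 \<partial>?Ls)) < e / 2" by auto
    obtain N0 :: nat where N0: "(s - t) / d < real N0" using reals_Archimedean2 by blast
    show "\<exists>no. \<forall>N\<ge>no. norm ((\<integral>z. (f N z - g z)\<^sup>2 \<partial>?Q) - 0) < e"
    proof (intro exI[of _ "max 1 (max N0 N1)"] allI impI)
      fix N assume N: "max 1 (max N0 N1) \<le> N"
      have "(s - t) / d < real N" using N0 N by simp
      then have mesh: "(s - t) / real N < d" using d(1) N by (simp add: field_simps)
      have "(\<integral>z. (f N z - g z)\<^sup>2 \<partial>?Q) \<le> 2 * C * (\<integral>r. (\<psi> r - \<sigma> N r)\<^sup>2 \<partial>?Ls) + 2 * e1 * A"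
        using N e1(1) d(2) by (intro bound[OF _ _ mesh]) (auto intro: less_imp_le)
      also have "\<dots> < e / 2 + e / 2"
        using N1[of N] N e1(2) by (intro add_less_le_mono) auto
      finally show "norm ((\<integral>z. (f N z - g z)\<^sup>2 \<partial>?Q) - 0) < e" by simp
    qed
  qed
  then have "l2_tendsto ?Q f g" using sqf sqg by (simp add: l2_tendsto_def)
  then show ?thesis unfolding f_def[abs_def] g_def[abs_def] by blast
qed

text \<open>By the isometry the integrals of the approximants form a Cauchy sequence, and
  completeness relative to \<open>F s\<close> makes the limit adapted.\<close>

lemma ito_integral_exists:
  assumes s: "t < s" "s \<le> T" and Y: "regular_process Y" and \<psi>: "square_integrable L \<psi>" and i: "i \<in> {1..m}"
  shows "\<exists>X\<in>borel_measurable (F s). has_ito_integral M F (W i) t s (\<lambda>s \<omega>. \<psi> s * Y s \<omega>) X"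
proof -
  let ?Q = "lebesgue_on {t..s} \<Otimes>\<^sub>M M" and ?\<tau> = "uniform_partition t s"
  obtain c where c: "l2_tendsto ?Q
    (\<lambda>N z. \<Sum>j<N. (c N j * Y (?\<tau> N j) (snd z)) * indicator {?\<tau> N j..<?\<tau> N (Suc j)} (fst z))
    (\<lambda>z. \<psi> (fst z) * Y (fst z) (snd z))"
    using product_process_approx[OF s Y \<psi>] by blast
  define \<eta> where "\<eta> N j \<omega> = c N j * Y (?\<tau> N j) \<omega>" for N j \<omega>
  have ip: "interval_partition t s N (?\<tau> N)" if "0 < N" for N by (rule interval_partition_uniform[OF s(1) that])
  have inT: "?\<tau> N j \<in> {t..T}" if "j < N" for N j
    using interval_partition_bounds[OF ip, of N j] that s by auto
  have \<eta>: "\<eta> N j \<in> borel_measurable (F (?\<tau> N j)) \<and> square_integrable M (\<eta> N j)" if "j < N" for N j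
    unfolding \<eta>_def[abs_def]
    using regular_processD(2,3)[OF Y inT[OF that]] by (auto intro: square_integrable_cmult)
  define f where "f N z = (\<Sum>j<N. \<eta> N j (snd z) * indicator {?\<tau> N j..<?\<tau> N (Suc j)} (fst z))" for N z
  define S where "S N \<omega> = (\<Sum>j<N. \<eta> N j \<omega> * (W i (?\<tau> N (Suc j)) \<omega> - W i (?\<tau> N j) \<omega>))" for N \<omega>
  have lf: "l2_tendsto ?Q f (\<lambda>z. \<psi> (fst z) * Y (fst z) (snd z))"
    using c by (simp add: f_def[abs_def] \<eta>_def)
  have simp: "simple_ito i (f N) (S N)" for N
  proof (cases "N = 0")
    case True then show ?thesis by (simp add: f_def[abs_def] S_def[abs_def] simple_ito.zero)
  next
    case False
    then have "interval_partition t s N (?\<tau> N)" using ip[of N] by simp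
    then show ?thesis unfolding f_def[abs_def] S_def[abs_def]
      by (rule partition_simple_ito[OF _ s(2)]) (use \<eta> in simp)
  qed
  note sqf = simple_ito_square_integrable(1)[OF simp i] and sqS = simple_ito_square_integrable(2)[OF simp i]
  have lP: "l2_tendsto P f (\<lambda>z. indicator {t..<s} (fst z) * (\<psi> (fst z) * Y (fst z) (snd z)))"
  proof (rule l2_tendsto_strip[OF s(2) lf sqf])
    show "f N z = 0" if "fst z \<notin> {t..<s}" for N z
      using partition_support[OF ip that, of N] by (cases "N = 0") (auto simp: f_def)
  qed
  have dist: "(\<integral>\<omega>. (S k \<omega> - S n \<omega>)\<^sup>2 \<partial>M) = (\<integral>z. (f k z - f n z)\<^sup>2 \<partial>P)" for k n
    by (rule ito_rel_dist[OF ito_rel_simple[OF simp i] ito_rel_simple[OF simp i] i])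
  have SF: "S N \<in> borel_measurable (F s)" for N
    unfolding S_def[abs_def]
  proof (rule borel_measurable_sum)
    fix j assume "j \<in> {..<N}"
    then have j: "j < N" and N: "0 < N" by auto
    note b = interval_partition_bounds[OF ip[OF N] j]
    have 1: "\<eta> N j \<in> borel_measurable (F s)"
      by (rule F_measurable_mono[of _ "?\<tau> N j"]) (use \<eta>[OF j] b t s in auto)
    have "D i (?\<tau> N j) (?\<tau> N (Suc j)) \<in> borel_measurable (F s)"
      by (rule borel_measurable_diff; rule W_F_measurable[OF i]) (use b t s in auto)
    then show "(\<lambda>x. \<eta> N j x * (W i (?\<tau> N (Suc j)) x - W i (?\<tau> N j) x)) \<in> borel_measurable (F s)"
      by (rule borel_measurable_times[OF 1])
  qed
  have sub: "subalgebra M (F s)" using s t by (intro subalgebra_F) auto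
  have "\<exists>X\<in>borel_measurable (F s). l2_tendsto M S X"
    using l2_tendsto_Cauchy[OF lP] by (intro l2_complete[OF sqS sub SF]) (simp add: dist)
  then obtain X where X: "X \<in> borel_measurable (F s)" "l2_tendsto M S X" by blast
  have "has_ito_integral M F (W i) t s (\<lambda>s \<omega>. \<psi> s * Y s \<omega>) X"
    unfolding has_ito_integral_def
  proof (intro exI conjI allI impI)
    show "refining_partitions t s ?\<tau>" by (rule refining_partitions_uniform[OF s(1)])
    show "\<eta> N j \<in> borel_measurable (F (?\<tau> N j))" "square_integrable M (\<eta> N j)" if "j < N" for N j
      using \<eta>[OF that] by auto
    show "l2_tendsto ?Q (\<lambda>N (s, \<omega>). \<Sum>j<N. \<eta> N j \<omega> * indicator {?\<tau> N j..<?\<tau> N (Suc j)} s) (\<lambda>(s, \<omega>). \<psi> s * Y s \<omega>)"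
      using lf by (simp add: f_def[abs_def] case_prod_unfold)
    show "l2_tendsto M (\<lambda>N \<omega>. \<Sum>j<N. \<eta> N j \<omega> * (W i (?\<tau> N (Suc j)) \<omega> - W i (?\<tau> N j) \<omega>)) X"
      using X(2) by (simp add: S_def[abs_def])
  qed
  then show ?thesis using X(1) by blast
qed


text \<open>Freezing \<open>X\<close> on grids of mesh \<open>\<delta> k\<close> gives jointly measurable adapted processes that converge almost
  surely at every time, because \<open>\<delta> k\<close> makes the errors summable. Where they diverge, \<open>lim\<close> is an
  unspecified value, which is harmless for measurability.\<close>

lemma adapted_measurable_version:
  fixes X :: "real \<Rightarrow> 'a \<Rightarrow> real"
  assumes X: "\<And>s. s \<in> {t..T} \<Longrightarrow> X s \<in> borel_measurable (F s)" "\<And>s. s \<in> {t..T} \<Longrightarrow> square_integrable M (X s)"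
    and X0: "\<And>\<omega>. X t \<omega> = 0"
    and mod: "\<And>e. 0 < e \<Longrightarrow> \<exists>d>0. \<forall>u\<in>{t..T}. \<forall>s\<in>{t..T}. \<bar>s - u\<bar> < d \<longrightarrow> (\<integral>\<omega>. (X u \<omega> - X s \<omega>)\<^sup>2 \<partial>M) < e"
  shows "\<exists>Y. (\<lambda>(s, \<omega>). Y s \<omega>) \<in> borel_measurable P \<and> (\<forall>s\<in>{t..T}. Y s \<in> borel_measurable (F s)) \<and>
    (\<forall>\<omega>. Y t \<omega> = 0) \<and> (\<forall>s\<in>{t..T}. AE \<omega> in M. X s \<omega> = Y s \<omega>)"
proof -
  have "\<forall>k::nat. \<exists>d>0. \<forall>u\<in>{t..T}. \<forall>s\<in>{t..T}. \<bar>s - u\<bar> < d \<longrightarrow> (\<integral>\<omega>. (X u \<omega> - X s \<omega>)\<^sup>2 \<partial>M) < (1/2)^k"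
    by (intro allI mod) simp
  from choice[OF this] obtain \<delta> :: "nat \<Rightarrow> real" where \<delta>: "\<And>k. 0 < \<delta> k"
    "\<And>k u s. u \<in> {t..T} \<Longrightarrow> s \<in> {t..T} \<Longrightarrow> \<bar>s - u\<bar> < \<delta> k \<Longrightarrow> (\<integral>\<omega>. (X u \<omega> - X s \<omega>)\<^sup>2 \<partial>M) < (1/2)^k"
    by blast
  \<comment> \<open>Rounding down uses only past values, which keeps adaptedness, and it fixes
    \<open>t\<close>, where the value 0 has to be exact.\<close>
  define grid where "grid k s = t + \<delta> k * of_int \<lfloor>(s - t) / \<delta> k\<rfloor>" for k s
  have grid: "t \<le> grid k s" "grid k s \<le> s" "s - grid k s < \<delta> k" if "t \<le> s" for k s
  proof -
    have "0 \<le> (s - t) / \<delta> k" using that \<delta>(1)[of k] by simp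
    then have "0 \<le> \<lfloor>(s - t) / \<delta> k\<rfloor>" by simp
    then show "t \<le> grid k s" using \<delta>(1)[of k] by (simp add: grid_def)
    have "\<delta> k * of_int \<lfloor>(s - t) / \<delta> k\<rfloor> \<le> \<delta> k * ((s - t) / \<delta> k)"
      using \<delta>(1)[of k] by (intro mult_left_mono) auto
    also have "\<dots> = s - t" using \<delta>(1)[of k] by simp
    finally show "grid k s \<le> s" by (simp add: grid_def)
    have "s - t = \<delta> k * ((s - t) / \<delta> k)" using \<delta>(1)[of k] by simp
    also have "\<dots> < \<delta> k * (of_int \<lfloor>(s - t) / \<delta> k\<rfloor> + 1)"
      using \<delta>(1)[of k] by (intro mult_strict_left_mono) linarith+
    finally show "s - grid k s < \<delta> k" by (simp add: grid_def algebra_simps)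
  qed
  have gridT: "grid k s \<in> {t..T}" if "s \<in> {t..T}" for k s using grid[of s k] that by auto
  define Y where "Y s \<omega> = lim (\<lambda>k. X (grid k s) \<omega>)" for s \<omega>
  have XM: "X s \<in> borel_measurable M" if "s \<in> {t..T}" for s
    using square_integrableD(1)[OF X(2)[OF that]] .
  have id: "(\<lambda>s::real. s) \<in> borel_measurable L"
    by (rule measurable_restrict_space1[OF measurable_completion]) simp
  have joint: "(\<lambda>z. X (grid k (fst z)) (snd z)) \<in> borel_measurable P" for k
  proof -
    define h where "h n z = (if t + \<delta> k * of_int n \<in> {t..T} then X (t + \<delta> k * of_int n) (snd z) else 0)" for n :: int and z :: "real \<times> 'a"
    have h: "h n \<in> borel_measurable P" for n
    proof (cases "t + \<delta> k * of_int n \<in> {t..T}")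
      case True
      show ?thesis unfolding h_def[abs_def] if_P[OF True]
        by (rule measurable_compose[OF measurable_snd XM[OF True]])
    next
      case False
      show ?thesis unfolding h_def[abs_def] if_not_P[OF False] by (rule borel_measurable_const)
    qed
    have "(\<lambda>z. (fst z - t) / \<delta> k) \<in> borel_measurable P"
      using measurable_compose[OF measurable_fst id] by (intro borel_measurable_divide borel_measurable_diff borel_measurable_const)
    then have fl: "(\<lambda>z. \<lfloor>(fst z - t) / \<delta> k\<rfloor>) \<in> measurable P (count_space UNIV)"
      by (rule measurable_compose[OF _ measurable_real_floor])
    have "(\<lambda>z. h \<lfloor>(fst z - t) / \<delta> k\<rfloor> z) \<in> borel_measurable P"
      by (rule measurable_compose_countable[OF h fl])
    then show ?thesis
    proof (rule measurable_cong[THEN iffD1, rotated])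
      fix z assume "z \<in> space P"
      then have "fst z \<in> {t..T}" by (auto simp: space_pair_measure)
      then show "h \<lfloor>(fst z - t) / \<delta> k\<rfloor> z = X (grid k (fst z)) (snd z)"
        using gridT[of "fst z" k] by (simp add: h_def grid_def)
    qed
  qed
  have "(\<lambda>z. lim (\<lambda>k. X (grid k (fst z)) (snd z))) \<in> borel_measurable P"
    by (rule borel_measurable_lim_metric[OF joint])
  then have 1: "(\<lambda>(s, \<omega>). Y s \<omega>) \<in> borel_measurable P" by (simp add: Y_def case_prod_unfold)
  have 2: "Y s \<in> borel_measurable (F s)" if s: "s \<in> {t..T}" for s
    unfolding Y_def[abs_def]
  proof (rule borel_measurable_lim_metric)
    fix k
    show "X (grid k s) \<in> borel_measurable (F s)"
      by (rule F_measurable_mono[OF X(1)[OF gridT[OF s]]]) (use grid[of s k] s t in auto)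
  qed
  have "grid k t = t" for k by (simp add: grid_def)
  then have 3: "Y t \<omega> = 0" for \<omega> by (simp add: Y_def X0)
  have 4: "AE \<omega> in M. X s \<omega> = Y s \<omega>" if s: "s \<in> {t..T}" for s
  proof -
    have sq: "square_integrable M (\<lambda>\<omega>. X (grid k s) \<omega> - X s \<omega>)" for k
      by (intro square_integrable_diff X(2) gridT s)
    have "AE \<omega> in M. summable (\<lambda>k. (X (grid k s) \<omega> - X s \<omega>)\<^sup>2)"
    proof (rule AE_summable_of_integral_le)
      fix k
      have "\<bar>s - grid k s\<bar> < \<delta> k" using grid[of s k] s by auto
      then show "(\<integral>\<omega>. (X (grid k s) \<omega> - X s \<omega>)\<^sup>2 \<partial>M) \<le> (1/2)^k"
        using \<delta>(2)[OF gridT[OF s] s] by (simp add: less_imp_le)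
      show "integrable M (\<lambda>\<omega>. (X (grid k s) \<omega> - X s \<omega>)\<^sup>2)" by (rule square_integrableD(2)[OF sq])
    qed simp
    then show ?thesis
    proof eventually_elim
      case (elim \<omega>)
      then have "(\<lambda>k. (X (grid k s) \<omega> - X s \<omega>)\<^sup>2) \<longlonglongrightarrow> 0" by (rule summable_LIMSEQ_zero)
      then have "(\<lambda>k. X (grid k s) \<omega> - X s \<omega>) \<longlonglongrightarrow> 0" by (simp add: power_tendsto_0_iff)
      then have "(\<lambda>k. X (grid k s) \<omega>) \<longlonglongrightarrow> X s \<omega>" by (simp add: LIM_zero_iff)
      then show ?case unfolding Y_def by (rule limI[symmetric])
    qed
  qed
  show ?thesis using 1 2 3 4 by blast
qed

context
  fixes Y :: "real \<Rightarrow> 'a \<Rightarrow> real" and \<psi> :: "real \<Rightarrow> real" and X :: "real \<Rightarrow> 'a \<Rightarrow> real" and i :: nat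
  assumes Y: "regular_process Y" and \<psi>: "square_integrable L \<psi>" and i: "i \<in> {1..m}"
    and X: "\<And>s. s \<in> {t..T} \<Longrightarrow> ito_rel i (\<lambda>z. indicator {t..<s} (fst z) * (\<psi> (fst z) * Y (fst z) (snd z))) (X s)"
begin

lemma ito_family_bounded: "\<exists>C. \<forall>s\<in>{t..T}. (\<integral>\<omega>. (X s \<omega>)\<^sup>2 \<partial>M) \<le> C"
proof -
  obtain C where C: "C \<ge> 0" "\<forall>s\<in>{t..T}. (\<integral>\<omega>. (Y s \<omega>)\<^sup>2 \<partial>M) \<le> C" using regular_processD(4)[OF Y] by blast
  have "(\<integral>\<omega>. (X s \<omega>)\<^sup>2 \<partial>M) \<le> (\<integral>r. (\<psi> r)\<^sup>2 * C \<partial>L)" if s: "s \<in> {t..T}" for s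
  proof -
    let ?f = "\<lambda>z. indicator {t..<s} (fst z) * (\<psi> (fst z) * Y (fst z) (snd z))"
    have "(\<integral>\<omega>. (X s \<omega>)\<^sup>2 \<partial>M) = (\<integral>z. (?f z)\<^sup>2 \<partial>P)"
      using ito_rel_isometry[OF X[OF s] X[OF s] i i] by (simp add: power2_eq_square)
    also have "\<dots> \<le> (\<integral>r. (\<psi> r)\<^sup>2 * C \<partial>L)"
    proof (rule P.square_integrable_fiber_bound(2))
      show "?f \<in> borel_measurable P" by (rule square_integrableD(1)[OF ito_rel_square_integrable(1)[OF X[OF s]]])
      show "integrable L (\<lambda>r. (\<psi> r)\<^sup>2 * C)" using square_integrableD(2)[OF \<psi>] by simp
      fix r assume "r \<in> space L"
      then have r: "r \<in> {t..T}" by simp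
      show "square_integrable M (\<lambda>y. ?f (r, y))"
        unfolding fst_conv snd_conv by (intro square_integrable_cmult regular_processD(3)[OF Y r])
      have "(\<integral>y. (?f (r, y))\<^sup>2 \<partial>M) = (indicator {t..<s} r)\<^sup>2 * ((\<psi> r)\<^sup>2 * (\<integral>y. (Y r y)\<^sup>2 \<partial>M))"
        unfolding fst_conv snd_conv power_mult_distrib by simp
      also have "\<dots> \<le> 1 * ((\<psi> r)\<^sup>2 * C)"
        using C r by (intro mult_mono mult_left_mono) (auto split: split_indicator)
      finally show "(\<integral>y. (?f (r, y))\<^sup>2 \<partial>M) \<le> (\<psi> r)\<^sup>2 * C" by simp
    qed
    finally show ?thesis .
  qed
  then show ?thesis by blast
qed

text \<open>The difference of two integrals has an integrand supported on \<open>[u, s)\<close>,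
  which \<open>l2_modulus\<close> controls. It concerns any family of integrals, since it is applied
  both before and after the passage to a measurable version.\<close>

lemma ito_family_modulus:
  assumes e: "0 < e"
  shows "\<exists>d>0. \<forall>u\<in>{t..T}. \<forall>s\<in>{t..T}. \<bar>s - u\<bar> < d \<longrightarrow> (\<integral>\<omega>. (X u \<omega> - X s \<omega>)\<^sup>2 \<partial>M) < e"
proof -
  obtain C where C: "C \<ge> 0" "\<forall>s\<in>{t..T}. (\<integral>\<omega>. (Y s \<omega>)\<^sup>2 \<partial>M) \<le> C" using regular_processD(4)[OF Y] by blast
  have le: "(\<integral>\<omega>. (X u \<omega> - X s \<omega>)\<^sup>2 \<partial>M) \<le> C * (\<integral>r. indicator {u..<s} r * (\<psi> r)\<^sup>2 \<partial>L)"
    if u: "u \<in> {t..T}" and s: "s \<in> {t..T}" and us: "u \<le> s" for u s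
  proof -
    let ?\<xi> = "\<lambda>z. \<psi> (fst z) * Y (fst z) (snd z)"
    let ?f = "\<lambda>z. indicator {t..<u} (fst z) * ?\<xi> z - indicator {t..<s} (fst z) * ?\<xi> z"
    have "{u..<s} \<in> sets L" using u s by (auto simp: sets_restrict_space_iff)
    then have int: "integrable L (\<lambda>r. indicator {u..<s} r * (\<psi> r)\<^sup>2)"
      using integrable_mult_indicator[OF _ square_integrableD(2)[OF \<psi>]] by simp
    have "(\<integral>\<omega>. (X u \<omega> - X s \<omega>)\<^sup>2 \<partial>M) = (\<integral>z. (?f z)\<^sup>2 \<partial>P)"
      by (rule ito_rel_dist[OF X[OF u] X[OF s] i])
    also have "\<dots> \<le> (\<integral>r. C * (indicator {u..<s} r * (\<psi> r)\<^sup>2) \<partial>L)"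
    proof (rule P.square_integrable_fiber_bound(2))
      show "?f \<in> borel_measurable P"
        by (rule square_integrableD(1)[OF ito_rel_square_integrable(1)[OF ito_rel_diff[OF X[OF u] X[OF s]]]])
      show "integrable L (\<lambda>r. C * (indicator {u..<s} r * (\<psi> r)\<^sup>2))" using int by simp
      fix r assume "r \<in> space L"
      then have r: "r \<in> {t..T}" by simp
      have eq: "?f (r, y) = (- indicator {u..<s} r * \<psi> r) * Y r y" for y
        using us u r by (auto split: split_indicator)
      show "square_integrable M (\<lambda>y. ?f (r, y))"
        unfolding eq by (intro square_integrable_cmult regular_processD(3)[OF Y r])
      have "(\<integral>y. (?f (r, y))\<^sup>2 \<partial>M) = (indicator {u..<s} r * (\<psi> r)\<^sup>2) * (\<integral>y. (Y r y)\<^sup>2 \<partial>M)"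
        unfolding eq by (simp add: power_mult_distrib) (simp split: split_indicator)
      also have "\<dots> \<le> (indicator {u..<s} r * (\<psi> r)\<^sup>2) * C"
        using C(2) r by (intro mult_left_mono) auto
      finally show "(\<integral>y. (?f (r, y))\<^sup>2 \<partial>M) \<le> C * (indicator {u..<s} r * (\<psi> r)\<^sup>2)" by (simp add: mult_ac)
    qed
    also have "\<dots> = C * (\<integral>r. indicator {u..<s} r * (\<psi> r)\<^sup>2 \<partial>L)" by simp
    finally show ?thesis .
  qed
  \<comment> \<open>\<open>C + 1\<close> because \<open>C\<close> may be 0.\<close>
  have "0 < e / (C + 1)" using e C(1) by simp
  from l2_modulus[OF \<psi> this] obtain d where d: "0 < d"
    "\<And>u s. u \<in> {t..T} \<Longrightarrow> s \<in> {t..T} \<Longrightarrow> u \<le> s \<Longrightarrow> s - u < d \<Longrightarrow> (\<integral>r. indicator {u..<s} r * (\<psi> r)\<^sup>2 \<partial>L) < e / (C + 1)"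
    by blast
  have small: "(\<integral>\<omega>. (X u \<omega> - X s \<omega>)\<^sup>2 \<partial>M) < e" if u: "u \<in> {t..T}" and s: "s \<in> {t..T}" and us: "u \<le> s" "s - u < d" for u s
  proof -
    have "(\<integral>\<omega>. (X u \<omega> - X s \<omega>)\<^sup>2 \<partial>M) \<le> C * (\<integral>r. indicator {u..<s} r * (\<psi> r)\<^sup>2 \<partial>L)" by (rule le[OF u s us(1)])
    also have "\<dots> \<le> C * (e / (C + 1))" using C(1) d(2)[OF u s us] by (intro mult_left_mono) auto
    also have "\<dots> < (C + 1) * (e / (C + 1))" using \<open>0 < e / (C + 1)\<close> by (intro mult_strict_right_mono) auto
    also have "\<dots> = e" using C(1) by simp
    finally show ?thesis .
  qed
  show ?thesis
  proof (intro exI[of _ d] conjI ballI impI)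
    fix u s assume us: "u \<in> {t..T}" "s \<in> {t..T}" "\<bar>s - u\<bar> < d"
    show "(\<integral>\<omega>. (X u \<omega> - X s \<omega>)\<^sup>2 \<partial>M) < e"
    proof (cases "u \<le> s")
      case True
      then show ?thesis using small us by auto
    next
      case False
      then have "(\<integral>\<omega>. (X s \<omega> - X u \<omega>)\<^sup>2 \<partial>M) < e" using small us by auto
      then show ?thesis by (simp add: power2_commute)
    qed
  qed (rule d(1))
qed

end

section \<open>Indefinite Ito integrals\<close>

lemma ito_rel_null:
  assumes "X \<in> borel_measurable M" "\<And>\<omega>. \<omega> \<in> space M \<Longrightarrow> X \<omega> = 0"
  shows "ito_rel i (\<lambda>z. indicator {t..<t} (fst z) * f z) X"
proof -
  have "l2_tendsto M (\<lambda>n x. 0) X"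
    by (rule l2_tendsto_cong_AE[OF l2_tendsto_const[OF square_integrable_zero] assms(1)]) (use assms(2) in \<open>auto intro!: AE_I2\<close>)
  then show ?thesis unfolding ito_rel_def
    by (intro exI[of _ "\<lambda>n z. 0"] exI[of _ "\<lambda>n x. 0"])
       (auto intro: simple_ito.zero l2_tendsto_const square_integrable_zero)
qed

text \<open>\<open>is_indefinite_ito_integral\<close> prescribes the value 0 at \<open>s = t\<close>
  and speaks of Ito integrals only for \<open>s > t\<close>; at \<open>s = t\<close> the integrand
  has empty support, so the relation holds there as well.\<close>

lemma indefinite_ito_integral_rel:
  assumes Y: "is_indefinite_ito_integral M F (W i) t T \<xi> Y" and i: "i \<in> {1..m}" and s: "s \<in> {t..T}"
  shows "ito_rel i (\<lambda>z. indicator {t..<s} (fst z) * \<xi> (fst z) (snd z)) (Y s)"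
proof (cases "s = t")
  case True
  have "Y t \<in> borel_measurable M"
    using Y t by (intro F_measurable[of _ t]) (auto simp: is_indefinite_ito_integral_def)
  then show ?thesis unfolding True
    by (rule ito_rel_null) (use Y in \<open>auto simp: is_indefinite_ito_integral_def\<close>)
next
  case False
  then have "has_ito_integral M F (W i) t s \<xi> (Y s)" using Y s by (auto simp: is_indefinite_ito_integral_def)
  then show ?thesis by (rule has_ito_integral_rel) (use s i in auto)
qed

text \<open>Integrals chosen separately for each \<open>s\<close> need not be measurable in
  \<open>s\<close>. They are continuous in the mean, however, and therefore have an adapted jointly
  measurable version.\<close>

lemma indefinite_ito_integral_exists:
  assumes Y: "regular_process Y" and \<psi>: "square_integrable L \<psi>" and i: "i \<in> {1..m}"
  shows "\<exists>Z. is_indefinite_ito_integral M F (W i) t T (\<lambda>s \<omega>. \<psi> s * Y s \<omega>) Z"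
proof -
  have "\<forall>s. \<exists>X. s \<in> {t<..T} \<longrightarrow> X \<in> borel_measurable (F s) \<and> has_ito_integral M F (W i) t s (\<lambda>s \<omega>. \<psi> s * Y s \<omega>) X"
    using ito_integral_exists[OF _ _ Y \<psi> i] by (auto simp: Bex_def)
  from choice[OF this] obtain X0 where X0: "\<And>s. s \<in> {t<..T} \<Longrightarrow> X0 s \<in> borel_measurable (F s)"
    "\<And>s. s \<in> {t<..T} \<Longrightarrow> has_ito_integral M F (W i) t s (\<lambda>s \<omega>. \<psi> s * Y s \<omega>) (X0 s)"
    by blast
  define X where "X s = (if s = t then (\<lambda>_. 0) else X0 s)" for s
  have XF: "X s \<in> borel_measurable (F s)" if "s \<in> {t..T}" for s using X0(1)[of s] that by (auto simp: X_def)
  have Xr: "ito_rel i (\<lambda>z. indicator {t..<s} (fst z) * (\<psi> (fst z) * Y (fst z) (snd z))) (X s)" if s: "s \<in> {t..T}" for s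
  proof (cases "s = t")
    case True
    show ?thesis unfolding True by (rule ito_rel_null) (auto simp: X_def)
  next
    case False
    then have "has_ito_integral M F (W i) t s (\<lambda>s \<omega>. \<psi> s * Y s \<omega>) (X s)" using X0(2)[of s] s by (auto simp: X_def)
    then show ?thesis by (rule has_ito_integral_rel) (use s i in auto)
  qed
  have "\<exists>Z. (\<lambda>(s, \<omega>). Z s \<omega>) \<in> borel_measurable P \<and> (\<forall>s\<in>{t..T}. Z s \<in> borel_measurable (F s)) \<and>
    (\<forall>\<omega>. Z t \<omega> = 0) \<and> (\<forall>s\<in>{t..T}. AE \<omega> in M. X s \<omega> = Z s \<omega>)"
  proof (rule adapted_measurable_version)
    show "square_integrable M (X s)" if "s \<in> {t..T}" for s by (rule ito_rel_square_integrable(2)[OF Xr[OF that]])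
    show "X t \<omega> = 0" for \<omega> by (simp add: X_def)
    show "\<exists>d>0. \<forall>u\<in>{t..T}. \<forall>s\<in>{t..T}. \<bar>s - u\<bar> < d \<longrightarrow> (\<integral>\<omega>. (X u \<omega> - X s \<omega>)\<^sup>2 \<partial>M) < e" if "0 < e" for e
      by (rule ito_family_modulus[OF Y \<psi> i Xr that])
  qed (rule XF)
  then obtain Z where Z: "(\<lambda>(s, \<omega>). Z s \<omega>) \<in> borel_measurable P" "\<forall>s\<in>{t..T}. Z s \<in> borel_measurable (F s)"
    "\<forall>\<omega>. Z t \<omega> = 0" "\<forall>s\<in>{t..T}. AE \<omega> in M. X s \<omega> = Z s \<omega>" by blast
  have "has_ito_integral M F (W i) t s (\<lambda>s \<omega>. \<psi> s * Y s \<omega>) (Z s)" if s: "s \<in> {t<..T}" for s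
  proof (rule has_ito_integral_cong_AE)
    show "has_ito_integral M F (W i) t s (\<lambda>s \<omega>. \<psi> s * Y s \<omega>) (X s)" using X0(2)[OF s] s by (simp add: X_def)
    show "Z s \<in> borel_measurable M" by (rule F_measurable[of _ s]) (use Z(2) s t in auto)
    show "AE \<omega> in M. X s \<omega> = Z s \<omega>" using Z(4) s by auto
  qed
  then have "is_indefinite_ito_integral M F (W i) t T (\<lambda>s \<omega>. \<psi> s * Y s \<omega>) Z"
    using Z by (simp add: is_indefinite_ito_integral_def)
  then show ?thesis by blast
qed

text \<open>For every witness \<open>Z\<close>, because \<open>SOME\<close> may return another one
  than the process constructed above.\<close>

lemma indefinite_ito_integral_regular:
  assumes Y: "regular_process Y" and \<psi>: "square_integrable L \<psi>" and i: "i \<in> {1..m}"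
    and Z: "is_indefinite_ito_integral M F (W i) t T (\<lambda>s \<omega>. \<psi> s * Y s \<omega>) Z"
  shows "regular_process Z"
proof -
  note r = indefinite_ito_integral_rel[OF Z i]
  have "\<exists>C. \<forall>s\<in>{t..T}. (\<integral>\<omega>. (Z s \<omega>)\<^sup>2 \<partial>M) \<le> C" by (rule ito_family_bounded[OF Y \<psi> i r])
  moreover have "\<exists>d>0. \<forall>u\<in>{t..T}. \<forall>s\<in>{t..T}. \<bar>s - u\<bar> < d \<longrightarrow> (\<integral>\<omega>. (Z u \<omega> - Z s \<omega>)\<^sup>2 \<partial>M) < e" if "0 < e" for e
    by (rule ito_family_modulus[OF Y \<psi> i r that])
  moreover have "square_integrable M (Z s)" if "s \<in> {t..T}" for s by (rule ito_rel_square_integrable(2)[OF r[OF that]])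
  ultimately show ?thesis using Z by (simp add: regular_process_def is_indefinite_ito_integral_def)
qed

subsection \<open>Iterated Ito integrals\<close>

lemma regular_process_one: "regular_process (\<lambda>s \<omega>. 1)"
  unfolding regular_process_def
  by (auto simp: square_integrable_def intro!: exI[of _ 1])

abbreviation J where "J \<psi> i k \<equiv> iterated_ito_process M F W t T \<psi> i k"

text \<open>Each \<open>SOME\<close> of the recursion is backed by
  \<open>indefinite_ito_integral_exists\<close>, which the regularity of the previous level makes
  applicable.\<close>

lemma iterated_ito_regular:
  assumes "\<forall>q\<in>{1..k}. i q \<in> {1..m} \<and> square_integrable L (\<psi> q)"
  shows "regular_process (J \<psi> i k)"
  using assms
proof (induction k)
  case 0
  then show ?case by (simp add: regular_process_one)
next
  case (Suc k)
  then have Y: "regular_process (J \<psi> i k)" by auto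
  have \<psi>: "square_integrable L (\<psi> (Suc k))" "i (Suc k) \<in> {1..m}" using Suc.prems by auto
  show ?case using indefinite_ito_integral_regular[OF Y \<psi> someI_ex[OF indefinite_ito_integral_exists[OF Y \<psi>]]]
    by (simp add: indefinite_ito_integral_def)
qed

lemma iterated_ito_rel:
  assumes "\<forall>q\<in>{1..Suc k}. i q \<in> {1..m} \<and> square_integrable L (\<psi> q)" and s: "s \<in> {t..T}"
  shows "ito_rel (i (Suc k)) (\<lambda>z. indicator {t..<s} (fst z) * (\<psi> (Suc k) (fst z) * J \<psi> i k (fst z) (snd z))) (J \<psi> i (Suc k) s)"
proof -
  have Y: "regular_process (J \<psi> i k)" by (rule iterated_ito_regular) (use assms in auto)
  have \<psi>: "square_integrable L (\<psi> (Suc k))" "i (Suc k) \<in> {1..m}" using assms by auto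
  show ?thesis using indefinite_ito_integral_rel[OF someI_ex[OF indefinite_ito_integral_exists[OF Y \<psi>]] \<psi>(2) s]
    by (simp add: indefinite_ito_integral_def)
qed

text \<open>The integral over \<open>t \<le> r\<^sub>1 < \<dots> < r\<^sub>k < s\<close>, see
  \<open>simplex_integral_eq\<close>, with the outermost variable peeled off as in
  \<open>iterated_ito_process\<close>.\<close>

primrec simplex_integral :: "(nat \<Rightarrow> real \<Rightarrow> real) \<Rightarrow> nat \<Rightarrow> real \<Rightarrow> real" where
  "simplex_integral h 0 s = 1"
| "simplex_integral h (Suc k) s = (\<integral>r. indicator {t..<s} r * (h (Suc k) r * simplex_integral h k r) \<partial>L)"

text \<open>The isometry and Fubini's theorem reduce the outermost integral to a time integral of
  the inner product one level down, hence the induction over all \<open>s\<close>. A level at which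
  the component indices differ makes the inner product vanish.\<close>

lemma iterated_ito_inner:
  assumes f: "\<forall>q\<in>{1..k}. i q \<in> {1..m} \<and> square_integrable L (f q)"
    and g: "\<forall>q\<in>{1..k}. j q \<in> {1..m} \<and> square_integrable L (g q)"
    and s: "s \<in> {t..T}"
  shows "(\<integral>\<omega>. J f i k s \<omega> * J g j k s \<omega> \<partial>M) =
    (if \<forall>q\<in>{1..k}. i q = j q then simplex_integral (\<lambda>q r. f q r * g q r) k s else 0)"
  using assms
proof (induction k arbitrary: s)
  case 0
  then show ?case by (simp add: prob_space)
next
  case (Suc k)
  let ?h = "\<lambda>q r. f q r * g q r"
  let ?f = "\<lambda>z. indicator {t..<s} (fst z) * (f (Suc k) (fst z) * J f i k (fst z) (snd z))"
  let ?g = "\<lambda>z. indicator {t..<s} (fst z) * (g (Suc k) (fst z) * J g j k (fst z) (snd z))"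
  note rf = iterated_ito_rel[OF Suc.prems(1,3)] and rg = iterated_ito_rel[OF Suc.prems(2,3)]
  have IH: "(\<integral>\<omega>. J f i k r \<omega> * J g j k r \<omega> \<partial>M) = (if \<forall>q\<in>{1..k}. i q = j q then simplex_integral ?h k r else 0)"
    if "r \<in> {t..T}" for r using Suc.IH[OF _ _ that] Suc.prems by auto
  have int: "integrable P (\<lambda>z. ?f z * ?g z)"
    by (intro square_integrable_mult_integrable ito_rel_square_integrable(1)[OF rf] ito_rel_square_integrable(1)[OF rg])
  have "(\<integral>z. ?f z * ?g z \<partial>P) = (\<integral>r. \<integral>\<omega>. ?f (r, \<omega>) * ?g (r, \<omega>) \<partial>M \<partial>L)"
    by (rule P.integral_fst'[OF int, symmetric])
  also have "\<dots> = (\<integral>r. indicator {t..<s} r * (?h (Suc k) r * (if \<forall>q\<in>{1..k}. i q = j q then simplex_integral ?h k r else 0)) \<partial>L)"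
  proof (rule Bochner_Integration.integral_cong[OF refl])
    fix r assume "r \<in> space L"
    then have r: "r \<in> {t..T}" by simp
    have "(\<integral>\<omega>. ?f (r, \<omega>) * ?g (r, \<omega>) \<partial>M) =
       (\<integral>\<omega>. (indicator {t..<s} r * ?h (Suc k) r) * (J f i k r \<omega> * J g j k r \<omega>) \<partial>M)"
      unfolding fst_conv snd_conv by (intro Bochner_Integration.integral_cong) (auto split: split_indicator)
    also have "\<dots> = (indicator {t..<s} r * ?h (Suc k) r) * (\<integral>\<omega>. J f i k r \<omega> * J g j k r \<omega> \<partial>M)" by simp
    finally show "(\<integral>\<omega>. ?f (r, \<omega>) * ?g (r, \<omega>) \<partial>M) =
      indicator {t..<s} r * (?h (Suc k) r * (if \<forall>q\<in>{1..k}. i q = j q then simplex_integral ?h k r else 0))"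
      unfolding IH[OF r] by (simp add: mult.assoc)
  qed
  also have "\<dots> = (if \<forall>q\<in>{1..k}. i q = j q then simplex_integral ?h (Suc k) s else 0)"
  proof (cases "\<forall>q\<in>{1..k}. i q = j q")
    case True
    show ?thesis by (simp only: if_P[OF True] simplex_integral.simps)
  next
    case False
    show ?thesis by (simp only: if_not_P[OF False] mult_zero_right Bochner_Integration.integral_zero)
  qed
  finally have eq: "(\<integral>z. ?f z * ?g z \<partial>P) = (if \<forall>q\<in>{1..k}. i q = j q then simplex_integral ?h (Suc k) s else 0)" .
  have ij: "i (Suc k) \<in> {1..m}" "j (Suc k) \<in> {1..m}" using Suc.prems by auto
  have "(\<forall>q\<in>{1..Suc k}. i q = j q) \<longleftrightarrow> i (Suc k) = j (Suc k) \<and> (\<forall>q\<in>{1..k}. i q = j q)"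
    by (auto simp: atLeastAtMostSuc_conv)
  then show ?case unfolding ito_rel_isometry[OF rf rg ij] eq by auto
qed

end


subsection \<open>Sorting permutations\<close>

lemma chain_less:
  fixes y :: "nat \<Rightarrow> 'c::linorder"
  assumes "\<forall>q\<in>{1..<k}. y q < y (Suc q)" "1 \<le> a" "a < b" "b \<le> k"
  shows "y a < y b"
proof -
  have "y a < y (Suc (a + n))" if "a + n < k" for n
    using that
  proof (induction n)
    case 0
    then show ?case using assms by simp
  next
    case (Suc n)
    then have "y a < y (Suc (a + n))" by simp
    also have "\<dots> < y (Suc (Suc (a + n)))" using assms(1,2) Suc.prems by simp
    finally show ?case by simp
  qed
  from this[of "b - a - 1"] show ?thesis using assms by simp
qed

text \<open>A sorting permutation \<open>\<sigma>\<close> attains the values up to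
  \<open>x (\<sigma> q)\<close> exactly on the image of \<open>{1..q}\<close>, so
  \<open>rank (\<sigma> q) = q\<close> and \<open>\<sigma>\<close> is the inverse of
  \<open>rank\<close>.\<close>

lemma ex1_sorting_permutation:
  fixes x :: "nat \<Rightarrow> 'c::linorder"
  assumes inj: "inj_on x {1..k}"
  shows "\<exists>!\<sigma>. \<sigma> permutes {1..k} \<and> (\<forall>q\<in>{1..<k}. x (\<sigma> q) < x (\<sigma> (Suc q)))"
proof -
  \<comment> \<open>The identity off \<open>{1..k}\<close>, as \<open>permutes\<close>
    demands.\<close>
  define rank where "rank p = (if p \<in> {1..k} then card {p'\<in>{1..k}. x p' \<le> x p} else p)" for p
  have into: "rank p \<in> {1..k}" if "p \<in> {1..k}" for p
  proof -
    have "p \<in> {p'\<in>{1..k}. x p' \<le> x p}" using that by auto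
    then have "0 < card {p'\<in>{1..k}. x p' \<le> x p}" by (auto simp: card_gt_0_iff)
    moreover have "card {p'\<in>{1..k}. x p' \<le> x p} \<le> card {1..k}" by (rule card_mono) auto
    ultimately show ?thesis using that by (simp add: rank_def)
  qed
  have less: "rank p < rank q" if "p \<in> {1..k}" "q \<in> {1..k}" "x p < x q" for p q
  proof -
    have "{p'\<in>{1..k}. x p' \<le> x p} \<subseteq> {p'\<in>{1..k}. x p' \<le> x q}"
      "q \<in> {p'\<in>{1..k}. x p' \<le> x q}" "q \<notin> {p'\<in>{1..k}. x p' \<le> x p}" using that by auto
    then have "{p'\<in>{1..k}. x p' \<le> x p} \<subset> {p'\<in>{1..k}. x p' \<le> x q}" by blast
    then show ?thesis using that by (simp add: rank_def psubset_card_mono)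
  qed
  have ij: "inj_on rank {1..k}"
  proof (rule inj_onI, rule ccontr)
    fix p q assume pq: "p \<in> {1..k}" "q \<in> {1..k}" "rank p = rank q" "p \<noteq> q"
    then have "x p \<noteq> x q" using inj by (auto dest: inj_onD)
    then show False using less[of p q] less[of q p] pq less_linear[of "x p" "x q"] by auto
  qed
  have perm: "rank permutes {1..k}"
  proof (rule bij_imp_permutes)
    have "rank ` {1..k} \<subseteq> {1..k}" using into by blast
    from endo_inj_surj[OF finite_atLeastAtMost this ij] ij
    show "bij_betw rank {1..k} {1..k}" unfolding bij_betw_def by blast
  qed (simp only: rank_def if_False)
  show ?thesis
  proof (rule ex1I[of _ "inv rank"])
    show "inv rank permutes {1..k} \<and> (\<forall>q\<in>{1..<k}. x (inv rank q) < x (inv rank (Suc q)))"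
    proof (intro conjI ballI)
      show ip: "inv rank permutes {1..k}" by (rule permutes_inv[OF perm])
      fix q assume q: "q \<in> {1..<k}"
      have in1: "inv rank q \<in> {1..k}" "inv rank (Suc q) \<in> {1..k}"
        using q permutes_in_image[OF ip, of q] permutes_in_image[OF ip, of "Suc q"] by simp_all
      have r: "rank (inv rank q) = q" "rank (inv rank (Suc q)) = Suc q"
        using permutes_inverses(1)[OF perm] by auto
      show "x (inv rank q) < x (inv rank (Suc q))"
      proof (rule ccontr)
        assume "\<not> ?thesis"
        then have "x (inv rank (Suc q)) < x (inv rank q) \<or> inv rank (Suc q) = inv rank q"
          using inj_onD[OF inj _ in1] less_linear[of "x (inv rank q)" "x (inv rank (Suc q))"] by auto
        then show False using less[OF in1(2,1)] r by auto
      qed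
    qed
    fix \<sigma> assume \<sigma>: "\<sigma> permutes {1..k} \<and> (\<forall>q\<in>{1..<k}. x (\<sigma> q) < x (\<sigma> (Suc q)))"
    have \<sigma>p: "\<sigma> permutes {1..k}" using \<sigma> by (rule conjunct1)
    have mono: "x (\<sigma> a) < x (\<sigma> b)" if "1 \<le> a" "a < b" "b \<le> k" for a b
      using chain_less[of k "\<lambda>q. x (\<sigma> q)" a b] \<sigma> that by auto
    have rk: "rank (\<sigma> q) = q" for q
    proof (cases "q \<in> {1..k}")
      case True
      have "{p'\<in>{1..k}. x p' \<le> x (\<sigma> q)} = \<sigma> ` {1..q}"
      proof (rule set_eqI)
        fix p
        show "p \<in> {p'\<in>{1..k}. x p' \<le> x (\<sigma> q)} \<longleftrightarrow> p \<in> \<sigma> ` {1..q}"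
        proof
          assume "p \<in> {p'\<in>{1..k}. x p' \<le> x (\<sigma> q)}"
          then have "p \<in> \<sigma> ` {1..k}" "x p \<le> x (\<sigma> q)" unfolding permutes_image[OF \<sigma>p] by simp_all
          then obtain r where r: "r \<in> {1..k}" "p = \<sigma> r" "x (\<sigma> r) \<le> x (\<sigma> q)" by blast
          then have "\<not> q < r" using mono[of q r] True by auto
          then show "p \<in> \<sigma> ` {1..q}" using r by auto
        next
          assume "p \<in> \<sigma> ` {1..q}"
          then obtain r where r: "r \<in> {1..q}" "p = \<sigma> r" by auto
          then have "r \<in> {1..k}" using True by auto
          then have "\<sigma> r \<in> {1..k}" unfolding permutes_in_image[OF \<sigma>p] .
          moreover have "x (\<sigma> r) \<le> x (\<sigma> q)" using mono[of r q] r True by (cases "r = q") auto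
          ultimately show "p \<in> {p'\<in>{1..k}. x p' \<le> x (\<sigma> q)}" using r by auto
        qed
      qed
      moreover have "card (\<sigma> ` {1..q}) = q" using card_image[OF inj_on_subset[OF permutes_inj[OF \<sigma>p] subset_UNIV]] by simp
      moreover have "\<sigma> q \<in> {1..k}" unfolding permutes_in_image[OF \<sigma>p] by (rule True)
      ultimately show ?thesis by (simp add: rank_def)
    next
      case False
      have sq: "\<sigma> q = q" by (rule permutes_not_in[OF \<sigma>p False])
      show ?thesis unfolding sq by (simp only: rank_def if_not_P[OF False])
    qed
    show "\<sigma> = inv rank"
    proof (rule ext)
      fix q
      show "\<sigma> q = inv rank q" using permutes_inverses(2)[OF perm, of "\<sigma> q"] unfolding rk by (rule sym)
    qed
  qed
qed

text \<open>A partition of unity. Applied to points of the cube it tiles the cube by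
  \<open>k!\<close> simplices; applied to tuples of cells it isolates the sorted order.\<close>

lemma sum_sorting_permutations:
  fixes x :: "nat \<Rightarrow> 'c::linorder" and c :: real
  assumes "inj_on x {1..k}"
  shows "(\<Sum>\<sigma> | \<sigma> permutes {1..k}. if \<forall>q\<in>{1..<k}. x (\<sigma> q) < x (\<sigma> (Suc q)) then c else 0) = c"
proof -
  let ?S = "\<lambda>\<sigma>. \<forall>q\<in>{1..<k}. x (\<sigma> q) < x (\<sigma> (Suc q))"
  from ex1_sorting_permutation[OF assms] obtain \<sigma>0 where s0: "\<sigma>0 permutes {1..k} \<and> ?S \<sigma>0"
    and uniq0: "\<forall>\<sigma>. \<sigma> permutes {1..k} \<and> ?S \<sigma> \<longrightarrow> \<sigma> = \<sigma>0"
    by (rule ex1E)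
  note \<sigma>0 = s0[THEN conjunct1] s0[THEN conjunct2]
  have uniq: "\<sigma> = \<sigma>0" if "\<sigma> permutes {1..k}" "?S \<sigma>" for \<sigma>
    by (rule uniq0[rule_format]) (intro conjI that)
  have "(\<Sum>\<sigma> | \<sigma> permutes {1..k}. if \<forall>q\<in>{1..<k}. x (\<sigma> q) < x (\<sigma> (Suc q)) then c else 0) =
    (\<Sum>\<sigma> | \<sigma> permutes {1..k}. if \<sigma> = \<sigma>0 then c else 0)"
  proof (rule sum.cong[OF refl])
    fix \<sigma> assume "\<sigma> \<in> {\<sigma>. \<sigma> permutes {1..k}}"
    then have \<sigma>: "\<sigma> permutes {1..k}" by simp
    show "(if ?S \<sigma> then c else 0) = (if \<sigma> = \<sigma>0 then c else 0)"
    proof (cases "?S \<sigma>")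
      case True
      have eq: "\<sigma> = \<sigma>0" by (rule uniq[OF \<sigma> True])
      show ?thesis unfolding if_P[OF True] if_P[OF eq] ..
    next
      case False
      then have ne: "\<sigma> \<noteq> \<sigma>0" using \<sigma>0(2) by blast
      show ?thesis unfolding if_not_P[OF False] if_not_P[OF ne] ..
    qed
  qed
  also have "\<dots> = c" using \<sigma>0(1) by (simp add: finite_permutations)
  finally show ?thesis .
qed

subsection \<open>Integration over the cube\<close>

definition ordered_on :: "nat \<Rightarrow> (nat \<Rightarrow> real) \<Rightarrow> bool" where
  "ordered_on k x \<longleftrightarrow> (\<forall>q\<in>{1..<k}. x q < x (Suc q))"

context ito
begin

sublocale C: product_sigma_finite "\<lambda>_::nat. L"
  by standard

lemma L_id: "(\<lambda>s::real. s) \<in> borel_measurable L"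
  by (rule measurable_restrict_space1[OF measurable_completion]) simp

lemma cube_component: "q \<in> I \<Longrightarrow> (\<lambda>x. x q) \<in> borel_measurable (PiM I (\<lambda>_. L))"
  using measurable_compose[OF measurable_component_singleton[of q I "\<lambda>_. L"] L_id] .

lemma cube_component_compose: "q \<in> I \<Longrightarrow> h \<in> borel_measurable L \<Longrightarrow> (\<lambda>x. h (x q) :: real) \<in> borel_measurable (PiM I (\<lambda>_. L))"
  using measurable_compose[OF measurable_component_singleton[of q I "\<lambda>_. L"]] .

lemma space_cube: "x \<in> space (cube t T k) \<Longrightarrow> q \<in> {1..k} \<Longrightarrow> x q \<in> {t..T}"
  by (auto simp: space_PiM PiE_def Pi_def)

lemma cube_prod_measurable:
  assumes "\<And>q. q \<in> {1..k} \<Longrightarrow> h q \<in> borel_measurable L"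
  shows "(\<lambda>x. \<Prod>q=1..k. h q (x q) :: real) \<in> borel_measurable (cube t T k)"
  using assms by (intro borel_measurable_prod cube_component_compose) auto

lemma ordered_on_measurable: "{x \<in> space (cube t T k). ordered_on k x} \<in> sets (cube t T k)"
  unfolding ordered_on_def
  by (intro sets.sets_Collect_finite_All borel_measurable_less cube_component) auto

lemma cube_emeasure_finite: "integrable (cube t T k) (\<lambda>x. 1 :: real)"
proof -
  have "integrable (cube t T k) (\<lambda>x. \<Prod>q\<in>{1..k}. (1 :: real))"
    by (rule C.product_integrable_prod) auto
  then show ?thesis by simp
qed

lemma AE_L_neq: "AE r in L. r \<noteq> c"
proof -
  have "AE r in lebesgue. r \<notin> {c}" by (rule AE_not_in) (simp add: negligible_iff_null_sets[symmetric])
  then show ?thesis by (subst AE_restrict_space_iff) (auto elim: eventually_mono)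
qed

text \<open>With coordinate \<open>p\<close> integrated first, the diagonal meets each line in a
  single point.\<close>

lemma AE_cube_neq:
  assumes pq: "p \<in> {1..k}" "q \<in> {1..k}" "p \<noteq> q"
  shows "AE x in cube t T k. x p \<noteq> x q"
proof -
  let ?I = "{1..k} - {p}" and ?f = "\<lambda>x::nat \<Rightarrow> real. indicator {x. x p = x q} x :: real"
  have ins: "insert p ?I = {1..k}" using pq by auto
  have m: "{x \<in> space (cube t T k). x p = x q} \<in> sets (cube t T k)"
    by (intro borel_measurable_eq cube_component pq)
  have fm: "?f \<in> borel_measurable (cube t T k)"
    by (rule borel_measurable_indicator_iff[THEN iffD2]) (use m in \<open>simp add: Int_def conj_commute\<close>)
  have int: "integrable (cube t T k) ?f"
    by (rule Bochner_Integration.integrable_bound[OF cube_emeasure_finite fm]) (auto split: split_indicator)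
  have "(\<integral>x. ?f x \<partial>cube t T k) = (\<integral>x. (\<integral>y. ?f (x(p := y)) \<partial>L) \<partial>PiM ?I (\<lambda>_. L))"
    using C.product_integral_insert[of ?I p ?f] int unfolding ins by simp
  also have "\<dots> = (\<integral>x. 0 \<partial>PiM ?I (\<lambda>_. L))"
  proof (rule Bochner_Integration.integral_cong[OF refl])
    fix x :: "nat \<Rightarrow> real"
    have "AE y in L. ?f (x(p := y)) = 0"
      using AE_L_neq[of "x q"] by eventually_elim (use pq in auto)
    then show "(\<integral>y. ?f (x(p := y)) \<partial>L) = 0" by (rule integral_eq_zero_AE)
  qed
  finally have "(\<integral>x. ?f x \<partial>cube t T k) = 0" by simp
  then have "AE x in cube t T k. ?f x = 0"
    using integral_nonneg_eq_0_iff_AE[OF int] by auto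
  then show ?thesis by eventually_elim (auto split: split_indicator_asm)
qed

lemma AE_cube_inj: "AE x in cube t T k. inj_on x {1..k}"
proof -
  have "AE x in cube t T k. \<forall>pq \<in> {1..k} \<times> {1..k}. fst pq \<noteq> snd pq \<longrightarrow> x (fst pq) \<noteq> x (snd pq)"
    using AE_cube_neq by (intro AE_finite_allI) (auto intro: AE_impI)
  then show ?thesis by eventually_elim (auto simp: inj_on_def)
qed

section \<open>Permuting the coordinates of the cube\<close>

lemma cube_permute_measurable:
  assumes "\<sigma> permutes {1..k}"
  shows "(\<lambda>x. \<lambda>q\<in>{1..k}. x (\<sigma> q)) \<in> measurable (cube t T k) (cube t T k)"
  using permutes_in_image[OF assms] by (intro measurable_restrict measurable_component_singleton) auto

lemma cube_permute_distr:
  assumes \<sigma>: "\<sigma> permutes {1..k}"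
  shows "distr (cube t T k) (cube t T k) (\<lambda>x. \<lambda>q\<in>{1..k}. x (\<sigma> q)) = cube t T k"
proof (rule measure_eqI_PiM_finite[where I="{1..k}" and M="\<lambda>_. L" and A="\<lambda>_. Pi\<^sub>E {1..k} (\<lambda>_. space L)"])
  let ?g = "\<lambda>x. \<lambda>q\<in>{1..k}. x (\<sigma> q)"
  have gm: "?g \<in> measurable (cube t T k) (cube t T k)" by (rule cube_permute_measurable[OF \<sigma>])
  have em: "emeasure (distr (cube t T k) (cube t T k) ?g) (Pi\<^sub>E {1..k} A) = emeasure (cube t T k) (Pi\<^sub>E {1..k} A)"
    if A: "\<And>i. i \<in> {1..k} \<Longrightarrow> A i \<in> sets L" for A
  proof -
    \<comment> \<open>The preimage of a box is the box with permuted sides, which has the same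
      measure.\<close>
    have "?g -` (Pi\<^sub>E {1..k} A) \<inter> space (cube t T k) = Pi\<^sub>E {1..k} (\<lambda>q. A (inv \<sigma> q))"
    proof (rule set_eqI)
      fix x
      have 1: "(\<forall>q\<in>{1..k}. x (\<sigma> q) \<in> A q) \<longleftrightarrow> (\<forall>q\<in>{1..k}. x q \<in> A (inv \<sigma> q))"
      proof (intro iffI ballI)
        fix q assume *: "\<forall>q\<in>{1..k}. x (\<sigma> q) \<in> A q" and q: "q \<in> {1..k}"
        have "inv \<sigma> q \<in> {1..k}" using q permutes_in_image[OF permutes_inv[OF \<sigma>]] by blast
        then have "x (\<sigma> (inv \<sigma> q)) \<in> A (inv \<sigma> q)" using * by blast
        then show "x q \<in> A (inv \<sigma> q)" by (simp add: permutes_inverses(1)[OF \<sigma>])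
      next
        fix q assume *: "\<forall>q\<in>{1..k}. x q \<in> A (inv \<sigma> q)" and q: "q \<in> {1..k}"
        have "\<sigma> q \<in> {1..k}" using q permutes_in_image[OF \<sigma>] by blast
        then have "x (\<sigma> q) \<in> A (inv \<sigma> (\<sigma> q))" using * by blast
        then show "x (\<sigma> q) \<in> A q" by (simp add: permutes_inverses(2)[OF \<sigma>])
      qed
      have 2: "x q \<in> space L" if "\<forall>q\<in>{1..k}. x q \<in> A (inv \<sigma> q)" "q \<in> {1..k}" for q
      proof -
        have "inv \<sigma> q \<in> {1..k}" using that(2) permutes_in_image[OF permutes_inv[OF \<sigma>]] by blast
        then show ?thesis using sets.sets_into_space[OF A] that by blast
      qed
      show "x \<in> ?g -` (Pi\<^sub>E {1..k} A) \<inter> space (cube t T k) \<longleftrightarrow> x \<in> Pi\<^sub>E {1..k} (\<lambda>q. A (inv \<sigma> q))"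
        using 1 2 by (auto simp: space_PiM PiE_iff)
    qed
    then have "emeasure (distr (cube t T k) (cube t T k) ?g) (Pi\<^sub>E {1..k} A) = emeasure (cube t T k) (Pi\<^sub>E {1..k} (\<lambda>q. A (inv \<sigma> q)))"
      using gm A by (subst emeasure_distr) (auto intro!: sets_PiM_I_finite)
    also have "\<dots> = (\<Prod>q\<in>{1..k}. emeasure L (A (inv \<sigma> q)))"
      using A permutes_in_image[OF permutes_inv[OF \<sigma>]] by (intro C.emeasure_PiM) auto
    also have "\<dots> = (\<Prod>q\<in>{1..k}. emeasure L (A q))"
      using prod.permute[OF permutes_inv[OF \<sigma>], of "\<lambda>q. emeasure L (A q)"] by (simp add: comp_def)
    also have "\<dots> = emeasure (cube t T k) (Pi\<^sub>E {1..k} A)"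
      using A by (intro C.emeasure_PiM[symmetric]) auto
    finally show ?thesis .
  qed
  show "emeasure (distr (cube t T k) (cube t T k) ?g) (Pi\<^sub>E {1..k} A) = emeasure (cube t T k) (Pi\<^sub>E {1..k} A)"
    if "\<And>i. i \<in> {1..k} \<Longrightarrow> A i \<in> sets L" for A by (rule em[OF that])
  show "range (\<lambda>_::nat. Pi\<^sub>E {1..k} (\<lambda>_. space L)) \<subseteq> prod_algebra {1..k} (\<lambda>_. L)"
    by (auto intro!: prod_algebraI_finite)
  show "(\<Union>i::nat. Pi\<^sub>E {1..k} (\<lambda>_. space L)) = space (cube t T k)" by (simp add: space_PiM)
  have "emeasure (cube t T k) (Pi\<^sub>E {1..k} (\<lambda>_. space L)) = (\<Prod>q\<in>{1..k}. emeasure L (space L))"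
    by (intro C.emeasure_PiM) auto
  also have "\<dots> < top"
    by (simp only: L.emeasure_eq_measure prod_constant ennreal_power measure_nonneg) simp
  finally show "emeasure (distr (cube t T k) (cube t T k) ?g) (Pi\<^sub>E {1..k} (\<lambda>_. space L)) \<noteq> \<infinity>"
    by (subst em) auto
qed simp_all

lemma cube_permute_integral:
  fixes f :: "(nat \<Rightarrow> real) \<Rightarrow> real"
  assumes \<sigma>: "\<sigma> permutes {1..k}" and f: "f \<in> borel_measurable (cube t T k)"
  shows "(\<integral>x. f (\<lambda>q\<in>{1..k}. x (\<sigma> q)) \<partial>cube t T k) = (\<integral>x. f x \<partial>cube t T k)"
  using integral_distr[OF cube_permute_measurable[OF \<sigma>] f] cube_permute_distr[OF \<sigma>] by simp

lemma cube_permute_integrable: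
  fixes f :: "(nat \<Rightarrow> real) \<Rightarrow> real"
  assumes \<sigma>: "\<sigma> permutes {1..k}" and f: "integrable (cube t T k) f"
  shows "integrable (cube t T k) (\<lambda>x. f (\<lambda>q\<in>{1..k}. x (\<sigma> q)))"
proof -
  have "integrable (distr (cube t T k) (cube t T k) (\<lambda>x. \<lambda>q\<in>{1..k}. x (\<sigma> q))) f"
    unfolding cube_permute_distr[OF \<sigma>] by (rule f)
  then show ?thesis using integrable_distr_eq[OF cube_permute_measurable[OF \<sigma>], of f] f by auto
qed

lemma ordered_tensor_integrable:
  assumes h: "\<And>q. q \<in> {1..k} \<Longrightarrow> integrable L (h q :: real \<Rightarrow> real)"
  shows "integrable (cube t T k) (\<lambda>x. if ordered_on k x then \<Prod>q=1..k. h q (x q) else 0)"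
proof (rule Bochner_Integration.integrable_bound)
  show "integrable (cube t T k) (\<lambda>x. \<Prod>q=1..k. h q (x q))" by (rule C.product_integrable_prod) (use h in auto)
  show "(\<lambda>x. if ordered_on k x then \<Prod>q=1..k. h q (x q) else 0) \<in> borel_measurable (cube t T k)"
    by (rule measurable_If[OF cube_prod_measurable borel_measurable_const ordered_on_measurable]) (use h in auto)
qed auto

text \<open>Permuting the coordinates by \<open>\<sigma>\<close> restores the fixed product and
  turns the ordered simplex into the one sorted by \<open>\<sigma>\<close>; these simplices tile the
  cube up to the null set of coinciding coordinates.\<close>

lemma sum_permutations_ordered_integral:
  assumes h: "\<And>q. q \<in> {1..k} \<Longrightarrow> integrable L (h q :: real \<Rightarrow> real)"
  shows "(\<Sum>\<sigma> | \<sigma> permutes {1..k}. \<integral>x. (if ordered_on k x then \<Prod>q=1..k. h (\<sigma> q) (x q) else 0) \<partial>cube t T k) =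
    (\<Prod>q=1..k. \<integral>r. h q r \<partial>L)"
proof -
  let ?G = "\<lambda>\<sigma> x. if ordered_on k x then \<Prod>q=1..k. h (\<sigma> q) (x q) else 0"
  let ?E = "\<lambda>\<sigma> x. if \<forall>q\<in>{1..<k}. x (\<sigma> q) < x (\<sigma> (Suc q)) then \<Prod>q=1..k. h q (x q) else 0"
  have G: "integrable (cube t T k) (?G \<sigma>)" if "\<sigma> permutes {1..k}" for \<sigma>
    by (rule ordered_tensor_integrable) (use h permutes_in_image[OF that] in blast)
  have GE: "?G \<sigma> (\<lambda>q\<in>{1..k}. x (\<sigma> q)) = ?E \<sigma> x" if \<sigma>: "\<sigma> permutes {1..k}" for \<sigma> x
  proof -
    have "ordered_on k (\<lambda>q\<in>{1..k}. x (\<sigma> q)) \<longleftrightarrow> (\<forall>q\<in>{1..<k}. x (\<sigma> q) < x (\<sigma> (Suc q)))"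
      by (auto simp: ordered_on_def)
    moreover have "(\<Prod>q=1..k. h (\<sigma> q) ((\<lambda>q\<in>{1..k}. x (\<sigma> q)) q)) = (\<Prod>q=1..k. h q (x q))"
      using prod.permute[OF \<sigma>, of "\<lambda>q. h q (x q)"] by (simp add: comp_def)
    ultimately show ?thesis by simp
  qed
  have int: "integrable (cube t T k) (?E \<sigma>)" if "\<sigma> permutes {1..k}" for \<sigma>
    using cube_permute_integrable[OF that G[OF that]] unfolding GE[OF that] .
  have eq: "(\<integral>x. ?G \<sigma> x \<partial>cube t T k) = (\<integral>x. ?E \<sigma> x \<partial>cube t T k)" if "\<sigma> permutes {1..k}" for \<sigma>
    using cube_permute_integral[OF that borel_measurable_integrable[OF G[OF that]], symmetric] unfolding GE[OF that] .
  have "(\<Sum>\<sigma> | \<sigma> permutes {1..k}. \<integral>x. ?G \<sigma> x \<partial>cube t T k) = (\<Sum>\<sigma> | \<sigma> permutes {1..k}. \<integral>x. ?E \<sigma> x \<partial>cube t T k)"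
    using eq by (intro sum.cong) auto
  also have "\<dots> = (\<integral>x. (\<Sum>\<sigma> | \<sigma> permutes {1..k}. ?E \<sigma> x) \<partial>cube t T k)"
    using int by (intro Bochner_Integration.integral_sum[symmetric]) auto
  also have "\<dots> = (\<integral>x. (\<Prod>q=1..k. h q (x q)) \<partial>cube t T k)"
  proof (rule integral_cong_AE)
    show "(\<lambda>x. \<Sum>\<sigma> | \<sigma> permutes {1..k}. ?E \<sigma> x) \<in> borel_measurable (cube t T k)"
      using int by (intro borel_measurable_sum) auto
    show "(\<lambda>x. \<Prod>q=1..k. h q (x q)) \<in> borel_measurable (cube t T k)"
      by (rule cube_prod_measurable) (use h in auto)
    show "AE x in cube t T k. (\<Sum>\<sigma> | \<sigma> permutes {1..k}. ?E \<sigma> x) = (\<Prod>q=1..k. h q (x q))"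
      using AE_cube_inj by eventually_elim (rule sum_sorting_permutations)
  qed
  also have "\<dots> = (\<Prod>q=1..k. \<integral>r. h q r \<partial>L)" by (rule C.product_integral_prod) (use h in auto)
  finally show ?thesis .
qed


section \<open>Iterated integrals over the simplex\<close>

lemma ordered_tensor_split:
  fixes h :: "nat \<Rightarrow> real \<Rightarrow> real"
  assumes "x \<in> space (cube t T k)"
  shows "(if ordered_on (Suc k) (x(Suc k := r)) \<and> r < s then \<Prod>q=1..Suc k. h q ((x(Suc k := r)) q) else 0) =
    (if r < s then h (Suc k) r else 0) * (if ordered_on k x \<and> (1 \<le> k \<longrightarrow> x k < r) then \<Prod>q=1..k. h q (x q) else 0)"
proof -
  have "(\<Prod>q=1..k. h q ((x(Suc k := r)) q)) = (\<Prod>q=1..k. h q (x q))" by (intro prod.cong) auto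
  then have p: "(\<Prod>q=1..Suc k. h q ((x(Suc k := r)) q)) = h (Suc k) r * (\<Prod>q=1..k. h q (x q))"
    by (simp add: atLeastAtMostSuc_conv)
  \<comment> \<open>For \<open>k = 0\<close> there is no earlier variable to compare with, hence the
    guard \<open>1 \<le> k\<close>.\<close>
  have o: "ordered_on (Suc k) (x(Suc k := r)) \<longleftrightarrow> ordered_on k x \<and> (1 \<le> k \<longrightarrow> x k < r)"
  proof (cases "k = 0")
    case True
    then show ?thesis by (simp add: ordered_on_def)
  next
    case False
    then have "{1..<Suc k} = insert k {1..<k}" by auto
    then show ?thesis using False by (auto simp: ordered_on_def)
  qed
  show ?thesis unfolding o p by auto
qed

text \<open>The bound \<open>s\<close> on the last variable carries the induction, since one level
  down its place is taken by the next variable.\<close>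

lemma simplex_integral_eq:
  assumes h: "\<And>q. q \<in> {1..k} \<Longrightarrow> integrable L (h q :: real \<Rightarrow> real)"
  shows "simplex_integral h k s = (\<integral>x. (if ordered_on k x \<and> (1 \<le> k \<longrightarrow> x k < s) then \<Prod>q=1..k. h q (x q) else 0) \<partial>cube t T k)"
  using h
proof (induction k arbitrary: s)
  case 0
  interpret finite_measure "PiM {} (\<lambda>_::nat. L)" by rule (simp add: space_PiM)
  show ?case by (simp add: ordered_on_def space_PiM measure_def)
next
  case (Suc k)
  let ?H = "\<lambda>r x. if ordered_on k x \<and> (1 \<le> k \<longrightarrow> x k < r) then \<Prod>q=1..k. h q (x q) else 0"
  let ?G = "\<lambda>x. if ordered_on (Suc k) x \<and> (1 \<le> Suc k \<longrightarrow> x (Suc k) < s) then \<Prod>q=1..Suc k. h q (x q) else 0"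
  let ?C = "cube t T k"
  interpret Ck: finite_product_sigma_finite "\<lambda>_. L" "{1..k}" by standard auto
  interpret R: pair_sigma_finite ?C L ..
  have ins: "insert (Suc k) {1..k} = {1..Suc k}" by auto
  have hk: "integrable L (h q)" if "q \<in> {1..k}" for q using Suc.prems that by auto
  have hS: "integrable L (h (Suc k))" using Suc.prems by auto
  have Gm: "?G \<in> borel_measurable (cube t T (Suc k))"
  proof (rule measurable_If[OF cube_prod_measurable borel_measurable_const])
    show "h q \<in> borel_measurable L" if "q \<in> {1..Suc k}" for q using Suc.prems[OF that] by auto
    have "{x \<in> space (cube t T (Suc k)). x (Suc k) < s} \<in> sets (cube t T (Suc k))"
      by (intro borel_measurable_less cube_component) auto
    from sets.Int[OF ordered_on_measurable[of "Suc k"] this]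
    show "{x \<in> space (cube t T (Suc k)). ordered_on (Suc k) x \<and> (1 \<le> Suc k \<longrightarrow> x (Suc k) < s)} \<in> sets (cube t T (Suc k))"
      by (simp add: Int_def conj_ac cong: conj_cong)
  qed
  have Gint: "integrable (cube t T (Suc k)) ?G"
  proof (rule Bochner_Integration.integrable_bound[OF _ Gm])
    show "integrable (cube t T (Suc k)) (\<lambda>x. \<Prod>q=1..Suc k. h q (x q))"
      by (rule C.product_integrable_prod) (use Suc.prems in auto)
  qed auto
  have split: "?G (x(Suc k := r)) = (if r < s then h (Suc k) r else 0) * ?H r x" if "x \<in> space ?C" for x r
    using ordered_tensor_split[OF that, of r s h] by simp
  have pint: "integrable (?C \<Otimes>\<^sub>M L) (\<lambda>(x, r). ?G (x(Suc k := r)))"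
  proof (rule Bochner_Integration.integrable_bound)
    show "integrable (?C \<Otimes>\<^sub>M L) (\<lambda>(x, r). (\<Prod>q=1..k. h q (x q)) * h (Suc k) r)"
      by (rule R.integrable_tensor(1)[OF C.product_integrable_prod hS]) (use hk in auto)
    have "(\<lambda>(x, r). x(Suc k := r)) \<in> measurable (?C \<Otimes>\<^sub>M L) (PiM (insert (Suc k) {1..k}) (\<lambda>_. L))"
      by (rule measurable_add_dim)
    then have "(\<lambda>z. (fst z)(Suc k := snd z)) \<in> measurable (?C \<Otimes>\<^sub>M L) (cube t T (Suc k))"
      unfolding ins by (simp add: case_prod_unfold)
    from measurable_compose[OF this Gm]
    show "(\<lambda>(x, r). ?G (x(Suc k := r))) \<in> borel_measurable (?C \<Otimes>\<^sub>M L)" by (simp only: case_prod_unfold)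
    show "AE z in ?C \<Otimes>\<^sub>M L. norm (case z of (x, r) \<Rightarrow> ?G (x(Suc k := r))) \<le> norm (case z of (x, r) \<Rightarrow> (\<Prod>q=1..k. h q (x q)) * h (Suc k) r)"
    proof (rule AE_I2)
      fix z assume "z \<in> space (?C \<Otimes>\<^sub>M L)"
      then have "fst z \<in> space ?C" by (auto simp: space_pair_measure)
      then show "norm (case z of (x, r) \<Rightarrow> ?G (x(Suc k := r))) \<le> norm (case z of (x, r) \<Rightarrow> (\<Prod>q=1..k. h q (x q)) * h (Suc k) r)"
        unfolding case_prod_unfold split[OF \<open>fst z \<in> space ?C\<close>] by (auto simp: abs_mult)
    qed
  qed
  have "(\<integral>x. ?G x \<partial>cube t T (Suc k)) = (\<integral>x. (\<integral>r. ?G (x(Suc k := r)) \<partial>L) \<partial>?C)"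
    using C.product_integral_insert[of "{1..k}" "Suc k" ?G] Gint unfolding ins by simp
  \<comment> \<open>\<open>product_integral_insert\<close> puts the new variable innermost, the
    recursion has it outermost.\<close>
  also have "\<dots> = (\<integral>r. (\<integral>x. ?G (x(Suc k := r)) \<partial>?C) \<partial>L)"
    by (rule R.Fubini_integral[OF pint, symmetric])
  also have "\<dots> = (\<integral>r. indicator {t..<s} r * (h (Suc k) r * simplex_integral h k r) \<partial>L)"
  proof (rule Bochner_Integration.integral_cong[OF refl])
    fix r assume "r \<in> space L"
    then have r: "indicator {t..<s} r = (if r < s then 1 else 0 :: real)" by auto
    have IH: "simplex_integral h k r = (\<integral>x. ?H r x \<partial>?C)"
      by (rule Suc.IH) (rule hk)
    have "(\<integral>x. ?G (x(Suc k := r)) \<partial>?C) = (\<integral>x. (if r < s then h (Suc k) r else 0) * ?H r x \<partial>?C)"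
      by (rule Bochner_Integration.integral_cong[OF refl split])
    also have "\<dots> = (if r < s then h (Suc k) r else 0) * simplex_integral h k r"
      unfolding IH by (rule Bochner_Integration.integral_mult_right_zero)
    finally show "(\<integral>x. ?G (x(Suc k := r)) \<partial>?C) = indicator {t..<s} r * (h (Suc k) r * simplex_integral h k r)"
      unfolding r by simp
  qed
  finally show ?case by simp
qed

text \<open>The bound \<open>T\<close> on the last variable removes only the null set where that
  variable equals \<open>T\<close>.\<close>

lemma simplex_integral_T:
  assumes h: "\<And>q. q \<in> {1..k} \<Longrightarrow> integrable L (h q :: real \<Rightarrow> real)"
  shows "simplex_integral h k T = (\<integral>x. (if ordered_on k x then \<Prod>q=1..k. h q (x q) else 0) \<partial>cube t T k)"
proof (cases "k = 0")
  case True
  then show ?thesis using simplex_integral_eq[where k=k and s=T and h=h, OF h] by simp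
next
  case False
  have AE: "AE x in cube t T k. x k \<noteq> T"
  proof -
    let ?N = "\<lambda>x. indicator {x. x k = T} x :: real"
    \<comment> \<open>The indicator of \<open>x k = T\<close> is a tensor in which one factor has
      integral 0.\<close>
    have "(\<Prod>q=1..k. \<integral>r. (if q = k then indicator {T} r else 1 :: real) \<partial>L) = 0"
    proof (rule prod_zero)
      have "AE r in L. indicator {T} r = (0 :: real)" using AE_L_neq[of T] by eventually_elim simp
      then have "(\<integral>r. indicator {T} r \<partial>L) = (0 :: real)" by (rule integral_eq_zero_AE)
      then show "\<exists>a\<in>{1..k}. (\<integral>r. (if a = k then indicator {T} r else 1 :: real) \<partial>L) = 0"
        using False by (intro bexI[of _ k]) auto
    qed simp
    have i1: "integrable L (\<lambda>r. if q = k then indicator {T} r else 1 :: real)" for q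
    proof (cases "q = k")
      case True
      have "{T} \<in> sets L" using t by (auto simp: sets_restrict_space_iff)
      then have "integrable L (indicator {T} :: real \<Rightarrow> real)"
        by (rule integrable_real_indicator) (use L.emeasure_finite[of "{T}"] in \<open>simp add: less_top[symmetric]\<close>)
      then show ?thesis unfolding if_P[OF True] .
    qed simp
    have "(\<integral>x. (\<Prod>q=1..k. if q = k then indicator {T} (x q) else 1 :: real) \<partial>cube t T k) = 0"
      using C.product_integral_prod[of "{1..k}" "\<lambda>q r. if q = k then indicator {T} r else 1 :: real"] i1
        \<open>(\<Prod>q=1..k. \<integral>r. (if q = k then indicator {T} r else 1 :: real) \<partial>L) = 0\<close> by simp
    moreover have "(\<Prod>q=1..k. if q = k then indicator {T} (x q) else 1 :: real) = indicator {T} (x k)" for x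
      using False by (simp add: prod.delta)
    ultimately have z: "(\<integral>x. indicator {T} (x k) \<partial>cube t T k) = (0 :: real)" by simp
    have "integrable (cube t T k) (\<lambda>x. (\<Prod>q=1..k. if q = k then indicator {T} (x q) else 1 :: real))"
      by (rule C.product_integrable_prod) (use i1 in auto)
    then have "integrable (cube t T k) (\<lambda>x. indicator {T} (x k) :: real)"
      using False by (simp add: prod.delta)
    from integral_nonneg_eq_0_iff_AE[OF this] z have "AE x in cube t T k. indicator {T} (x k) = (0 :: real)" by simp
    then show ?thesis by eventually_elim (auto split: split_indicator_asm)
  qed
  have "simplex_integral h k T = (\<integral>x. (if ordered_on k x \<and> (1 \<le> k \<longrightarrow> x k < T) then \<Prod>q=1..k. h q (x q) else 0) \<partial>cube t T k)"
    by (rule simplex_integral_eq[OF h])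
  also have "\<dots> = (\<integral>x. (if ordered_on k x then \<Prod>q=1..k. h q (x q) else 0) \<partial>cube t T k)"
  proof (rule integral_cong_AE)
    show o: "(\<lambda>x. if ordered_on k x then \<Prod>q=1..k. h q (x q) else 0) \<in> borel_measurable (cube t T k)"
      by (rule borel_measurable_integrable[OF ordered_tensor_integrable[OF h]])
    have "{x \<in> space (cube t T k). x k < T} \<in> sets (cube t T k)"
      using False by (intro borel_measurable_less cube_component) auto
    from measurable_If[OF o borel_measurable_const this, of 0]
    show "(\<lambda>x. if ordered_on k x \<and> (1 \<le> k \<longrightarrow> x k < T) then \<Prod>q=1..k. h q (x q) else 0) \<in> borel_measurable (cube t T k)"
      by (rule measurable_cong[THEN iffD1, rotated]) (use False in auto)
    show "AE x in cube t T k. (if ordered_on k x \<and> (1 \<le> k \<longrightarrow> x k < T) then \<Prod>q=1..k. h q (x q) else 0) =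
       (if ordered_on k x then \<Prod>q=1..k. h q (x q) else 0)"
    proof (rule AE_mp[OF AE], intro AE_I2 impI)
      fix x assume "x \<in> space (cube t T k)" "x k \<noteq> T"
      then have "x k < T" using space_cube[of x k k] False by auto
      then show "(if ordered_on k x \<and> (1 \<le> k \<longrightarrow> x k < T) then \<Prod>q=1..k. h q (x q) else 0) =
       (if ordered_on k x then \<Prod>q=1..k. h q (x q) else 0)" by simp
    qed
  qed
  finally show ?thesis .
qed

section \<open>Symmetrized iterated integrals\<close>

definition admissible :: "nat \<Rightarrow> (nat \<Rightarrow> real \<Rightarrow> real) \<Rightarrow> (nat \<Rightarrow> nat) \<Rightarrow> bool" where
  "admissible k f i \<longleftrightarrow> (\<forall>q\<in>{1..k}. i q \<in> {1..m} \<and> square_integrable L (f q))"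

lemma admissible_permute:
  "admissible k f i \<Longrightarrow> \<sigma> permutes {1..k} \<Longrightarrow> admissible k (\<lambda>q. f (\<sigma> q)) (\<lambda>q. i (\<sigma> q))"
  unfolding admissible_def using permutes_in_image by metis

lemma iterated_ito_square_integrable:
  "admissible k f i \<Longrightarrow> s \<in> {t..T} \<Longrightarrow> square_integrable M (J f i k s)"
  unfolding admissible_def by (rule regular_processD(3)[OF iterated_ito_regular])

lemma iterated_ito_inner_T:
  assumes f: "admissible k f i" and g: "admissible k g j"
  shows "(\<integral>\<omega>. J f i k T \<omega> * J g j k T \<omega> \<partial>M) = (if \<forall>q\<in>{1..k}. i q = j q
     then \<integral>x. (if ordered_on k x then \<Prod>q=1..k. f q (x q) * g q (x q) else 0) \<partial>cube t T k else 0)"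
proof -
  have "integrable L (\<lambda>r. f q r * g q r)" if "q \<in> {1..k}" for q
    using f g that by (auto simp: admissible_def intro: square_integrable_mult_integrable)
  note s = simplex_integral_T[OF this]
  show ?thesis using iterated_ito_inner[of k i f j g T] f g t s by (simp add: admissible_def)
qed

definition symmetrized_ito :: "nat \<Rightarrow> (nat \<Rightarrow> real \<Rightarrow> real) \<Rightarrow> (nat \<Rightarrow> nat) \<Rightarrow> 'a \<Rightarrow> real" where
  "symmetrized_ito k f i \<omega> = (\<Sum>\<sigma> | \<sigma> permutes {1..k}. J (\<lambda>q. f (\<sigma> q)) (\<lambda>q. i (\<sigma> q)) k T \<omega>)"

lemma symmetrized_ito_square_integrable:
  assumes "admissible k f i"
  shows "square_integrable M (symmetrized_ito k f i)"
  unfolding symmetrized_ito_def[abs_def]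
proof (rule square_integrable_sum)
  fix \<sigma> assume "\<sigma> \<in> {\<sigma>. \<sigma> permutes {1..k}}"
  then show "square_integrable M (J (\<lambda>q. f (\<sigma> q)) (\<lambda>q. i (\<sigma> q)) k T)"
    using admissible_permute[OF assms] t by (intro iterated_ito_square_integrable) auto
qed

lemma iterated_symmetrized_inner:
  assumes f: "admissible k f i" and g: "admissible k g j"
  shows "(\<integral>\<omega>. J f i k T \<omega> * symmetrized_ito k g j \<omega> \<partial>M) = (\<Sum>\<sigma> | \<sigma> permutes {1..k}. if \<forall>q\<in>{1..k}. i q = j (\<sigma> q)
     then \<integral>x. (if ordered_on k x then \<Prod>q=1..k. f q (x q) * g (\<sigma> q) (x q) else 0) \<partial>cube t T k else 0)"
proof -
  have "(\<integral>\<omega>. J f i k T \<omega> * symmetrized_ito k g j \<omega> \<partial>M) =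
     (\<integral>\<omega>. (\<Sum>\<sigma> | \<sigma> permutes {1..k}. J f i k T \<omega> * J (\<lambda>q. g (\<sigma> q)) (\<lambda>q. j (\<sigma> q)) k T \<omega>) \<partial>M)"
    by (simp add: symmetrized_ito_def sum_distrib_left)
  also have "\<dots> = (\<Sum>\<sigma> | \<sigma> permutes {1..k}. \<integral>\<omega>. J f i k T \<omega> * J (\<lambda>q. g (\<sigma> q)) (\<lambda>q. j (\<sigma> q)) k T \<omega> \<partial>M)"
    using admissible_permute[OF g] f t
    by (intro Bochner_Integration.integral_sum square_integrable_mult_integrable iterated_ito_square_integrable) auto
  also have "\<dots> = (\<Sum>\<sigma> | \<sigma> permutes {1..k}. if \<forall>q\<in>{1..k}. i q = j (\<sigma> q)
     then \<integral>x. (if ordered_on k x then \<Prod>q=1..k. f q (x q) * g (\<sigma> q) (x q) else 0) \<partial>cube t T k else 0)"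
    using iterated_ito_inner_T[OF f admissible_permute[OF g]] by (intro sum.cong) auto
  finally show ?thesis .
qed

text \<open>In the double sum over \<open>\<sigma>\<close> and \<open>\<sigma>'\<close> put
  \<open>\<sigma> = \<rho> \<circ> \<sigma>'\<close>. The condition on the component indices then
  depends on \<open>\<rho>\<close> alone, and the sum over \<open>\<sigma>'\<close> reassembles the
  cube, where the integral factorizes.\<close>

lemma symmetrized_inner:
  assumes f: "admissible k f i" and g: "admissible k g i"
  shows "(\<integral>\<omega>. symmetrized_ito k f i \<omega> * symmetrized_ito k g i \<omega> \<partial>M) =
    (\<Sum>\<rho> | \<rho> permutes {1..k}. if \<forall>q\<in>{1..k}. i (\<rho> q) = i q then \<Prod>q=1..k. \<integral>r. f (\<rho> q) r * g q r \<partial>L else 0)"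
proof -
  let ?S = "{\<sigma>. \<sigma> permutes {1..k}}"
  let ?O = "\<lambda>\<sigma> \<sigma>'. \<integral>x. (if ordered_on k x then \<Prod>q=1..k. f (\<sigma> q) (x q) * g (\<sigma>' q) (x q) else 0) \<partial>cube t T k"
  let ?A = "\<lambda>\<sigma> \<sigma>'. if \<forall>q\<in>{1..k}. i (\<sigma> q) = i (\<sigma>' q) then ?O \<sigma> \<sigma>' else 0"
  have "(\<integral>\<omega>. symmetrized_ito k f i \<omega> * symmetrized_ito k g i \<omega> \<partial>M) =
     (\<integral>\<omega>. (\<Sum>\<sigma>\<in>?S. J (\<lambda>q. f (\<sigma> q)) (\<lambda>q. i (\<sigma> q)) k T \<omega> * symmetrized_ito k g i \<omega>) \<partial>M)"
    by (simp add: symmetrized_ito_def[of k f] sum_distrib_right)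
  also have "\<dots> = (\<Sum>\<sigma>\<in>?S. \<integral>\<omega>. J (\<lambda>q. f (\<sigma> q)) (\<lambda>q. i (\<sigma> q)) k T \<omega> * symmetrized_ito k g i \<omega> \<partial>M)"
    using admissible_permute[OF f] g t
    by (intro Bochner_Integration.integral_sum square_integrable_mult_integrable iterated_ito_square_integrable
      symmetrized_ito_square_integrable) auto
  also have "\<dots> = (\<Sum>\<sigma>\<in>?S. \<Sum>\<sigma>'\<in>?S. ?A \<sigma> \<sigma>')"
    using iterated_symmetrized_inner[OF admissible_permute[OF f] g] by (intro sum.cong) auto
  also have "\<dots> = (\<Sum>\<sigma>'\<in>?S. \<Sum>\<sigma>\<in>?S. ?A \<sigma> \<sigma>')" by (rule sum.swap)
  also have "\<dots> = (\<Sum>\<sigma>'\<in>?S. \<Sum>\<rho>\<in>?S. ?A (\<rho> \<circ> \<sigma>') \<sigma>')"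
  proof (rule sum.cong[OF refl])
    fix \<sigma>' assume "\<sigma>' \<in> ?S"
    then show "(\<Sum>\<sigma>\<in>?S. ?A \<sigma> \<sigma>') = (\<Sum>\<rho>\<in>?S. ?A (\<rho> \<circ> \<sigma>') \<sigma>')"
      by (intro sum_permutations_compose_right) simp
  qed
  also have "\<dots> = (\<Sum>\<rho>\<in>?S. \<Sum>\<sigma>'\<in>?S. ?A (\<rho> \<circ> \<sigma>') \<sigma>')" by (rule sum.swap)
  also have "\<dots> = (\<Sum>\<rho>\<in>?S. if \<forall>q\<in>{1..k}. i (\<rho> q) = i q then \<Prod>q=1..k. \<integral>r. f (\<rho> q) r * g q r \<partial>L else 0)"
  proof (rule sum.cong[OF refl])
    fix \<rho> assume "\<rho> \<in> ?S"
    then have \<rho>: "\<rho> permutes {1..k}" by simp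
    have iff: "(\<forall>q\<in>{1..k}. i ((\<rho> \<circ> \<sigma>') q) = i (\<sigma>' q)) \<longleftrightarrow> (\<forall>q\<in>{1..k}. i (\<rho> q) = i q)" if "\<sigma>' \<in> ?S" for \<sigma>'
    proof -
      have "(\<forall>q\<in>\<sigma>' ` {1..k}. i (\<rho> q) = i q) \<longleftrightarrow> (\<forall>q\<in>{1..k}. i (\<rho> q) = i q)"
        using permutes_image[of \<sigma>' "{1..k}"] that by simp
      then show ?thesis by simp
    qed
    have int: "integrable L (\<lambda>r. f (\<rho> q) r * g q r)" if "q \<in> {1..k}" for q
      using admissible_permute[OF f \<rho>] g that by (auto simp: admissible_def intro: square_integrable_mult_integrable)
    have "(\<Sum>\<sigma>'\<in>?S. ?A (\<rho> \<circ> \<sigma>') \<sigma>') = (\<Sum>\<sigma>'\<in>?S. if \<forall>q\<in>{1..k}. i (\<rho> q) = i q then ?O (\<rho> \<circ> \<sigma>') \<sigma>' else 0)"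
      using iff by (intro sum.cong refl if_cong) auto
    also have "\<dots> = (if \<forall>q\<in>{1..k}. i (\<rho> q) = i q then \<Sum>\<sigma>'\<in>?S. ?O (\<rho> \<circ> \<sigma>') \<sigma>' else 0)"
    proof (cases "\<forall>q\<in>{1..k}. i (\<rho> q) = i q")
      case True
      show ?thesis unfolding if_P[OF True] ..
    next
      case False
      show ?thesis unfolding if_not_P[OF False] by (rule sum.neutral_const)
    qed
    also have "(\<Sum>\<sigma>'\<in>?S. ?O (\<rho> \<circ> \<sigma>') \<sigma>') = (\<Prod>q=1..k. \<integral>r. f (\<rho> q) r * g q r \<partial>L)"
      unfolding comp_apply by (rule sum_permutations_ordered_integral) (rule int)
    finally show "(\<Sum>\<sigma>'\<in>?S. ?A (\<rho> \<circ> \<sigma>') \<sigma>') = (if \<forall>q\<in>{1..k}. i (\<rho> q) = i q then \<Prod>q=1..k. \<integral>r. f (\<rho> q) r * g q r \<partial>L else 0)" .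
  qed
  finally show ?thesis .
qed


subsection \<open>Multiple Wiener integrals\<close>

lemma tensor_square_integrable:
  assumes f: "\<And>q. q \<in> {1..k} \<Longrightarrow> square_integrable L (f q :: real \<Rightarrow> real)"
  shows "square_integrable (cube t T k) (\<lambda>x. \<Prod>q=1..k. f q (x q))"
proof -
  have "integrable (cube t T k) (\<lambda>x. \<Prod>q=1..k. (f q (x q))\<^sup>2)"
    by (rule C.product_integrable_prod) (use f square_integrableD(2) in auto)
  then have "integrable (cube t T k) (\<lambda>x. (\<Prod>q=1..k. f q (x q))\<^sup>2)" by (simp add: prod_power_distrib)
  moreover have "(\<lambda>x. \<Prod>q=1..k. f q (x q)) \<in> borel_measurable (cube t T k)"
    by (rule cube_prod_measurable) (use f square_integrableD(1) in auto)
  ultimately show ?thesis by (simp add: square_integrable_def)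
qed

lemma tensor_inner:
  assumes f: "\<And>q. q \<in> {1..k} \<Longrightarrow> square_integrable L (f q :: real \<Rightarrow> real)"
    and g: "\<And>q. q \<in> {1..k} \<Longrightarrow> square_integrable L (g q)"
  shows "(\<integral>x. (\<Prod>q=1..k. f q (x q)) * (\<Prod>q=1..k. g q (x q)) \<partial>cube t T k) = (\<Prod>q=1..k. \<integral>r. f q r * g q r \<partial>L)"
proof -
  have "(\<integral>x. (\<Prod>q=1..k. f q (x q) * g q (x q)) \<partial>cube t T k) = (\<Prod>q=1..k. \<integral>r. f q r * g q r \<partial>L)"
    by (rule C.product_integral_prod[OF finite_atLeastAtMost]) (rule square_integrable_mult_integrable[OF f g]; assumption)
  then show ?thesis by (simp add: prod.distrib)
qed

lemma cube_permute_square_integrable: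
  assumes \<sigma>: "\<sigma> permutes {1..k}" and U: "square_integrable (cube t T k) U"
  shows "square_integrable (cube t T k) (\<lambda>x. U (\<lambda>q\<in>{1..k}. x (\<sigma> q)))"
    "(\<integral>x. (U (\<lambda>q\<in>{1..k}. x (\<sigma> q)))\<^sup>2 \<partial>cube t T k) = (\<integral>x. (U x)\<^sup>2 \<partial>cube t T k)"
proof -
  have "(\<lambda>x. U (\<lambda>q\<in>{1..k}. x (\<sigma> q))) \<in> borel_measurable (cube t T k)"
    using measurable_compose[OF cube_permute_measurable[OF \<sigma>] square_integrableD(1)[OF U]] .
  then show "square_integrable (cube t T k) (\<lambda>x. U (\<lambda>q\<in>{1..k}. x (\<sigma> q)))"
    using cube_permute_integrable[OF \<sigma> square_integrableD(2)[OF U]] by (simp add: square_integrable_def)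
  show "(\<integral>x. (U (\<lambda>q\<in>{1..k}. x (\<sigma> q)))\<^sup>2 \<partial>cube t T k) = (\<integral>x. (U x)\<^sup>2 \<partial>cube t T k)"
    by (rule cube_permute_integral[OF \<sigma>]) (use square_integrableD(2)[OF U] in auto)
qed

text \<open>For linear combinations of tensors, because the difference of a step function and a
  tensor is of that kind. For fixed \<open>\<rho>\<close> the quadratic form is the inner product of
  \<open>U\<close> with \<open>U\<close> in permuted coordinates, hence at most the squared norm;
  permutations that change the component indices contribute 0.\<close>

lemma symmetrized_ito_norm_bound:
  fixes A :: "'b set" and \<alpha> :: "'b \<Rightarrow> real"
  assumes A: "finite A" and f: "\<And>a. a \<in> A \<Longrightarrow> admissible k (f a) i"
  shows "(\<integral>\<omega>. (\<Sum>a\<in>A. \<alpha> a * symmetrized_ito k (f a) i \<omega>)\<^sup>2 \<partial>M) \<le>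
    fact k * (\<integral>x. (\<Sum>a\<in>A. \<alpha> a * (\<Prod>q=1..k. f a q (x q)))\<^sup>2 \<partial>cube t T k)"
proof -
  let ?S = "\<lambda>a. symmetrized_ito k (f a) i" and ?P = "{\<rho>. \<rho> permutes {1..k}}"
  let ?T = "\<lambda>a x. \<Prod>q=1..k. f a q (x q)"
  define U where "U x = (\<Sum>a\<in>A. \<alpha> a * ?T a x)" for x
  have sqS: "square_integrable M (?S a)" if "a \<in> A" for a by (rule symmetrized_ito_square_integrable[OF f[OF that]])
  have fL: "square_integrable L (f a q)" if "a \<in> A" "q \<in> {1..k}" for a q using f[OF that(1)] that(2) by (auto simp: admissible_def)
  have sqT: "square_integrable (cube t T k) (?T a)" if "a \<in> A" for a by (rule tensor_square_integrable) (rule fL[OF that])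
  have sqU: "square_integrable (cube t T k) U"
    unfolding U_def[abs_def] using sqT by (intro square_integrable_sum square_integrable_cmult)
  have U: "(\<Sum>a\<in>A. \<Sum>b\<in>A. \<alpha> a * \<alpha> b * (\<Prod>q=1..k. \<integral>r. f a (\<rho> q) r * f b q r \<partial>L)) \<le> (\<integral>x. (U x)\<^sup>2 \<partial>cube t T k)"
    if \<rho>: "\<rho> permutes {1..k}" for \<rho>
  proof -
    have i\<rho>: "inv \<rho> permutes {1..k}" by (rule permutes_inv[OF \<rho>])
    define V where "V x = U (\<lambda>q\<in>{1..k}. x (inv \<rho> q))" for x
    \<comment> \<open>Permuting the coordinates of a tensor amounts to permuting its
      factors.\<close>
    have Ta: "?T a (\<lambda>q\<in>{1..k}. x (inv \<rho> q)) = (\<Prod>q=1..k. f a (\<rho> q) (x q))" for a x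
      using prod.permute[OF \<rho>, of "\<lambda>q. f a q (x (inv \<rho> q))"] by (simp add: comp_def permutes_inverses(2)[OF \<rho>])
    have V: "V x = (\<Sum>a\<in>A. \<alpha> a * (\<Prod>q=1..k. f a (\<rho> q) (x q)))" for x
      unfolding V_def U_def Ta ..
    note sqV = cube_permute_square_integrable[OF i\<rho> sqU, folded V_def]
    have f\<rho>: "square_integrable L (f a (\<rho> q))" if "a \<in> A" "q \<in> {1..k}" for a q
      using fL that permutes_in_image[OF \<rho>] by blast
    have sqT\<rho>: "square_integrable (cube t T k) (\<lambda>x. \<Prod>q=1..k. f a (\<rho> q) (x q))" if "a \<in> A" for a
      by (rule tensor_square_integrable) (rule f\<rho>[OF that])
    have "(\<Sum>a\<in>A. \<Sum>b\<in>A. \<alpha> a * \<alpha> b * (\<Prod>q=1..k. \<integral>r. f a (\<rho> q) r * f b q r \<partial>L)) =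
      (\<Sum>a\<in>A. \<Sum>b\<in>A. \<integral>x. \<alpha> a * \<alpha> b * ((\<Prod>q=1..k. f a (\<rho> q) (x q)) * ?T b x) \<partial>cube t T k)"
    proof (intro sum.cong refl)
      fix a b assume ab: "a \<in> A" "b \<in> A"
      have "(\<integral>x. (\<Prod>q=1..k. f a (\<rho> q) (x q)) * ?T b x \<partial>cube t T k) = (\<Prod>q=1..k. \<integral>r. f a (\<rho> q) r * f b q r \<partial>L)"
        by (rule tensor_inner) (use fL f\<rho> ab in auto)
      then show "\<alpha> a * \<alpha> b * (\<Prod>q=1..k. \<integral>r. f a (\<rho> q) r * f b q r \<partial>L) =
        (\<integral>x. \<alpha> a * \<alpha> b * ((\<Prod>q=1..k. f a (\<rho> q) (x q)) * ?T b x) \<partial>cube t T k)" by simp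
    qed
    also have "\<dots> = (\<integral>x. (\<Sum>a\<in>A. \<Sum>b\<in>A. \<alpha> a * \<alpha> b * ((\<Prod>q=1..k. f a (\<rho> q) (x q)) * ?T b x)) \<partial>cube t T k)"
      using square_integrable_mult_integrable[OF sqT\<rho> sqT]
      by (subst Bochner_Integration.integral_sum; intro Bochner_Integration.integrable_sum sum.cong refl
           Bochner_Integration.integral_sum[symmetric] integrable_mult_right) auto
    also have "\<dots> = (\<integral>x. V x * U x \<partial>cube t T k)"
      unfolding V U_def sum_product by (simp add: mult_ac)
    also have "\<dots> \<le> sqrt (\<integral>x. (V x)\<^sup>2 \<partial>cube t T k) * sqrt (\<integral>x. (U x)\<^sup>2 \<partial>cube t T k)"
      using l2_cauchy_schwarz[OF sqV(1) sqU] by linarith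
    also have "\<dots> = (\<integral>x. (U x)\<^sup>2 \<partial>cube t T k)" unfolding sqV(2) by simp
    finally show ?thesis .
  qed
  have "(\<integral>\<omega>. (\<Sum>a\<in>A. \<alpha> a * ?S a \<omega>)\<^sup>2 \<partial>M) = (\<integral>\<omega>. (\<Sum>a\<in>A. \<Sum>b\<in>A. \<alpha> a * \<alpha> b * (?S a \<omega> * ?S b \<omega>)) \<partial>M)"
    unfolding power2_eq_square sum_product by (simp add: mult_ac)
  also have "\<dots> = (\<Sum>a\<in>A. \<Sum>b\<in>A. \<alpha> a * \<alpha> b * (\<integral>\<omega>. ?S a \<omega> * ?S b \<omega> \<partial>M))"
    using square_integrable_mult_integrable[OF sqS sqS]
    by (subst Bochner_Integration.integral_sum; intro Bochner_Integration.integrable_sum sum.cong refl integrable_mult_right)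
       (auto simp: Bochner_Integration.integral_sum)
  also have "\<dots> = (\<Sum>a\<in>A. \<Sum>b\<in>A. \<Sum>\<rho>\<in>?P. if \<forall>q\<in>{1..k}. i (\<rho> q) = i q then \<alpha> a * \<alpha> b * (\<Prod>q=1..k. \<integral>r. f a (\<rho> q) r * f b q r \<partial>L) else 0)"
    using symmetrized_inner[OF f f]
    by (intro sum.cong refl) (auto simp: sum_distrib_left intro!: sum.cong)
  also have "\<dots> = (\<Sum>\<rho>\<in>?P. \<Sum>a\<in>A. \<Sum>b\<in>A. if \<forall>q\<in>{1..k}. i (\<rho> q) = i q then \<alpha> a * \<alpha> b * (\<Prod>q=1..k. \<integral>r. f a (\<rho> q) r * f b q r \<partial>L) else 0)"
    by (subst sum.swap[of _ ?P A], subst sum.swap[of _ ?P A], rule refl)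
  also have "\<dots> \<le> (\<Sum>\<rho>\<in>?P. \<integral>x. (U x)\<^sup>2 \<partial>cube t T k)"
  proof (rule sum_mono)
    fix \<rho> assume "\<rho> \<in> ?P"
    then have \<rho>: "\<rho> permutes {1..k}" by simp
    show "(\<Sum>a\<in>A. \<Sum>b\<in>A. if \<forall>q\<in>{1..k}. i (\<rho> q) = i q then \<alpha> a * \<alpha> b * (\<Prod>q=1..k. \<integral>r. f a (\<rho> q) r * f b q r \<partial>L) else 0) \<le> (\<integral>x. (U x)\<^sup>2 \<partial>cube t T k)"
    proof (cases "\<forall>q\<in>{1..k}. i (\<rho> q) = i q")
      case True
      show ?thesis unfolding if_P[OF True] by (rule U[OF \<rho>])
    next
      case False
      show ?thesis unfolding if_not_P[OF False] by simp
    qed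
  qed
  also have "\<dots> = fact k * (\<integral>x. (U x)\<^sup>2 \<partial>cube t T k)" by (simp add: card_permutations[OF refl])
  finally show ?thesis unfolding U_def .
qed

text \<open>The product of the earlier increments is the coefficient of the next elementary
  integral, so its adaptedness and square integrability travel through the induction. By the
  isometry it suffices that at each time the integrands agree almost surely.\<close>

lemma iterated_ito_ordered_indicators:
  assumes "\<forall>q\<in>{1..n}. i q \<in> {1..m} \<and> t \<le> a q \<and> a q \<le> b q \<and> b q \<le> T"
    and "\<And>p q. p \<in> {1..n} \<Longrightarrow> q \<in> {1..n} \<Longrightarrow> p < q \<Longrightarrow> b p \<le> a q"
    and "s \<in> {t..T}" "\<forall>q\<in>{1..n}. b q \<le> s"
  shows "(\<lambda>\<omega>. \<Prod>q=1..n. D (i q) (a q) (b q) \<omega>) \<in> borel_measurable (F s) \<and>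
    square_integrable M (\<lambda>\<omega>. \<Prod>q=1..n. D (i q) (a q) (b q) \<omega>) \<and>
    (AE \<omega> in M. J (\<lambda>q. indicator {a q..<b q}) i n s \<omega> = (\<Prod>q=1..n. D (i q) (a q) (b q) \<omega>))"
  using assms
proof (induction n arbitrary: s)
  case 0
  then show ?case by (simp add: square_integrable_def)
next
  case (Suc n)
  let ?c = "a (Suc n)" and ?d = "b (Suc n)" and ?j = "i (Suc n)"
  let ?ind = "\<lambda>q. indicator {a q..<b q} :: real \<Rightarrow> real"
  define \<eta> where "\<eta> \<omega> = (\<Prod>q=1..n. D (i q) (a q) (b q) \<omega>)" for \<omega>
  have cd: "t \<le> ?c" "?c \<le> ?d" "?d \<le> T" "?j \<in> {1..m}" "?d \<le> s" using Suc.prems by auto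
  \<comment> \<open>At any time from \<open>?c\<close> on all earlier intervals are over, so the
    inner integral has already reached its final value \<open>\<eta>\<close>.\<close>
  have IH: "\<eta> \<in> borel_measurable (F r) \<and> square_integrable M \<eta> \<and> (AE \<omega> in M. J ?ind i n r \<omega> = \<eta> \<omega>)"
    if r: "r \<in> {?c..T}" for r
    unfolding \<eta>_def[abs_def]
  proof (rule Suc.IH)
    show "r \<in> {t..T}" using r cd by auto
    have "b q \<le> ?c" if "q \<in> {1..n}" for q using Suc.prems(2)[of q "Suc n"] that by auto
    then show "\<forall>q\<in>{1..n}. b q \<le> r" using r by fastforce
  qed (use Suc.prems(1,2) in auto)
  have \<eta>: "\<eta> \<in> borel_measurable (F ?c)" "square_integrable M \<eta>" using IH[of ?c] cd by auto
  have prod: "(\<lambda>\<omega>. \<Prod>q=1..Suc n. D (i q) (a q) (b q) \<omega>) = (\<lambda>\<omega>. \<eta> \<omega> * D ?j ?c ?d \<omega>)"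
    by (simp add: \<eta>_def[abs_def])
  have sqind: "square_integrable L (?ind q)" if "q \<in> {1..Suc n}" for q
    using measure_lebesgue_on_Ico(1)[of t "a q" "b q" T] Suc.prems(1) that
    by (auto simp: square_integrable_def power2_eq_square simp flip: indicator_inter_arith)
  have adm: "\<forall>q\<in>{1..Suc n}. i q \<in> {1..m} \<and> square_integrable L (?ind q)" using Suc.prems(1) sqind by auto
  have sqp: "square_integrable M (\<lambda>\<omega>. \<eta> \<omega> * D ?j ?c ?d \<omega>)"
    by (rule elementary_F_square_integrable[OF cd(4,1-3) \<eta>])
  have "\<eta> \<in> borel_measurable (F s)" using F_measurable_mono[OF \<eta>(1)] cd t Suc.prems(3) by auto
  moreover have "D ?j ?c ?d \<in> borel_measurable (F s)"
    by (rule F_measurable_mono[OF D_F_measurable[OF cd(4)]]) (use cd t Suc.prems(3) in auto)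
  ultimately have pm: "(\<lambda>\<omega>. \<eta> \<omega> * D ?j ?c ?d \<omega>) \<in> borel_measurable (F s)" by (rule borel_measurable_times)
  note rel = iterated_ito_rel[OF adm Suc.prems(3)]
  have "simple_ito ?j (\<lambda>z. 0 + \<eta> (snd z) * indicator {?c..<?d} (fst z)) (\<lambda>\<omega>. 0 + \<eta> \<omega> * D ?j ?c ?d \<omega>)"
    by (rule simple_ito.add[OF simple_ito.zero cd(1-3) \<eta>])
  then have rel2: "ito_rel ?j (\<lambda>z. \<eta> (snd z) * indicator {?c..<?d} (fst z)) (\<lambda>\<omega>. \<eta> \<omega> * D ?j ?c ?d \<omega>)"
    using ito_rel_simple[OF _ cd(4)] by simp
  let ?f = "\<lambda>z. indicator {t..<s} (fst z) * (?ind (Suc n) (fst z) * J ?ind i n (fst z) (snd z)) - \<eta> (snd z) * indicator {?c..<?d} (fst z)"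
  have Y: "regular_process (J ?ind i n)" by (rule iterated_ito_regular) (use adm in auto)
  have "(\<integral>\<omega>. (J ?ind i (Suc n) s \<omega> - \<eta> \<omega> * D ?j ?c ?d \<omega>)\<^sup>2 \<partial>M) = (\<integral>z. (?f z)\<^sup>2 \<partial>P)"
    by (rule ito_rel_dist[OF rel rel2 cd(4)])
  also have "\<dots> \<le> (\<integral>r. 0 \<partial>L)"
  proof (rule P.square_integrable_fiber_bound(2))
    show "?f \<in> borel_measurable P"
      by (rule square_integrableD(1)[OF square_integrable_diff[OF ito_rel_square_integrable(1)[OF rel] ito_rel_square_integrable(1)[OF rel2]]])
    fix r assume "r \<in> space L"
    then have r: "r \<in> {t..T}" by simp
    have eq: "?f (r, \<omega>) = indicator {?c..<?d} r * (J ?ind i n r \<omega> - \<eta> \<omega>)" for \<omega>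
      using cd by (auto split: split_indicator)
    have sqd: "square_integrable M (\<lambda>\<omega>. J ?ind i n r \<omega> - \<eta> \<omega>)"
      by (rule square_integrable_diff[OF regular_processD(3)[OF Y r] \<eta>(2)])
    show "square_integrable M (\<lambda>\<omega>. ?f (r, \<omega>))" unfolding eq by (rule square_integrable_cmult[OF sqd])
    show "(\<integral>\<omega>. (?f (r, \<omega>))\<^sup>2 \<partial>M) \<le> 0"
    proof (cases "r \<in> {?c..<?d}")
      case True
      then have "AE \<omega> in M. J ?ind i n r \<omega> = \<eta> \<omega>" using IH[of r] r by auto
      then have "AE \<omega> in M. (?f (r, \<omega>))\<^sup>2 = 0" unfolding eq by eventually_elim simp
      then have "(\<integral>\<omega>. (?f (r, \<omega>))\<^sup>2 \<partial>M) = 0" by (rule integral_eq_zero_AE)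
      then show ?thesis by (rule eq_refl)
    next
      case False
      then show ?thesis unfolding eq by simp
    qed
  qed simp
  finally have le: "(\<integral>\<omega>. (J ?ind i (Suc n) s \<omega> - \<eta> \<omega> * D ?j ?c ?d \<omega>)\<^sup>2 \<partial>M) \<le> 0" by simp
  have "0 \<le> (\<integral>\<omega>. (J ?ind i (Suc n) s \<omega> - \<eta> \<omega> * D ?j ?c ?d \<omega>)\<^sup>2 \<partial>M)" by simp
  with le have z: "(\<integral>\<omega>. (J ?ind i (Suc n) s \<omega> - \<eta> \<omega> * D ?j ?c ?d \<omega>)\<^sup>2 \<partial>M) = 0" by (rule antisym)
  have "AE \<omega> in M. J ?ind i (Suc n) s \<omega> - \<eta> \<omega> * D ?j ?c ?d \<omega> = 0"
    by (rule l2_zero_AE[OF square_integrable_diff[OF ito_rel_square_integrable(2)[OF rel] sqp] z])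
  then have "AE \<omega> in M. J ?ind i (Suc n) s \<omega> = \<eta> \<omega> * D ?j ?c ?d \<omega>" by eventually_elim simp
  then show ?case unfolding prod using pm sqp by (simp add: \<eta>_def)
qed

section \<open>Cells of a partition\<close>

definition cell_indicator :: "(nat \<Rightarrow> real) \<Rightarrow> (nat \<Rightarrow> nat) \<Rightarrow> nat \<Rightarrow> real \<Rightarrow> real" where
  "cell_indicator \<tau> l q = indicator {\<tau> (l q)..<\<tau> (Suc (l q))}"

lemma cell_admissible:
  assumes ip: "interval_partition t T N \<tau>" and l: "\<And>q. q \<in> {1..k} \<Longrightarrow> l q < N" and i: "\<forall>q\<in>{1..k}. i q \<in> {1..m}"
  shows "admissible k (cell_indicator \<tau> l) i"
  unfolding admissible_def
proof (intro ballI conjI)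
  fix q assume q: "q \<in> {1..k}"
  then show "i q \<in> {1..m}" using i by blast
  have b: "t \<le> \<tau> (l q)" "\<tau> (Suc (l q)) \<le> T" using interval_partition_bounds[OF ip l[OF q]] by auto
  have "(\<lambda>r. (indicator {\<tau> (l q)..<\<tau> (Suc (l q))} r)\<^sup>2) = (indicator {\<tau> (l q)..<\<tau> (Suc (l q))} :: real \<Rightarrow> real)"
    by (auto simp: fun_eq_iff split: split_indicator)
  then show "square_integrable L (cell_indicator \<tau> l q)"
    using measure_lebesgue_on_Ico(1)[OF b] borel_measurable_integrable[OF measure_lebesgue_on_Ico(1)[OF b]]
    by (simp add: square_integrable_def cell_indicator_def)
qed

text \<open>The product of the indicators of cells in the wrong order vanishes on the ordered
  simplex, so the isometry gives norm 0.\<close>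

lemma iterated_ito_unordered_cells:
  assumes ip: "interval_partition t T N \<tau>" and l: "\<And>q. q \<in> {1..k} \<Longrightarrow> l q < N" and i: "\<forall>q\<in>{1..k}. i q \<in> {1..m}"
    and uns: "\<not> (\<forall>q\<in>{1..<k}. l q < l (Suc q))" and inj: "inj_on l {1..k}"
  shows "AE \<omega> in M. J (cell_indicator \<tau> l) i k T \<omega> = 0"
proof -
  have adm: "admissible k (cell_indicator \<tau> l) i" by (rule cell_admissible[OF ip l i])
  obtain q where q: "q \<in> {1..<k}" "\<not> l q < l (Suc q)" using uns by blast
  \<comment> \<open>For equal cells the ordered integral need not vanish, so injectivity matters
    here.\<close>
  have "l (Suc q) \<noteq> l q" using inj_onD[OF inj, of "Suc q" q] q by auto
  then have "Suc (l (Suc q)) \<le> l q" using q by simp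
  then have le: "\<tau> (Suc (l (Suc q))) \<le> \<tau> (l q)" using interval_partition_mono[OF ip] l[of q] q by auto
  have zero: "(if ordered_on k x then \<Prod>q=1..k. cell_indicator \<tau> l q (x q) * cell_indicator \<tau> l q (x q) else 0) = 0" for x
  proof (rule ccontr)
    assume "\<not> ?thesis"
    then have o: "ordered_on k x" and p: "(\<Prod>q=1..k. cell_indicator \<tau> l q (x q) * cell_indicator \<tau> l q (x q)) \<noteq> 0"
      by (auto split: if_splits)
    have "cell_indicator \<tau> l q' (x q') \<noteq> 0" if "q' \<in> {1..k}" for q' using p that by auto
    then have mem: "x q' \<in> {\<tau> (l q')..<\<tau> (Suc (l q'))}" if "q' \<in> {1..k}" for q'
      using that unfolding cell_indicator_def by (metis indicator_simps(2))
    have "q \<in> {1..k}" "Suc q \<in> {1..k}" using q by auto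
    note mem[OF this(1)] mem[OF this(2)]
    moreover have "x q < x (Suc q)" using o q by (auto simp: ordered_on_def)
    ultimately show False using le by auto
  qed
  have "(\<integral>\<omega>. J (cell_indicator \<tau> l) i k T \<omega> * J (cell_indicator \<tau> l) i k T \<omega> \<partial>M) = 0"
    unfolding iterated_ito_inner_T[OF adm adm] zero by simp
  then have "(\<integral>\<omega>. (J (cell_indicator \<tau> l) i k T \<omega>)\<^sup>2 \<partial>M) = 0" by (simp add: power2_eq_square)
  then show ?thesis using t by (intro l2_zero_AE iterated_ito_square_integrable[OF adm]) auto
qed

lemma iterated_ito_ordered_cells:
  assumes ip: "interval_partition t T N \<tau>" and l: "\<And>q. q \<in> {1..k} \<Longrightarrow> l q < N" and i: "\<forall>q\<in>{1..k}. i q \<in> {1..m}"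
    and sorted: "\<forall>q\<in>{1..<k}. l q < l (Suc q)"
  shows "AE \<omega> in M. J (cell_indicator \<tau> l) i k T \<omega> = (\<Prod>q=1..k. D (i q) (\<tau> (l q)) (\<tau> (Suc (l q))) \<omega>)"
proof -
  have ci: "cell_indicator \<tau> l = (\<lambda>q. indicator {\<tau> (l q)..<\<tau> (Suc (l q))})" by (simp add: fun_eq_iff cell_indicator_def)
  have b: "t \<le> \<tau> (l q)" "\<tau> (l q) < \<tau> (Suc (l q))" "\<tau> (Suc (l q)) \<le> T" if "q \<in> {1..k}" for q
    using interval_partition_bounds[OF ip l[OF that]] by auto
  have ord: "\<tau> (Suc (l p)) \<le> \<tau> (l q)" if "p \<in> {1..k}" "q \<in> {1..k}" "p < q" for p q
  proof -
    have "l p < l q" using chain_less[OF sorted, of p q] that by auto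
    then show ?thesis using interval_partition_mono[OF ip, of "Suc (l p)" "l q"] l[OF that(2)] by auto
  qed
  have "(\<lambda>\<omega>. \<Prod>q=1..k. D (i q) (\<tau> (l q)) (\<tau> (Suc (l q))) \<omega>) \<in> borel_measurable (F T) \<and>
    square_integrable M (\<lambda>\<omega>. \<Prod>q=1..k. D (i q) (\<tau> (l q)) (\<tau> (Suc (l q))) \<omega>) \<and>
    (AE \<omega> in M. J (\<lambda>q. indicator {\<tau> (l q)..<\<tau> (Suc (l q))}) i k T \<omega> = (\<Prod>q=1..k. D (i q) (\<tau> (l q)) (\<tau> (Suc (l q))) \<omega>))"
  proof (rule iterated_ito_ordered_indicators)
    show "\<forall>q\<in>{1..k}. i q \<in> {1..m} \<and> t \<le> \<tau> (l q) \<and> \<tau> (l q) \<le> \<tau> (Suc (l q)) \<and> \<tau> (Suc (l q)) \<le> T"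
    proof
      fix q assume "q \<in> {1..k}"
      then show "i q \<in> {1..m} \<and> t \<le> \<tau> (l q) \<and> \<tau> (l q) \<le> \<tau> (Suc (l q)) \<and> \<tau> (Suc (l q)) \<le> T"
        using b[of q] i by (auto intro: less_imp_le)
    qed
    show "\<forall>q\<in>{1..k}. \<tau> (Suc (l q)) \<le> T" using b(3) by blast
  qed (use ord t in auto)
  then show ?thesis unfolding ci by blast
qed

lemma symmetrized_ito_cells:
  assumes ip: "interval_partition t T N \<tau>" and l: "\<And>q. q \<in> {1..k} \<Longrightarrow> l q < N" and i: "\<forall>q\<in>{1..k}. i q \<in> {1..m}"
    and inj: "inj_on l {1..k}"
  shows "AE \<omega> in M. symmetrized_ito k (cell_indicator \<tau> l) i \<omega> = (\<Prod>q=1..k. D (i q) (\<tau> (l q)) (\<tau> (Suc (l q))) \<omega>)"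
proof -
  let ?S = "{\<sigma>. \<sigma> permutes {1..k}}"
  let ?s = "\<lambda>\<sigma>. \<forall>q\<in>{1..<k}. l (\<sigma> q) < l (\<sigma> (Suc q))"
  let ?p = "\<lambda>\<omega>. \<Prod>q=1..k. D (i q) (\<tau> (l q)) (\<tau> (Suc (l q))) \<omega>"
  have "AE \<omega> in M. \<forall>\<sigma>\<in>?S. J (\<lambda>q. cell_indicator \<tau> l (\<sigma> q)) (\<lambda>q. i (\<sigma> q)) k T \<omega> = (if ?s \<sigma> then ?p \<omega> else 0)"
  proof (rule AE_finite_allI)
    show "finite ?S" by (simp add: finite_permutations)
    fix \<sigma> assume "\<sigma> \<in> ?S"
    then have \<sigma>: "\<sigma> permutes {1..k}" by simp
    have ci: "(\<lambda>q. cell_indicator \<tau> l (\<sigma> q)) = cell_indicator \<tau> (\<lambda>q. l (\<sigma> q))" by (simp add: fun_eq_iff cell_indicator_def)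
    have in1: "\<sigma> q \<in> {1..k}" if "q \<in> {1..k}" for q using that unfolding permutes_in_image[OF \<sigma>] .
    have l': "l (\<sigma> q) < N" if "q \<in> {1..k}" for q by (rule l[OF in1[OF that]])
    have i': "\<forall>q\<in>{1..k}. i (\<sigma> q) \<in> {1..m}" using i in1 by blast
    have inj': "inj_on (\<lambda>q. l (\<sigma> q)) {1..k}"
      using comp_inj_on[OF inj_on_subset[OF permutes_inj[OF \<sigma>] subset_UNIV, of "{1..k}"], of l] inj
      unfolding permutes_image[OF \<sigma>] by (simp add: comp_def)
    have p: "?p \<omega> = (\<Prod>q=1..k. D (i (\<sigma> q)) (\<tau> (l (\<sigma> q))) (\<tau> (Suc (l (\<sigma> q)))) \<omega>)" for \<omega>
      using prod.permute[OF \<sigma>, of "\<lambda>q. D (i q) (\<tau> (l q)) (\<tau> (Suc (l q))) \<omega>"] by (simp add: comp_def)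
    show "AE \<omega> in M. J (\<lambda>q. cell_indicator \<tau> l (\<sigma> q)) (\<lambda>q. i (\<sigma> q)) k T \<omega> = (if ?s \<sigma> then ?p \<omega> else 0)"
    proof (cases "?s \<sigma>")
      case True
      show ?thesis unfolding if_P[OF True] ci p by (rule iterated_ito_ordered_cells[OF ip l' i' True])
    next
      case False
      show ?thesis unfolding if_not_P[OF False] ci by (rule iterated_ito_unordered_cells[OF ip l' i' False inj'])
    qed
  qed
  then show ?thesis
  proof eventually_elim
    case (elim \<omega>)
    then have "symmetrized_ito k (cell_indicator \<tau> l) i \<omega> = (\<Sum>\<sigma>\<in>?S. if ?s \<sigma> then ?p \<omega> else 0)"
      unfolding symmetrized_ito_def by (intro sum.cong refl) blast
    also have "\<dots> = ?p \<omega>" by (rule sum_sorting_permutations[OF inj])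
    finally show ?case .
  qed
qed


lemma step_wiener_symmetrized:
  assumes ip: "interval_partition t T N \<tau>" and i: "\<forall>q\<in>{1..k}. i q \<in> {1..m}"
    and a: "\<forall>l\<in>{1..k} \<rightarrow>\<^sub>E {..<N}. \<not> inj_on l {1..k} \<longrightarrow> a l = 0"
  shows "AE \<omega> in M. step_wiener_integral W i k N \<tau> a \<omega> =
    (\<Sum>l\<in>{1..k} \<rightarrow>\<^sub>E {..<N}. a l * symmetrized_ito k (cell_indicator \<tau> l) i \<omega>)"
proof -
  let ?\<Lambda> = "{1..k} \<rightarrow>\<^sub>E {..<N}"
  have "AE \<omega> in M. \<forall>l\<in>?\<Lambda>. a l * (\<Prod>q=1..k. W (i q) (\<tau> (Suc (l q))) \<omega> - W (i q) (\<tau> (l q)) \<omega>) =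
    a l * symmetrized_ito k (cell_indicator \<tau> l) i \<omega>"
  proof (rule AE_finite_allI)
    show "finite ?\<Lambda>" by (intro finite_PiE) auto
    fix l assume l: "l \<in> ?\<Lambda>"
    show "AE \<omega> in M. a l * (\<Prod>q=1..k. W (i q) (\<tau> (Suc (l q))) \<omega> - W (i q) (\<tau> (l q)) \<omega>) =
      a l * symmetrized_ito k (cell_indicator \<tau> l) i \<omega>"
    proof (cases "inj_on l {1..k}")
      case True
      have "AE \<omega> in M. symmetrized_ito k (cell_indicator \<tau> l) i \<omega> = (\<Prod>q=1..k. D (i q) (\<tau> (l q)) (\<tau> (Suc (l q))) \<omega>)"
        by (rule symmetrized_ito_cells[OF ip _ i True]) (use l in auto)
      then show ?thesis by eventually_elim simp
    next
      case False
      \<comment> \<open>On diagonal cells the product of increments is in general not the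
        symmetrized integral, but there the coefficient is 0.\<close>
      then have "a l = 0" using a l by blast
      then show ?thesis by simp
    qed
  qed
  then show ?thesis
    by eventually_elim (auto simp: step_wiener_integral_def intro!: sum.cong)
qed

lemma cell_indicator_tensor:
  "step_function k N \<tau> a x = (\<Sum>l\<in>{1..k} \<rightarrow>\<^sub>E {..<N}. a l * (\<Prod>q=1..k. cell_indicator \<tau> l q (x q)))"
  by (simp add: step_function_def cell_indicator_def)

lemma step_function_square_integrable:
  assumes ip: "interval_partition t T N \<tau>" and i: "\<forall>q\<in>{1..k}. i q \<in> {1..m}"
  shows "square_integrable (cube t T k) (step_function k N \<tau> a)"
  unfolding cell_indicator_tensor[abs_def]
proof (intro square_integrable_sum square_integrable_cmult tensor_square_integrable)
  fix l q assume "l \<in> {1..k} \<rightarrow>\<^sub>E {..<N}" and q: "q \<in> {1..k}"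
  then have "l q < N" if "q \<in> {1..k}" for q using that by auto
  from cell_admissible[OF ip this i] show "square_integrable L (cell_indicator \<tau> l q)"
    using q by (simp add: admissible_def)
qed

lemma step_wiener_square_integrable:
  assumes ip: "interval_partition t T N \<tau>" and i: "\<forall>q\<in>{1..k}. i q \<in> {1..m}"
    and a: "\<forall>l\<in>{1..k} \<rightarrow>\<^sub>E {..<N}. \<not> inj_on l {1..k} \<longrightarrow> a l = 0"
  shows "square_integrable M (step_wiener_integral W i k N \<tau> a)"
proof (rule square_integrable_cong_AE)
  show "square_integrable M (\<lambda>\<omega>. \<Sum>l\<in>{1..k} \<rightarrow>\<^sub>E {..<N}. a l * symmetrized_ito k (cell_indicator \<tau> l) i \<omega>)"
  proof (intro square_integrable_sum square_integrable_cmult symmetrized_ito_square_integrable)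
    fix l assume "l \<in> {1..k} \<rightarrow>\<^sub>E {..<N}"
    then have "l q < N" if "q \<in> {1..k}" for q using that by auto
    from cell_admissible[OF ip this i] show "admissible k (cell_indicator \<tau> l) i" .
  qed
  show "step_wiener_integral W i k N \<tau> a \<in> borel_measurable M"
    unfolding step_wiener_integral_def[abs_def]
  proof (intro borel_measurable_sum borel_measurable_times borel_measurable_const borel_measurable_prod)
    fix l q assume l: "l \<in> {1..k} \<rightarrow>\<^sub>E {..<N}" and q: "q \<in> {1..k}"
    then have "l q < N" by auto
    from interval_partition_bounds[OF ip this]
    show "(\<lambda>\<omega>. W (i q) (\<tau> (Suc (l q))) \<omega> - W (i q) (\<tau> (l q)) \<omega>) \<in> borel_measurable M"
      using i q t by (intro borel_measurable_diff W_measurable) auto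
  qed
  show "AE \<omega> in M. (\<Sum>l\<in>{1..k} \<rightarrow>\<^sub>E {..<N}. a l * symmetrized_ito k (cell_indicator \<tau> l) i \<omega>) = step_wiener_integral W i k N \<tau> a \<omega>"
    using step_wiener_symmetrized[OF ip i a] by eventually_elim simp
qed

lemma step_wiener_dist:
  assumes ip: "interval_partition t T N \<tau>" and f: "admissible k f i"
    and a: "\<forall>l\<in>{1..k} \<rightarrow>\<^sub>E {..<N}. \<not> inj_on l {1..k} \<longrightarrow> a l = 0"
  shows "(\<integral>\<omega>. (step_wiener_integral W i k N \<tau> a \<omega> - symmetrized_ito k f i \<omega>)\<^sup>2 \<partial>M) \<le>
    fact k * (\<integral>x. (step_function k N \<tau> a x - (\<Prod>q=1..k. f q (x q)))\<^sup>2 \<partial>cube t T k)"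
proof -
  let ?\<Lambda> = "{1..k} \<rightarrow>\<^sub>E {..<N}"
  have i: "\<forall>q\<in>{1..k}. i q \<in> {1..m}" using f by (simp add: admissible_def)
  have fin: "finite ?\<Lambda>" by (intro finite_PiE) auto
  \<comment> \<open>The tensor of \<open>f\<close> is adjoined as the index \<open>None\<close> with
    coefficient \<open>-1\<close>, so that the norm bound applies to the difference.\<close>
  define A where "A = insert None (Some ` ?\<Lambda>)"
  define \<alpha> where "\<alpha> = case_option (-1) a"
  define g where "g = case_option f (cell_indicator \<tau>)"
  have sumA: "(\<Sum>b\<in>A. \<alpha> b * h (g b)) = (\<Sum>l\<in>?\<Lambda>. a l * h (cell_indicator \<tau> l)) - h f" for h :: "(nat \<Rightarrow> real \<Rightarrow> real) \<Rightarrow> real"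
    unfolding A_def using fin by (subst sum.insert) (auto simp: sum.reindex \<alpha>_def g_def)
  have adm: "admissible k (g b) i" if "b \<in> A" for b
  proof (cases b)
    case None
    then show ?thesis using f by (simp add: g_def)
  next
    case (Some l)
    then have "l q < N" if "q \<in> {1..k}" for q using \<open>b \<in> A\<close> that by (auto simp: A_def)
    from cell_admissible[OF ip this i] Some show ?thesis by (simp add: g_def)
  qed
  have "finite A" using fin by (simp add: A_def)
  note bound = symmetrized_ito_norm_bound[OF this adm, where \<alpha>=\<alpha>]
  have 1: "(\<Sum>b\<in>A. \<alpha> b * symmetrized_ito k (g b) i \<omega>) =
    (\<Sum>l\<in>?\<Lambda>. a l * symmetrized_ito k (cell_indicator \<tau> l) i \<omega>) - symmetrized_ito k f i \<omega>" for \<omega>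
    by (rule sumA[of "\<lambda>f. symmetrized_ito k f i \<omega>"])
  have 2: "(\<Sum>b\<in>A. \<alpha> b * (\<Prod>q=1..k. g b q (x q))) = step_function k N \<tau> a x - (\<Prod>q=1..k. f q (x q))" for x
    unfolding cell_indicator_tensor by (rule sumA[of "\<lambda>f. \<Prod>q=1..k. f q (x q)"])
  have sqS: "square_integrable M (\<lambda>\<omega>. step_wiener_integral W i k N \<tau> a \<omega> - symmetrized_ito k f i \<omega>)"
    by (intro square_integrable_diff step_wiener_square_integrable[OF ip i a] symmetrized_ito_square_integrable[OF f])
  have sqA: "square_integrable M (\<lambda>\<omega>. \<Sum>b\<in>A. \<alpha> b * symmetrized_ito k (g b) i \<omega>)"
    by (intro square_integrable_sum square_integrable_cmult symmetrized_ito_square_integrable adm)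
  have "(\<integral>\<omega>. (step_wiener_integral W i k N \<tau> a \<omega> - symmetrized_ito k f i \<omega>)\<^sup>2 \<partial>M) =
     (\<integral>\<omega>. (\<Sum>b\<in>A. \<alpha> b * symmetrized_ito k (g b) i \<omega>)\<^sup>2 \<partial>M)"
  proof (rule integral_cong_AE)
    show "AE \<omega> in M. (step_wiener_integral W i k N \<tau> a \<omega> - symmetrized_ito k f i \<omega>)\<^sup>2 = (\<Sum>b\<in>A. \<alpha> b * symmetrized_ito k (g b) i \<omega>)\<^sup>2"
      using step_wiener_symmetrized[OF ip i a] by eventually_elim (simp add: 1)
  qed (use square_integrableD(2)[OF sqS] square_integrableD(2)[OF sqA] in auto)
  also have "\<dots> \<le> fact k * (\<integral>x. (\<Sum>b\<in>A. \<alpha> b * (\<Prod>q=1..k. g b q (x q)))\<^sup>2 \<partial>cube t T k)" by (rule bound)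
  finally show ?thesis unfolding 2 .
qed

text \<open>Serves twice: with uniform partitions it gives existence, with the sequence behind an
  arbitrary witness it gives uniqueness.\<close>

lemma step_wiener_l2_tendsto:
  assumes f: "admissible k f i" and \<tau>: "refining_partitions t T \<tau>"
    and a: "\<forall>N. \<forall>l\<in>{1..k} \<rightarrow>\<^sub>E {..<N}. \<not> inj_on l {1..k} \<longrightarrow> a N l = 0"
    and l: "l2_tendsto (cube t T k) (\<lambda>N. step_function k N (\<tau> N) (a N)) (\<lambda>x. \<Prod>q=1..k. f q (x q))"
    and sq: "\<And>N. square_integrable M (step_wiener_integral W i k N (\<tau> N) (a N))"
  shows "l2_tendsto M (\<lambda>N. step_wiener_integral W i k N (\<tau> N) (a N)) (symmetrized_ito k f i)"
proof -
  have "(\<lambda>N. \<integral>\<omega>. (step_wiener_integral W i k N (\<tau> N) (a N) \<omega> - symmetrized_ito k f i \<omega>)\<^sup>2 \<partial>M) \<longlonglongrightarrow> 0"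
  proof (rule tendsto_sandwich[OF _ _ tendsto_const])
    show "\<forall>\<^sub>F N in sequentially. (\<integral>\<omega>. (step_wiener_integral W i k N (\<tau> N) (a N) \<omega> - symmetrized_ito k f i \<omega>)\<^sup>2 \<partial>M) \<le>
      fact k * (\<integral>x. (step_function k N (\<tau> N) (a N) x - (\<Prod>q=1..k. f q (x q)))\<^sup>2 \<partial>cube t T k)"
      using eventually_gt_at_top[of 0]
    proof eventually_elim
      case (elim N)
      then have "interval_partition t T N (\<tau> N)" using \<tau> by (simp add: refining_partitions_def)
      then show ?case by (rule step_wiener_dist[OF _ f]) (use a in blast)
    qed
    show "(\<lambda>N. fact k * (\<integral>x. (step_function k N (\<tau> N) (a N) x - (\<Prod>q=1..k. f q (x q)))\<^sup>2 \<partial>cube t T k)) \<longlonglongrightarrow> 0"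
      using tendsto_mult_left[OF l2_tendstoD(3)[OF l], of "fact k"] by simp
  qed simp
  then show ?thesis using sq symmetrized_ito_square_integrable[OF f] by (simp add: l2_tendsto_def)
qed

text \<open>The witness and the symmetrized integral are limits of the same sequence.\<close>

lemma multiple_wiener_integral_unique:
  assumes f: "admissible k f i"
    and X: "has_multiple_wiener_integral M W t T k i (\<lambda>x. \<Prod>q=1..k. f q (x q)) X"
  shows "AE \<omega> in M. X \<omega> = symmetrized_ito k f i \<omega>"
proof -
  obtain \<tau> a where \<tau>: "refining_partitions t T \<tau>"
    and a: "\<forall>N. \<forall>l\<in>{1..k} \<rightarrow>\<^sub>E {..<N}. \<not> inj_on l {1..k} \<longrightarrow> a N l = 0"
    and l: "l2_tendsto (cube t T k) (\<lambda>N. step_function k N (\<tau> N) (a N)) (\<lambda>x. \<Prod>q=1..k. f q (x q))"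
    and lX: "l2_tendsto M (\<lambda>N. step_wiener_integral W i k N (\<tau> N) (a N)) X"
    using X unfolding has_multiple_wiener_integral_def by (elim exE conjE)
  show ?thesis
    by (rule l2_tendsto_unique[OF lX step_wiener_l2_tendsto[where f=f, OF f \<tau> a l l2_tendstoD(1)[OF lX]]])
qed

section \<open>Approximating tensors by off-diagonal step functions\<close>

lemma tensor_l2_tendsto:
  assumes l: "\<And>q. q \<in> {1..k} \<Longrightarrow> l2_tendsto L (\<lambda>N. g N q) (f q)"
  shows "l2_tendsto (cube t T k) (\<lambda>N x. \<Prod>q=1..k. g N q (x q)) (\<lambda>x. \<Prod>q=1..k. f q (x q))"
proof -
  let ?G = "\<lambda>N x. \<Prod>q=1..k. g N q (x q)" and ?F = "\<lambda>x. \<Prod>q=1..k. f q (x q)"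
  have sg: "square_integrable L (g N q)" if "q \<in> {1..k}" for N q using l2_tendstoD(1)[OF l[OF that]] .
  have sf: "square_integrable L (f q)" if "q \<in> {1..k}" for q using l2_tendstoD(2)[OF l[OF that]] .
  have sG: "square_integrable (cube t T k) (?G N)" for N by (rule tensor_square_integrable) (rule sg)
  have sF: "square_integrable (cube t T k) ?F" by (rule tensor_square_integrable) (rule sf)
  \<comment> \<open>Expanding the square gives three tensor inner products, each a product of
    one-dimensional ones; the first two tend to the third, so no telescoping over the factors is
    involved.\<close>
  define a b c where "a N = (\<Prod>q=1..k. \<integral>r. g N q r * g N q r \<partial>L)" and "b N = (\<Prod>q=1..k. \<integral>r. g N q r * f q r \<partial>L)"
    and "c = (\<Prod>q=1..k. \<integral>r. f q r * f q r \<partial>L)" for N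
  have eq: "(\<integral>x. (?G N x - ?F x)\<^sup>2 \<partial>cube t T k) = a N - 2 * b N + c" for N
  proof -
    have i1: "integrable (cube t T k) (\<lambda>x. ?G N x * ?G N x)" "integrable (cube t T k) (\<lambda>x. ?G N x * ?F x)"
      "integrable (cube t T k) (\<lambda>x. ?F x * ?F x)"
      by (rule square_integrable_mult_integrable; (rule sG | rule sF))+
    have "(\<integral>x. (?G N x - ?F x)\<^sup>2 \<partial>cube t T k) = (\<integral>x. ?G N x * ?G N x - 2 * (?G N x * ?F x) + ?F x * ?F x \<partial>cube t T k)"
      by (intro Bochner_Integration.integral_cong refl) (simp add: power2_eq_square algebra_simps)
    also have "\<dots> = (\<integral>x. ?G N x * ?G N x \<partial>cube t T k) - 2 * (\<integral>x. ?G N x * ?F x \<partial>cube t T k) + (\<integral>x. ?F x * ?F x \<partial>cube t T k)"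
      using i1 by (simp only: Bochner_Integration.integral_add Bochner_Integration.integral_diff integrable_mult_right
        Bochner_Integration.integrable_diff Bochner_Integration.integral_mult_right_zero)
    also have "(\<integral>x. ?G N x * ?G N x \<partial>cube t T k) = a N" unfolding a_def by (rule tensor_inner[OF sg sg])
    also have "(\<integral>x. ?G N x * ?F x \<partial>cube t T k) = b N" unfolding b_def by (rule tensor_inner[OF sg sf])
    also have "(\<integral>x. ?F x * ?F x \<partial>cube t T k) = c" unfolding c_def by (rule tensor_inner[OF sf sf])
    finally show ?thesis .
  qed
  have "a \<longlonglongrightarrow> c" unfolding a_def c_def by (intro tendsto_prod l2_tendsto_inner l)
  moreover have "b \<longlonglongrightarrow> c" unfolding b_def c_def
    by (intro tendsto_prod l2_tendsto_inner l l2_tendsto_const sf)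
  ultimately have "(\<lambda>N. a N - 2 * b N + c) \<longlonglongrightarrow> c - 2 * c + c" by (intro tendsto_intros)
  then have "(\<lambda>N. \<integral>x. (?G N x - ?F x)\<^sup>2 \<partial>cube t T k) \<longlonglongrightarrow> 0" unfolding eq by simp
  then show ?thesis using sG sF unfolding l2_tendsto_def by blast
qed

lemma step_function_cell:
  assumes ip: "interval_partition t T N \<tau>" and l: "l \<in> {1..k} \<rightarrow>\<^sub>E {..<N}"
    and x: "\<And>q. q \<in> {1..k} \<Longrightarrow> x q \<in> {\<tau> (l q)..<\<tau> (Suc (l q))}"
  shows "step_function k N \<tau> a x = a l"
proof -
  have "step_function k N \<tau> a x = (\<Sum>l'\<in>{1..k} \<rightarrow>\<^sub>E {..<N}. if l' = l then a l else 0)"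
    unfolding step_function_def
  proof (rule sum.cong[OF refl])
    fix l' assume l': "l' \<in> {1..k} \<rightarrow>\<^sub>E {..<N}"
    show "a l' * (\<Prod>q=1..k. indicator {\<tau> (l' q)..<\<tau> (Suc (l' q))} (x q)) = (if l' = l then a l else 0)"
    proof (cases "l' = l")
      case True
      have "(\<Prod>q=1..k. indicator {\<tau> (l q)..<\<tau> (Suc (l q))} (x q)) = (1::real)"
        by (rule prod.neutral) (use x in \<open>auto simp del: atLeastLessThan_iff\<close>)
      then show ?thesis using True by simp
    next
      case False
      then obtain q where q: "q \<in> {1..k}" "l' q \<noteq> l q" using l l' PiE_ext by metis
      have "x q \<notin> {\<tau> (l' q)..<\<tau> (Suc (l' q))}"
        using interval_partition_cell_unique[OF ip, of "l' q" "l q" "x q"] x[OF q(1)] q l l' by blast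
      then have "(\<Prod>q=1..k. indicator {\<tau> (l' q)..<\<tau> (Suc (l' q))} (x q)) = (0::real)"
        using q(1) by (intro prod_zero) (auto intro!: bexI[of _ q])
      then show ?thesis using False by simp
    qed
  qed
  also have "\<dots> = a l" using l by (simp add: finite_PiE)
  finally show ?thesis .
qed

text \<open>Dropping the diagonal cells changes the tensor product \<open>G\<close> of step functions only at points with
  two coordinates closer than the mesh.\<close>

lemma off_diagonal_dichotomy:
  fixes c :: "nat \<Rightarrow> nat \<Rightarrow> real" and k N :: nat and \<tau> :: "nat \<Rightarrow> real" and x :: "nat \<Rightarrow> real"
  assumes ip: "interval_partition t T N \<tau>" and mesh: "\<And>j. j < N \<Longrightarrow> \<tau> (Suc j) - \<tau> j \<le> d"
  defines "a \<equiv> \<lambda>l. if inj_on l {1..k} then \<Prod>q=1..k. c q (l q) else 0"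
  defines "G \<equiv> \<lambda>x. \<Prod>q=1..k. \<Sum>j<N. c q j * indicator {\<tau> j..<\<tau> (Suc j)} (x q)"
  shows "step_function k N \<tau> a x = G x \<or>
    (step_function k N \<tau> a x = 0 \<and> (\<exists>p\<in>{1..k}. \<exists>q\<in>{1..k}. p \<noteq> q \<and> \<bar>x p - x q\<bar> < d))"
proof (cases "\<forall>q\<in>{1..k}. x q \<in> {t..<T}")
  case True
  have "\<forall>q. \<exists>j. q \<in> {1..k} \<longrightarrow> j < N \<and> \<tau> j \<le> x q \<and> x q < \<tau> (Suc j)"
    using interval_partition_cell[OF ip] True by (metis atLeastLessThan_iff)
  from choice[OF this] obtain l0 where l0: "\<And>q. q \<in> {1..k} \<Longrightarrow> l0 q < N \<and> \<tau> (l0 q) \<le> x q \<and> x q < \<tau> (Suc (l0 q))" by blast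
  define l where "l = restrict l0 {1..k}"
  have l: "l \<in> {1..k} \<rightarrow>\<^sub>E {..<N}" using l0 by (auto simp: l_def)
  have x: "x q \<in> {\<tau> (l q)..<\<tau> (Suc (l q))}" if "q \<in> {1..k}" for q using l0[OF that] that by (simp add: l_def)
  have step: "step_function k N \<tau> a x = a l" by (rule step_function_cell[OF ip l x])
  show ?thesis
  proof (cases "inj_on l {1..k}")
    case True
    have "G x = (\<Prod>q=1..k. c q (l q))"
      unfolding G_def
    proof (rule prod.cong[OF refl])
      fix q assume q: "q \<in> {1..k}"
      show "(\<Sum>j<N. c q j * indicator {\<tau> j..<\<tau> (Suc j)} (x q)) = c q (l q)"
        by (rule partition_sum_cell[OF ip]) (use l0[OF q] q in \<open>auto simp: l_def\<close>)
    qed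
    then show ?thesis using step True by (simp add: a_def)
  next
    case False
    then obtain p q where pq: "p \<in> {1..k}" "q \<in> {1..k}" "p \<noteq> q" "l p = l q" by (auto simp: inj_on_def)
    have "l p < N" using l pq by auto
    then have "\<bar>x p - x q\<bar> < d" using x[OF pq(1)] x[OF pq(2)] mesh[of "l p"] pq(4) by auto
    moreover have "a l = 0" using False by (simp add: a_def)
    ultimately have "step_function k N \<tau> a x = 0" "\<bar>x p - x q\<bar> < d" using step by simp_all
    then have "\<exists>p\<in>{1..k}. \<exists>q\<in>{1..k}. p \<noteq> q \<and> \<bar>x p - x q\<bar> < d"
      by (intro bexI[of _ p] bexI[of _ q] conjI pq(1-3))
    with \<open>step_function k N \<tau> a x = 0\<close> show ?thesis by (intro disjI2 conjI)
  qed
next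
  \<comment> \<open>Some coordinate lies outside every cell, for example at \<open>T\<close>, and
    both functions vanish.\<close>
  case False
  then obtain q where q: "q \<in> {1..k}" "x q \<notin> {t..<T}" by blast
  have "(\<Sum>j<N. c q j * indicator {\<tau> j..<\<tau> (Suc j)} (x q)) = 0" by (rule partition_support[OF ip q(2)])
  then have G: "G x = 0" unfolding G_def using q(1) by (intro prod_zero) auto
  have "step_function k N \<tau> a x = 0"
    unfolding step_function_def
  proof (rule sum.neutral, rule ballI)
    fix l assume "l \<in> {1..k} \<rightarrow>\<^sub>E {..<N}"
    then have "l q < N" using q(1) by auto
    then have "x q \<notin> {\<tau> (l q)..<\<tau> (Suc (l q))}" using interval_partition_bounds[OF ip, of "l q"] q(2) by auto
    then have "(\<Prod>q=1..k. indicator {\<tau> (l q)..<\<tau> (Suc (l q))} (x q)) = (0::real)"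
      using q(1) by (intro prod_zero) (auto intro!: bexI[of _ q])
    then show "a l * (\<Prod>q=1..k. indicator {\<tau> (l q)..<\<tau> (Suc (l q))} (x q)) = 0" by simp
  qed
  then show ?thesis using G by simp
qed

text \<open>Almost every point has distinct coordinates and so leaves the shrinking neighbourhoods
  of the diagonals; \<open>\<Phi>\<^sup>2\<close> dominates.\<close>

lemma near_diagonal_vanishes:
  assumes \<Phi>: "square_integrable (cube t T k) \<Phi>" and d: "d \<longlonglongrightarrow> 0"
  shows "(\<lambda>N. \<integral>x. (if \<exists>p\<in>{1..k}. \<exists>q\<in>{1..k}. p \<noteq> q \<and> \<bar>x p - x q\<bar> < d N then (\<Phi> x)\<^sup>2 else 0) \<partial>cube t T k) \<longlonglongrightarrow> 0"
    "integrable (cube t T k) (\<lambda>x. if \<exists>p\<in>{1..k}. \<exists>q\<in>{1..k}. p \<noteq> q \<and> \<bar>x p - x q\<bar> < d N then (\<Phi> x)\<^sup>2 else 0)"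
proof -
  let ?B = "\<lambda>N x. \<exists>p\<in>{1..k}. \<exists>q\<in>{1..k}. p \<noteq> q \<and> \<bar>x p - x q\<bar> < d N"
  let ?u = "\<lambda>N x. if ?B N x then (\<Phi> x)\<^sup>2 else 0"
  note int = square_integrableD(2)[OF \<Phi>]
  have Bm: "{x \<in> space (cube t T k). ?B N x} \<in> sets (cube t T k)" for N
    by (intro sets.sets_Collect_finite_Ex sets.sets_Collect_conj sets.sets_Collect_const borel_measurable_less
        borel_measurable_abs borel_measurable_diff cube_component) auto
  have m: "?u N \<in> borel_measurable (cube t T k)" for N
    by (rule measurable_If[OF borel_measurable_integrable[OF int] borel_measurable_const Bm])
  show "integrable (cube t T k) (?u N)"
    by (rule Bochner_Integration.integrable_bound[OF int m]) auto
  have "(\<lambda>N. \<integral>x. ?u N x \<partial>cube t T k) \<longlonglongrightarrow> (\<integral>x. 0 \<partial>cube t T k)"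
  proof (rule integral_dominated_convergence[where w="\<lambda>x. (\<Phi> x)\<^sup>2"])
    show "AE x in cube t T k. (\<lambda>N. ?u N x) \<longlonglongrightarrow> 0"
      using AE_cube_inj
    proof eventually_elim
      case (elim x)
      have "\<forall>\<^sub>F N in sequentially. \<forall>p\<in>{1..k}. \<forall>q\<in>{1..k}. \<not> (p \<noteq> q \<and> \<bar>x p - x q\<bar> < d N)"
      proof (intro eventually_ball_finite ballI finite_atLeastAtMost)
        fix p q assume pq: "p \<in> {1..k}" "q \<in> {1..k}"
        show "\<forall>\<^sub>F N in sequentially. \<not> (p \<noteq> q \<and> \<bar>x p - x q\<bar> < d N)"
        proof (cases "p = q")
          case False
          then have "x p \<noteq> x q" using elim pq by (auto dest: inj_onD)
          then have "\<forall>\<^sub>F N in sequentially. d N < \<bar>x p - x q\<bar>" by (intro order_tendstoD(2)[OF d]) simp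
          then show ?thesis by eventually_elim simp
        qed simp
      qed
      then have "\<forall>\<^sub>F N in sequentially. ?u N x = 0" 
      proof eventually_elim
        case (elim N)
        have "\<not> ?B N x"
        proof (rule notI, elim bexE)
          fix p q assume "p \<in> {1..k}" "q \<in> {1..k}" "p \<noteq> q \<and> \<bar>x p - x q\<bar> < d N"
          then show False using elim[THEN bspec, THEN bspec, of p q] by simp
        qed
        then show ?case by (rule if_not_P)
      qed
      then show ?case by (rule tendsto_eventually)
    qed
    show "AE x in cube t T k. norm (?u N x) \<le> (\<Phi> x)\<^sup>2" for N by (intro AE_I2) auto
  qed (rule borel_measurable_const m int)+
  then show "(\<lambda>N. \<integral>x. ?u N x \<partial>cube t T k) \<longlonglongrightarrow> 0" unfolding Bochner_Integration.integral_zero .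
qed

text \<open>Products of one-dimensional step functions approximate the tensor but charge the
  diagonal cells. Setting those coefficients to 0 adds at most the integral of
  \<open>\<Phi>\<^sup>2\<close> near the diagonals.\<close>

lemma multiple_wiener_integral_exists:
  assumes f: "admissible k f i"
  shows "has_multiple_wiener_integral M W t T k i (\<lambda>x. \<Prod>q=1..k. f q (x q)) (symmetrized_ito k f i)"
proof -
  let ?\<tau> = "uniform_partition t T"
  let ?\<sigma> = "\<lambda>c N r. \<Sum>j<N. c N j * indicator {?\<tau> N j..<?\<tau> N (Suc j)} r :: real"
  have i: "\<forall>q\<in>{1..k}. i q \<in> {1..m}" and sf: "\<And>q. q \<in> {1..k} \<Longrightarrow> square_integrable L (f q)"
    using f by (auto simp: admissible_def)
  have "\<forall>q. \<exists>c. q \<in> {1..k} \<longrightarrow> (\<lambda>N. \<integral>r. (f q r - ?\<sigma> c N r)\<^sup>2 \<partial>L) \<longlonglongrightarrow> 0"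
    using l2_step_approx[OF t(2) sf] by blast
  from choice[OF this] obtain c where c: "\<And>q. q \<in> {1..k} \<Longrightarrow> (\<lambda>N. \<integral>r. (f q r - ?\<sigma> (c q) N r)\<^sup>2 \<partial>L) \<longlonglongrightarrow> 0" by blast
  have l1: "l2_tendsto L (\<lambda>N r. ?\<sigma> (c q) N r) (f q)" if q: "q \<in> {1..k}" for q
    using c[OF q] sf[OF q] square_integrable_step by (simp add: l2_tendsto_def power2_commute)
  define G where "G N x = (\<Prod>q=1..k. ?\<sigma> (c q) N (x q))" for N x
  define \<Phi> where "\<Phi> x = (\<Prod>q=1..k. f q (x q))" for x
  have lG: "l2_tendsto (cube t T k) G \<Phi>"
    unfolding G_def[abs_def] \<Phi>_def[abs_def] by (rule tensor_l2_tendsto) (rule l1)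
  define a where "a N l = (if inj_on l {1..k} then \<Prod>q=1..k. c q N (l q) else 0)" for N l
  have a0: "\<forall>N. \<forall>l\<in>{1..k} \<rightarrow>\<^sub>E {..<N}. \<not> inj_on l {1..k} \<longrightarrow> a N l = 0" by (simp add: a_def)
  define d where "d N = (T - t) / real N" for N
  have d0: "d \<longlonglongrightarrow> 0" unfolding d_def[abs_def] by (rule lim_const_over_n)
  let ?st = "\<lambda>N. step_function k N (?\<tau> N) (a N)"
  let ?B = "\<lambda>N x. \<exists>p\<in>{1..k}. \<exists>q\<in>{1..k}. p \<noteq> q \<and> \<bar>x p - x q\<bar> < d N"
  have ip: "interval_partition t T N (?\<tau> N)" if "0 < N" for N by (rule interval_partition_uniform[OF t(2) that])
  note sqF = l2_tendstoD(2)[OF lG] and sqG = l2_tendstoD(1)[OF lG]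
  \<comment> \<open>For \<open>N = 0\<close> there are no cells, but with \<open>k = 0\<close> one
    empty multi-index remains; in each case the functions are constant.\<close>
  have empty: "{1..k} \<rightarrow>\<^sub>E {..<0::nat} = (if k = 0 then {\<lambda>_. undefined} else {})"
    by (auto simp: PiE_eq_empty_iff)
  have sqst: "square_integrable (cube t T k) (?st N)" for N
  proof (cases "0 < N")
    case True
    show ?thesis by (rule step_function_square_integrable[OF ip[OF True] i])
  next
    case False
    then have N: "N = 0" by simp
    have "\<exists>c0. ?st N = (\<lambda>_. c0)"
    proof (cases "k = 0")
      case True
      then show ?thesis by (intro exI[of _ "a 0 (\<lambda>_. undefined)"]) (simp add: step_function_def[abs_def] N)
    next
      case False
      show ?thesis unfolding step_function_def[abs_def] N empty if_not_P[OF False] by (intro exI[of _ 0]) simp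
    qed
    then obtain c0 where "?st N = (\<lambda>_. c0)" by blast
    then show ?thesis using integrable_mult_right[of "c0\<^sup>2", OF cube_emeasure_finite]
      by (simp add: square_integrable_def)
  qed
  have sqsw: "square_integrable M (step_wiener_integral W i k N (?\<tau> N) (a N))" for N
  proof (cases "0 < N")
    case True
    show ?thesis by (rule step_wiener_square_integrable[OF ip[OF True] i]) (use a0 in blast)
  next
    case False
    then have N: "N = 0" by simp
    have "\<exists>c0. step_wiener_integral W i k N (?\<tau> N) (a N) = (\<lambda>_. c0)"
    proof (cases "k = 0")
      case True
      then show ?thesis by (intro exI[of _ "a 0 (\<lambda>_. undefined)"]) (simp add: step_wiener_integral_def[abs_def] N)
    next
      case False
      show ?thesis unfolding step_wiener_integral_def[abs_def] N empty if_not_P[OF False] by (intro exI[of _ 0]) simp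
    qed
    then obtain c0 where "step_wiener_integral W i k N (?\<tau> N) (a N) = (\<lambda>_. c0)" by blast
    then show ?thesis by (simp add: square_integrable_def)
  qed
  have bound: "(\<integral>x. (?st N x - \<Phi> x)\<^sup>2 \<partial>cube t T k) \<le>
     (\<integral>x. (G N x - \<Phi> x)\<^sup>2 \<partial>cube t T k) + (\<integral>x. (if ?B N x then (\<Phi> x)\<^sup>2 else 0) \<partial>cube t T k)" if N: "0 < N" for N
  proof -
    have i1: "integrable (cube t T k) (\<lambda>x. (G N x - \<Phi> x)\<^sup>2)"
      by (rule square_integrableD(2)[OF square_integrable_diff[OF sqG sqF]])
    have i2: "integrable (cube t T k) (\<lambda>x. if ?B N x then (\<Phi> x)\<^sup>2 else 0)"
      by (rule near_diagonal_vanishes(2)[OF sqF d0])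
    have i3: "integrable (cube t T k) (\<lambda>x. (?st N x - \<Phi> x)\<^sup>2)"
      by (rule square_integrableD(2)[OF square_integrable_diff[OF sqst sqF]])
    have "(\<integral>x. (?st N x - \<Phi> x)\<^sup>2 \<partial>cube t T k) \<le> (\<integral>x. (G N x - \<Phi> x)\<^sup>2 + (if ?B N x then (\<Phi> x)\<^sup>2 else 0) \<partial>cube t T k)"
    proof (rule integral_mono[OF i3 Bochner_Integration.integrable_add[OF i1 i2]])
      fix x
      have "?\<tau> N (Suc j) - ?\<tau> N j \<le> d N" for j by (simp add: uniform_partition_step d_def)
      from off_diagonal_dichotomy[where \<tau>="?\<tau> N" and d="d N" and k=k and c="\<lambda>q. c q N" and x=x, OF ip[OF N] this]
      have "?st N x = G N x \<or> (?st N x = 0 \<and> ?B N x)" unfolding a_def[abs_def] G_def .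
      then show "(?st N x - \<Phi> x)\<^sup>2 \<le> (G N x - \<Phi> x)\<^sup>2 + (if ?B N x then (\<Phi> x)\<^sup>2 else 0)"
      proof
        \<comment> \<open>Where a nonzero value was dropped, the error is exactly
          \<open>\<Phi>\<^sup>2\<close>.\<close>
        assume "?st N x = 0 \<and> ?B N x"
        then have B: "?B N x" and z: "?st N x = 0" by (rule conjunct2, rule conjunct1)
        show ?thesis unfolding if_P[OF B] z by simp
      qed simp
    qed
    also have "\<dots> = (\<integral>x. (G N x - \<Phi> x)\<^sup>2 \<partial>cube t T k) + (\<integral>x. (if ?B N x then (\<Phi> x)\<^sup>2 else 0) \<partial>cube t T k)"
      by (rule Bochner_Integration.integral_add[OF i1 i2])
    finally show ?thesis .
  qed
  have "(\<lambda>N. \<integral>x. (?st N x - \<Phi> x)\<^sup>2 \<partial>cube t T k) \<longlonglongrightarrow> 0"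
  proof (rule tendsto_sandwich[OF _ _ tendsto_const])
    show "\<forall>\<^sub>F N in sequentially. (\<integral>x. (?st N x - \<Phi> x)\<^sup>2 \<partial>cube t T k) \<le>
      (\<integral>x. (G N x - \<Phi> x)\<^sup>2 \<partial>cube t T k) + (\<integral>x. (if ?B N x then (\<Phi> x)\<^sup>2 else 0) \<partial>cube t T k)"
      using eventually_gt_at_top[of 0] by eventually_elim (rule bound)
    show "(\<lambda>N. (\<integral>x. (G N x - \<Phi> x)\<^sup>2 \<partial>cube t T k) + (\<integral>x. (if ?B N x then (\<Phi> x)\<^sup>2 else 0) \<partial>cube t T k)) \<longlonglongrightarrow> 0"
      using tendsto_add[OF l2_tendstoD(3)[OF lG] near_diagonal_vanishes(1)[OF sqF d0]] by simp
  qed simp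
  then have lst: "l2_tendsto (cube t T k) ?st \<Phi>" using sqst sqF by (simp add: l2_tendsto_def)
  have lst': "l2_tendsto (cube t T k) ?st (\<lambda>x. \<Prod>q=1..k. f q (x q))"
    using lst unfolding \<Phi>_def[abs_def] .
  note \<tau> = refining_partitions_uniform[OF t(2)]
  have lW: "l2_tendsto M (\<lambda>N. step_wiener_integral W i k N (?\<tau> N) (a N)) (symmetrized_ito k f i)"
    by (rule step_wiener_l2_tendsto[where \<tau>="?\<tau>" and a=a and f=f, OF f \<tau> a0 lst' sqsw])
  show ?thesis
    unfolding has_multiple_wiener_integral_def
    by (rule exI[of _ ?\<tau>], rule exI[of _ a]) (rule conjI[OF \<tau> conjI[OF a0 conjI[OF lst' lW]]])
qed

text \<open>Existence turns \<open>SOME\<close> into a witness, and every witness agrees almost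
  surely with the symmetrized integral. Measurability is read off from the witness's own limit, as
  an almost sure identity would not supply it.\<close>

lemma multiple_wiener_integral_eq:
  assumes f: "admissible k f i"
  shows "square_integrable M (multiple_wiener_integral M W t T k i (\<lambda>x. \<Prod>q=1..k. f q (x q)))"
    "AE \<omega> in M. multiple_wiener_integral M W t T k i (\<lambda>x. \<Prod>q=1..k. f q (x q)) \<omega> = symmetrized_ito k f i \<omega>"
proof -
  have has: "has_multiple_wiener_integral M W t T k i (\<lambda>x. \<Prod>q=1..k. f q (x q))
     (multiple_wiener_integral M W t T k i (\<lambda>x. \<Prod>q=1..k. f q (x q)))"
    unfolding multiple_wiener_integral_def
    by (rule someI[where P="has_multiple_wiener_integral M W t T k i (\<lambda>x. \<Prod>q=1..k. f q (x q))",
          OF multiple_wiener_integral_exists[OF f]])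
  show "AE \<omega> in M. multiple_wiener_integral M W t T k i (\<lambda>x. \<Prod>q=1..k. f q (x q)) \<omega> = symmetrized_ito k f i \<omega>"
    by (rule multiple_wiener_integral_unique[where f=f, OF f has])
  show "square_integrable M (multiple_wiener_integral M W t T k i (\<lambda>x. \<Prod>q=1..k. f q (x q)))"
  proof -
    obtain \<tau> a where "l2_tendsto M (\<lambda>N. step_wiener_integral W i k N (\<tau> N) (a N))
        (multiple_wiener_integral M W t T k i (\<lambda>x. \<Prod>q=1..k. f q (x q)))"
      using has unfolding has_multiple_wiener_integral_def by (elim exE conjE)
    then show ?thesis by (rule l2_tendstoD(2))
  qed
qed


subsection \<open>The mean-square error\<close>

context
  fixes k p :: nat and i :: "nat \<Rightarrow> nat" and \<psi> \<phi> :: "nat \<Rightarrow> real \<Rightarrow> real"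
  assumes \<psi>: "admissible k \<psi> i"
    and \<phi>: "complete_orthonormal_system L \<phi>"
begin

abbreviation "indices \<equiv> {1..k} \<rightarrow>\<^sub>E {0..p}"
abbreviation "fcoeff j \<equiv> fourier_coeff t T k \<psi> \<phi> j"
abbreviation "S j \<equiv> symmetrized_ito k (\<lambda>l. \<phi> (j l)) i"

lemma basis_admissible: "admissible k (\<lambda>l. \<phi> (j l)) i"
  using \<psi> \<phi> by (auto simp: admissible_def complete_orthonormal_system_def)

lemma fourier_coeff_ordered:
  "fcoeff j = (\<integral>x. (if ordered_on k x then \<Prod>q=1..k. \<psi> q (x q) * \<phi> (j q) (x q) else 0) \<partial>cube t T k)"
  unfolding fourier_coeff_def
  by (intro Bochner_Integration.integral_cong refl) (auto simp: ordered_kernel_def ordered_on_def prod.distrib)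

text \<open>The kernel is the tensor of \<open>\<psi>\<close> cut off outside the ordered simplex,
  so the simplex integrals that occur here are Fourier coefficients.\<close>

lemma iterated_basis_inner:
  "(\<integral>\<omega>. J \<psi> i k T \<omega> * S j \<omega> \<partial>M) =
    (\<Sum>\<sigma> | \<sigma> permutes {1..k}. if \<forall>q\<in>{1..k}. i q = i (\<sigma> q) then fcoeff (\<lambda>q. j (\<sigma> q)) else 0)"
  unfolding iterated_symmetrized_inner[OF \<psi> basis_admissible] fourier_coeff_ordered ..

lemma basis_inner:
  "(\<integral>\<omega>. S j \<omega> * S j' \<omega> \<partial>M) =
    (\<Sum>\<rho> | \<rho> permutes {1..k}. if \<forall>q\<in>{1..k}. i (\<rho> q) = i q then (if \<forall>q\<in>{1..k}. j (\<rho> q) = j' q then 1 else 0) else 0)"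
proof -
  have eq: "(\<Prod>q=1..k. \<integral>r. \<phi> (j (\<rho> q)) r * \<phi> (j' q) r \<partial>L) = (if \<forall>q\<in>{1..k}. j (\<rho> q) = j' q then 1 else 0)" for \<rho>
  proof -
    have "(\<Prod>q=1..k. \<integral>r. \<phi> (j (\<rho> q)) r * \<phi> (j' q) r \<partial>L) = (\<Prod>q=1..k. if j (\<rho> q) = j' q then 1 else 0)"
      using \<phi> by (simp add: complete_orthonormal_system_def)
    also have "\<dots> = (if \<forall>q\<in>{1..k}. j (\<rho> q) = j' q then 1 else 0)"
      by (auto intro!: prod_zero)
    finally show ?thesis .
  qed
  show ?thesis unfolding symmetrized_inner[OF basis_admissible basis_admissible] eq ..
qed

text \<open>The Fourier coefficients solve the normal equations for projecting \<open>J\<close> on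
  the span of the \<open>S j\<close>: for each permutation \<open>\<rho>\<close> exactly one index
  matches, namely \<open>j \<circ> \<rho>\<close>, and it carries the coefficient that occurs in
  \<open>iterated_basis_inner\<close>.\<close>

lemma sum_basis_inner:
  assumes j: "j \<in> indices"
  shows "(\<Sum>j'\<in>indices. fcoeff j' * (\<integral>\<omega>. S j \<omega> * S j' \<omega> \<partial>M)) = (\<integral>\<omega>. J \<psi> i k T \<omega> * S j \<omega> \<partial>M)"
proof -
  let ?P = "{\<rho>. \<rho> permutes {1..k}}"
  have fin: "finite indices" by (intro finite_PiE) auto
  have "(\<Sum>j'\<in>indices. fcoeff j' * (\<integral>\<omega>. S j \<omega> * S j' \<omega> \<partial>M)) =
    (\<Sum>j'\<in>indices. \<Sum>\<rho>\<in>?P. if \<forall>q\<in>{1..k}. i (\<rho> q) = i q then (if \<forall>q\<in>{1..k}. j (\<rho> q) = j' q then fcoeff j' else 0) else 0)"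
    unfolding basis_inner sum_distrib_left by (intro sum.cong refl) auto
  also have "\<dots> = (\<Sum>\<rho>\<in>?P. \<Sum>j'\<in>indices. if \<forall>q\<in>{1..k}. i (\<rho> q) = i q then (if \<forall>q\<in>{1..k}. j (\<rho> q) = j' q then fcoeff j' else 0) else 0)"
    by (rule sum.swap)
  also have "\<dots> = (\<Sum>\<rho>\<in>?P. if \<forall>q\<in>{1..k}. i q = i (\<rho> q) then fcoeff (\<lambda>q. j (\<rho> q)) else 0)"
  proof (rule sum.cong[OF refl])
    fix \<rho> assume "\<rho> \<in> ?P"
    then have \<rho>: "\<rho> permutes {1..k}" by simp
    \<comment> \<open>The bound \<open>p\<close> is the same in each coordinate, and
      \<open>\<rho>\<close> fixes every point off \<open>{1..k}\<close>, so the value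
      \<open>undefined\<close> is kept there.\<close>
    have mem: "(\<lambda>q. j (\<rho> q)) \<in> indices"
    proof (rule PiE_I)
      fix q assume "q \<in> {1..k}"
      then have "\<rho> q \<in> {1..k}" unfolding permutes_in_image[OF \<rho>] .
      then show "j (\<rho> q) \<in> {0..p}" using j by auto
    next
      fix q assume q: "q \<notin> {1..k}"
      then show "j (\<rho> q) = undefined" using permutes_not_in[OF \<rho> q] j by (simp add: PiE_arb[OF j])
    qed
    have eq: "(\<forall>q\<in>{1..k}. j (\<rho> q) = j' q) \<longleftrightarrow> j' = (\<lambda>q. j (\<rho> q))" if "j' \<in> indices" for j'
      using PiE_ext[OF that mem] by auto
    have sum: "(\<Sum>j'\<in>indices. if \<forall>q\<in>{1..k}. j (\<rho> q) = j' q then fcoeff j' else 0) = fcoeff (\<lambda>q. j (\<rho> q))"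
    proof -
      have "(\<Sum>j'\<in>indices. if \<forall>q\<in>{1..k}. j (\<rho> q) = j' q then fcoeff j' else 0) =
        (\<Sum>j'\<in>indices. if j' = (\<lambda>q. j (\<rho> q)) then fcoeff (\<lambda>q. j (\<rho> q)) else 0)"
      proof (rule sum.cong[OF refl])
        fix j' assume "j' \<in> indices"
        from eq[OF this] show "(if \<forall>q\<in>{1..k}. j (\<rho> q) = j' q then fcoeff j' else 0) =
          (if j' = (\<lambda>q. j (\<rho> q)) then fcoeff (\<lambda>q. j (\<rho> q)) else 0)"
          by (cases "j' = (\<lambda>q. j (\<rho> q))") (simp_all only: if_True if_False)
      qed
      then show ?thesis using mem fin by simp
    qed
    have comm: "(\<forall>q\<in>{1..k}. i (\<rho> q) = i q) \<longleftrightarrow> (\<forall>q\<in>{1..k}. i q = i (\<rho> q))" by auto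
    show "(\<Sum>j'\<in>indices. if \<forall>q\<in>{1..k}. i (\<rho> q) = i q then (if \<forall>q\<in>{1..k}. j (\<rho> q) = j' q then fcoeff j' else 0) else 0) =
      (if \<forall>q\<in>{1..k}. i q = i (\<rho> q) then fcoeff (\<lambda>q. j (\<rho> q)) else 0)"
      unfolding comm
    proof (cases "\<forall>q\<in>{1..k}. i q = i (\<rho> q)")
      case True
      show "(\<Sum>j'\<in>indices. if \<forall>q\<in>{1..k}. i q = i (\<rho> q) then (if \<forall>q\<in>{1..k}. j (\<rho> q) = j' q then fcoeff j' else 0) else 0) =
        (if \<forall>q\<in>{1..k}. i q = i (\<rho> q) then fcoeff (\<lambda>q. j (\<rho> q)) else 0)"
        unfolding if_P[OF True] by (rule sum)
    next
      case False
      show "(\<Sum>j'\<in>indices. if \<forall>q\<in>{1..k}. i q = i (\<rho> q) then (if \<forall>q\<in>{1..k}. j (\<rho> q) = j' q then fcoeff j' else 0) else 0) =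
        (if \<forall>q\<in>{1..k}. i q = i (\<rho> q) then fcoeff (\<lambda>q. j (\<rho> q)) else 0)"
        unfolding if_not_P[OF False] by (rule sum.neutral_const)
    qed
  qed
  finally show ?thesis unfolding iterated_basis_inner .
qed

lemma approx_integral_eq:
  "approx_integral M W t T k \<psi> i \<phi> p \<in> borel_measurable M"
  "AE \<omega> in M. approx_integral M W t T k \<psi> i \<phi> p \<omega> = (\<Sum>j\<in>indices. fcoeff j * S j \<omega>)"
proof -
  have fin: "finite indices" by (intro finite_PiE) auto
  note eq = multiple_wiener_integral_eq[OF basis_admissible]
  show "approx_integral M W t T k \<psi> i \<phi> p \<in> borel_measurable M"
    unfolding approx_integral_def[abs_def]
    by (intro borel_measurable_sum borel_measurable_times borel_measurable_const square_integrableD(1)[OF eq(1)])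
  have "AE \<omega> in M. \<forall>j\<in>indices. multiple_wiener_integral M W t T k i (\<lambda>x. \<Prod>q=1..k. \<phi> (j q) (x q)) \<omega> = S j \<omega>"
    by (rule AE_finite_allI[OF fin eq(2)])
  then show "AE \<omega> in M. approx_integral M W t T k \<psi> i \<phi> p \<omega> = (\<Sum>j\<in>indices. fcoeff j * S j \<omega>)"
    by eventually_elim (auto simp: approx_integral_def intro!: sum.cong)
qed

lemma mean_square_error:
  "(\<integral>\<omega>. (J \<psi> i k T \<omega> - approx_integral M W t T k \<psi> i \<phi> p \<omega>)\<^sup>2 \<partial>M) =
    (\<integral>x. (ordered_kernel k \<psi> x)\<^sup>2 \<partial>cube t T k) - (\<Sum>j\<in>indices. fcoeff j * (\<integral>\<omega>. J \<psi> i k T \<omega> * S j \<omega> \<partial>M))"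
proof -
  let ?J = "J \<psi> i k T"
  define B where "B \<omega> = (\<Sum>j\<in>indices. fcoeff j * S j \<omega>)" for \<omega>
  have sqS: "square_integrable M (S j)" for j by (rule symmetrized_ito_square_integrable[OF basis_admissible])
  have sqJ: "square_integrable M ?J" using t by (intro iterated_ito_square_integrable[OF \<psi>]) auto
  have sqB: "square_integrable M B" unfolding B_def[abs_def] by (intro square_integrable_sum square_integrable_cmult sqS)
  have i1: "integrable M (\<lambda>\<omega>. ?J \<omega> * ?J \<omega>)" "integrable M (\<lambda>\<omega>. ?J \<omega> * B \<omega>)" "integrable M (\<lambda>\<omega>. B \<omega> * B \<omega>)"
    by (rule square_integrable_mult_integrable; (rule sqJ | rule sqB))+
  have JB: "(\<integral>\<omega>. X \<omega> * B \<omega> \<partial>M) = (\<Sum>j\<in>indices. fcoeff j * (\<integral>\<omega>. X \<omega> * S j \<omega> \<partial>M))" if X: "square_integrable M X" for X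
  proof -
    have "(\<integral>\<omega>. X \<omega> * B \<omega> \<partial>M) = (\<integral>\<omega>. (\<Sum>j\<in>indices. fcoeff j * (X \<omega> * S j \<omega>)) \<partial>M)"
      unfolding B_def sum_distrib_left by (simp add: mult_ac)
    also have "\<dots> = (\<Sum>j\<in>indices. \<integral>\<omega>. fcoeff j * (X \<omega> * S j \<omega>) \<partial>M)"
      by (intro Bochner_Integration.integral_sum integrable_mult_right square_integrable_mult_integrable X sqS)
    finally show ?thesis by simp
  qed
  \<comment> \<open>The normal equations enter here: \<open>?J - B\<close> is orthogonal to each
    \<open>S j\<close> with \<open>j\<close> in \<open>indices\<close>, hence to
    \<open>B\<close>.\<close>
  have BB: "(\<integral>\<omega>. B \<omega> * B \<omega> \<partial>M) = (\<integral>\<omega>. ?J \<omega> * B \<omega> \<partial>M)"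
  proof -
    have "(\<integral>\<omega>. B \<omega> * B \<omega> \<partial>M) = (\<Sum>j\<in>indices. fcoeff j * (\<integral>\<omega>. S j \<omega> * B \<omega> \<partial>M))"
      unfolding JB[OF sqB] by (simp add: mult.commute)
    also have "\<dots> = (\<Sum>j\<in>indices. fcoeff j * (\<integral>\<omega>. ?J \<omega> * S j \<omega> \<partial>M))"
      using sum_basis_inner by (intro sum.cong refl) (simp add: JB[OF sqS])
    finally show ?thesis unfolding JB[OF sqJ] .
  qed
  have JJ: "(\<integral>\<omega>. ?J \<omega> * ?J \<omega> \<partial>M) = (\<integral>x. (ordered_kernel k \<psi> x)\<^sup>2 \<partial>cube t T k)"
    unfolding iterated_ito_inner_T[OF \<psi> \<psi>]
    by (auto intro!: Bochner_Integration.integral_cong simp: ordered_kernel_def ordered_on_def prod.distrib power2_eq_square)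
  have "(\<integral>\<omega>. (?J \<omega> - approx_integral M W t T k \<psi> i \<phi> p \<omega>)\<^sup>2 \<partial>M) = (\<integral>\<omega>. (?J \<omega> - B \<omega>)\<^sup>2 \<partial>M)"
  proof (rule integral_cong_AE)
    show "(\<lambda>\<omega>. (?J \<omega> - approx_integral M W t T k \<psi> i \<phi> p \<omega>)\<^sup>2) \<in> borel_measurable M"
      by (intro borel_measurable_power borel_measurable_diff square_integrableD(1)[OF sqJ] approx_integral_eq(1))
    show "(\<lambda>\<omega>. (?J \<omega> - B \<omega>)\<^sup>2) \<in> borel_measurable M"
      by (intro borel_measurable_power borel_measurable_diff square_integrableD(1)[OF sqJ] square_integrableD(1)[OF sqB])
    show "AE \<omega> in M. (?J \<omega> - approx_integral M W t T k \<psi> i \<phi> p \<omega>)\<^sup>2 = (?J \<omega> - B \<omega>)\<^sup>2"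
      using approx_integral_eq(2) by eventually_elim (simp add: B_def)
  qed
  also have "\<dots> = (\<integral>\<omega>. ?J \<omega> * ?J \<omega> - 2 * (?J \<omega> * B \<omega>) + B \<omega> * B \<omega> \<partial>M)"
    by (intro Bochner_Integration.integral_cong refl) (simp add: power2_eq_square algebra_simps)
  also have "\<dots> = (\<integral>\<omega>. ?J \<omega> * ?J \<omega> \<partial>M) - 2 * (\<integral>\<omega>. ?J \<omega> * B \<omega> \<partial>M) + (\<integral>\<omega>. B \<omega> * B \<omega> \<partial>M)"
    using i1 by simp
  also have "\<dots> = (\<integral>x. (ordered_kernel k \<psi> x)\<^sup>2 \<partial>cube t T k) - (\<integral>\<omega>. ?J \<omega> * B \<omega> \<partial>M)"
    unfolding BB JJ by simp
  finally show ?thesis unfolding JB[OF sqJ] .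
qed

end

end

theorem theorem4:
  fixes M :: "'a measure" and F :: "real \<Rightarrow> 'a measure" and W :: "nat \<Rightarrow> real \<Rightarrow> 'a \<Rightarrow> real"
    and t T :: real and m k p :: nat and i :: "nat \<Rightarrow> nat"
    and \<psi> \<phi> :: "nat \<Rightarrow> real \<Rightarrow> real"
  assumes "prob_space M" and "complete_measure M"
    and "0 \<le> t" and "t < T"
    and "right_continuous_filtration M F T"
    and "wiener_process M F T m W"
    and "k \<ge> 1" and "\<forall>l\<in>{1..k}. i l \<in> {1..m}"
    and "\<forall>l\<in>{1..k}. square_integrable (lebesgue_on {t..T}) (\<psi> l)"
    and "complete_orthonormal_system (lebesgue_on {t..T}) \<phi>"
  shows "(\<integral>\<omega>. (iterated_ito_integral M F W t T k \<psi> i \<omega> - approx_integral M W t T k \<psi> i \<phi> p \<omega>)\<^sup>2 \<partial>M) =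
     (\<integral>x. (ordered_kernel k \<psi> x)\<^sup>2 \<partial>cube t T k) -
     (\<Sum>j\<in>{1..k} \<rightarrow>\<^sub>E {0..p}. fourier_coeff t T k \<psi> \<phi> j *
        (\<integral>\<omega>. iterated_ito_integral M F W t T k \<psi> i \<omega> *
           (\<Sum>\<sigma> | \<sigma> permutes {1..k}.
              iterated_ito_integral M F W t T k (\<lambda>l. \<phi> (j (\<sigma> l))) (\<lambda>l. i (\<sigma> l)) \<omega>) \<partial>M))"
proof -
  interpret prob_space M by fact
  interpret ito M F T m W t
    by unfold_locales fact+
  have "admissible k \<psi> i" using assms by (simp add: admissible_def)
  from mean_square_error[OF this \<open>complete_orthonormal_system (lebesgue_on {t..T}) \<phi>\<close>]
  show ?thesis unfolding iterated_ito_integral_def symmetrized_ito_def .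
qed

end
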